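(* Let $(M,\Delta)$ and $(M',\Delta')$ be decorated matrices with the same row sums $\mathbf b=(b_1,\dots,b_q)$ and column sums $\mathbf c=(c_1,\dots,c_r)$. Then the degeneration order and the move order are equivalent: $$(M,\Delta)\le_{\mathrm{deg}}(M',\Delta')\quad\Longleftrightarrow\quad (M,\Delta)\le_{\mathrm{mv}}(M',\Delta').$$
   Context: Let $\mathbf k$ be an infinite field (of arbitrary characteristic, not necessarily algebraically closed) and $V$ a vector space over $\mathbf k$ of dimension $n$. Write $[a,b]=\{a,\dots,b\}$. Fix two compositions of $n$, i.e. lists of positive integers $\mathbf b=(b_1,\dots,b_q)$ and $\mathbf c=(c_1,\dots,c_r)$ each with sum $n$. $\mathrm{Flag}(\mathbf b)$ is the variety of partial flags $B_\bullet=(0=B_0\subset B_1\subset\cdots\subset B_q=V)$ with $\dim(B_i/B_{i-1})=b_i$; similarly $\mathrm{Flag}(\mathbf c)$. $\mathbb P(V)$ is the variety of lines ($1$-dimensional subspaces) in $V$. $\mathrm{GL}(V)$ acts diagonally on $\mathbb P(V)\times\mathrm{Flag}(\mathbf b)\times\mathrm{Flag}(\mathbf c)$. A transport matrix is a $q\times r$ matrix $M=(m_{ij})$ of nonnegative integers with row sums $b_i$ and column sums $c_j$. A decorated matrix is a pair $(M,\Delta)$ with $M$ a transport matrix and $\Delta=\{(i_1,j_1),\dots,(i_t,j_t)\}\subset[1,q]\times[1,r]$ a nonempty set of positions with $i_1<\cdots<i_t$, $j_1>\cdots>j_t$, and $m_{ij}>0$ for all $(i,j)\in\Delta$. The orbit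 $F_{M,\Delta}$ is the set of all $(A,B_\bullet,C_\bullet)$ obtained as follows: take any basis $(v_{ijk})$ of $V$ indexed by $(i,j)\in[1,q]\times[1,r]$, $1\le k\le m_{ij}$, and put $B_i=\langle v_{i'jk}\mid i'\le i\rangle$, $C_j=\langle v_{ij'k}\mid j'\le j\rangle$, $A=\langle\sum_{(i,j)\in\Delta}v_{ij1}\rangle$. The $F_{M,\Delta}$ are the $\mathrm{GL}(V)$-orbits. Degeneration order: $(M,\Delta)\le_{\mathrm{deg}}(M',\Delta')$ iff $F_{M,\Delta}\subset\overline{F}_{M',\Delta'}$ (Zariski closure). Notation on positions: $(i,j)\le(i',j')$ iff $i\le i'$ and $j\le j'$; $(i,j)<(i',j')$ means $\le$ and $\ne$. For a position $p$ and a set $\Delta$ of positions, $p\le\Delta$ means $p\le p'$ for some $p'\in\Delta$. For a set $S$ of positions, $[S]$ is the set of $\le$-maximal elements of $S$. $E_{ij}$ is the matrix with $1$ in position $(i,j)$ and $0$ elsewhere. Simple moves. Each of the following produces from a decorated matrix $(M,\Delta)$, $M=(m_{ij})$, a decorated matrix $(M',\Delta')$. (i) Suppose $(i_1,j_1)\not\le\Delta$, $m_{i_1j_1}>0$, and $m_{ij}=0$ whenever $(i,j)<(i_1,j_1)$ and $(i,j)\not\le\Delta$. Then $M'=M$, $\Delta'=[\Delta\cup\{(i_1,j_1)\}]$. (ii) Suppose $i_0<i_1$, $j_0<j_1$, $m_{i_0j_0},m_{i_1j_1}>0$, and $m_{ij}=0$ whenever $(i_0,j_0)<(i,j)<(i_1,j_1)$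 and $(i,j)\ne(i_0,j_1),(i_1,j_0)$. Suppose further that $(i_1,j_1)\notin\Delta$; that $(i_0,j_1)\notin\Delta$ or $(i_1,j_0)\notin\Delta$; and that $(i_0,j_0)\notin\Delta$ or $m_{i_0j_0}>1$. Then $M'=M-E_{i_0j_0}-E_{i_1j_1}+E_{i_0j_1}+E_{i_1j_0}$, $\Delta'=\Delta$. (iii)(a) Suppose $i_0<i_1$, $j_0<j_1$, $(i_0,j_0)\in\Delta$, $m_{i_0j_0}=1$, $m_{i_1j_1}>0$, and $m_{ij}=0$ both whenever $(i_0,j_0)<(i,j)<(i_1,j_1)$, $(i,j)\ne(i_1,j_0)$, and whenever $(i,j)\le(i_0,j_1)$, $(i,j)\not\le\Delta$. Then $M'=M-E_{i_0j_0}-E_{i_1j_1}+E_{i_0j_1}+E_{i_1j_0}$, $\Delta'=[\Delta\cup\{(i_0,j_1)\}]$. (iii)(b) Suppose $i_0<i_1$, $j_0<j_1$, $(i_0,j_0)\in\Delta$, $m_{i_0j_0}=1$, $m_{i_1j_1}>0$, and $m_{ij}=0$ both whenever $(i_0,j_0)<(i,j)<(i_1,j_1)$, $(i,j)\ne(i_0,j_1)$, and whenever $(i,j)\le(i_1,j_0)$, $(i,j)\not\le\Delta$. Then $M'=M-E_{i_0j_0}-E_{i_1j_1}+E_{i_0j_1}+E_{i_1j_0}$, $\Delta'=[\Delta\cup\{(i_1,j_0)\}]$. (iv)(a) Suppose $i_0<i_2<i_1$, $j_2<j_0<j_1$, $(i_0,j_0),(i_2,j_2)\in\Delta$, $m_{i_0j_0}=m_{i_2j_2}=1$,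 $m_{i_1j_1}>0$, and $m_{ij}=0$ whenever $(i_0,j_2)<(i,j)<(i_1,j_1)$, $(i,j)\not\le\Delta$ and $(i,j)\ne(i_0,j_1),(i_1,j_2)$. Then $M'=M-E_{i_0j_0}-E_{i_1j_1}-E_{i_2j_2}+E_{i_1j_2}+E_{i_2j_0}+E_{i_0j_1}$, $\Delta'=[\Delta\cup\{(i_2,j_0)\}]$. (iv)(b),(c) Suppose $i_0<i_1$, $j_0<j_1$, $m_{i_0j_0},m_{i_1j_1}>0$, and $m_{ij}=0$ whenever $(i_0,j_0)<(i,j)<(i_1,j_1)$, except for $(i,j)=(i_0,j_1),(i_1,j_0)$ and one further position, as specified in one of the following cases: (b) the further position is $(i_2,j_0)$ with $i_0<i_2<i_1$, where $(i_2,j_0)\in\Delta$, $m_{i_2j_0}=1$, and $(i_0,j_1)\not\le\Delta$; or (c) the further position is $(i_0,j_2)$ with $j_0<j_2<j_1$, where $(i_0,j_2)\in\Delta$, $m_{i_0j_2}=1$, and $(i_1,j_0)\not\le\Delta$. Then $M'=M-E_{i_0j_0}-E_{i_1j_1}+E_{i_0j_1}+E_{i_1j_0}$, $\Delta'=\Delta$. (v) Suppose, for some $t\ge1$, $i_0<i_1<\cdots<i_t$ and $j_1>j_2>\cdots>j_t>j_0$, with $(i_1,j_1),\dots,(i_t,j_t)\in\Delta$, $m_{i_0j_0}>0$, and $m_{ij}=0$ whenever $(i_0,j_0)<(i,j)\le(i_s-1,j_s-1)$ for some $s\in\{1,\dots,t\}$. Then $$M'=M-E_{i_0j_0}-\sum_{s=1}^tE_{i_sj_s}+E_{i_0j_1}+\sum_{s=1}^{t-1}E_{i_sj_{s+1}}+E_{i_tj_0},$$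 $$\Delta'=\big[\,(\Delta\setminus\{(i_0,j_0),(i_1,j_1),\dots,(i_t,j_t)\})\cup\{(i_0,j_1),(i_t,j_0)\}\,\big].$$ Move order: $(M,\Delta)\le_{\mathrm{mv}}(M'',\Delta'')$ iff $(M'',\Delta'')$ can be obtained from $(M,\Delta)$ by a finite (possibly empty) sequence of simple moves of types (i)–(v). *)

theory Defs
  imports Main "HOL.Hull" "HOL.Vector_Spaces" "HOL-Library.Product_Order"
begin

section \<open>Decorated matrices\<close>

text \<open>Positions are 1-based.  Product_Order equips pairs with the componentwise order, so
  \<open>(i, j) \<le> (i', j')\<close> iff \<open>i \<le> i'\<close> and \<open>j \<le> j'\<close>, and \<open><\<close> means \<open>\<le>\<close> and \<open>\<noteq>\<close>.\<close>

type_synonym pos = "nat \<times> nat"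
type_synonym posmat = "pos \<Rightarrow> nat"
type_synonym decmat = "posmat \<times> pos set"

definition composition :: "nat \<Rightarrow> nat list \<Rightarrow> bool" where
  "composition n b \<longleftrightarrow> (\<forall>x\<in>set b. 0 < x) \<and> sum_list b = n"

text \<open>Entries outside \<open>[1,q] \<times> [1,r]\<close> are fixed to be 0, so that equality of functions is equality
  of matrices.  The part \<open>b\<^sub>i\<close> of a composition is the list entry \<open>b ! (i - 1)\<close>.\<close>

definition transport :: "nat list \<Rightarrow> nat list \<Rightarrow> posmat \<Rightarrow> bool" where
  "transport b c M \<longleftrightarrow>
     (\<forall>p. p \<notin> {1..length b} \<times> {1..length c} \<longrightarrow> M p = 0) \<and>
     (\<forall>i\<in>{1..length b}. (\<Sum>j = 1..length c. M (i, j)) = b ! (i - 1)) \<and>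
     (\<forall>j\<in>{1..length c}. (\<Sum>i = 1..length b. M (i, j)) = c ! (j - 1))"

fun decorated :: "nat list \<Rightarrow> nat list \<Rightarrow> decmat \<Rightarrow> bool" where
  "decorated b c (M, D) \<longleftrightarrow>
     transport b c M \<and>
     (\<exists>ps. ps \<noteq> [] \<and> D = set ps \<and> sorted_wrt (\<lambda>(i, j) (i', j'). i < i' \<and> j > j') ps) \<and>
     D \<subseteq> {1..length b} \<times> {1..length c} \<and>
     (\<forall>p\<in>D. M p > 0)"

section \<open>The move order\<close>

definition below :: "pos \<Rightarrow> pos set \<Rightarrow> bool" where
  "below p D \<longleftrightarrow> (\<exists>p'\<in>D. p \<le> p')"

definition maxset :: "pos set \<Rightarrow> pos set" where
  "maxset S = {p \<in> S. \<not> (\<exists>p'\<in>S. p < p')}"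

definition E :: "pos \<Rightarrow> posmat" where
  "E p = (\<lambda>x. if x = p then 1 else 0)"

text \<open>Each rule takes a decorated matrix to a decorated matrix; the matrix units subtracted sit at
  distinct positions with positive entries, so subtraction in \<^typ>\<open>nat\<close> never truncates.\<close>

inductive simple_move :: "decmat \<Rightarrow> decmat \<Rightarrow> bool" where
  i:
  "simple_move (M, D) (M, maxset (D \<union> {(i1, j1)}))"
  if "\<not> below (i1, j1) D" "M (i1, j1) > 0"
     "\<forall>p. p < (i1, j1) \<and> \<not> below p D \<longrightarrow> M p = 0"
| ii:
  "simple_move (M, D)
     (\<lambda>x. M x - E (i0, j0) x - E (i1, j1) x + E (i0, j1) x + E (i1, j0) x, D)"
  if "i0 < i1" "j0 < j1" "M (i0, j0) > 0" "M (i1, j1) > 0"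
     "\<forall>p. (i0, j0) < p \<and> p < (i1, j1) \<and> p \<noteq> (i0, j1) \<and> p \<noteq> (i1, j0) \<longrightarrow> M p = 0"
     "(i1, j1) \<notin> D"
     "(i0, j1) \<notin> D \<or> (i1, j0) \<notin> D"
     "(i0, j0) \<notin> D \<or> M (i0, j0) > 1"
| iii_a:
  "simple_move (M, D)
     (\<lambda>x. M x - E (i0, j0) x - E (i1, j1) x + E (i0, j1) x + E (i1, j0) x,
      maxset (D \<union> {(i0, j1)}))"
  if "i0 < i1" "j0 < j1" "(i0, j0) \<in> D" "M (i0, j0) = 1" "M (i1, j1) > 0"
     "\<forall>p. (i0, j0) < p \<and> p < (i1, j1) \<and> p \<noteq> (i1, j0) \<longrightarrow> M p = 0"
     "\<forall>p. p \<le> (i0, j1) \<and> \<not> below p D \<longrightarrow> M p = 0"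
| iii_b:
  "simple_move (M, D)
     (\<lambda>x. M x - E (i0, j0) x - E (i1, j1) x + E (i0, j1) x + E (i1, j0) x,
      maxset (D \<union> {(i1, j0)}))"
  if "i0 < i1" "j0 < j1" "(i0, j0) \<in> D" "M (i0, j0) = 1" "M (i1, j1) > 0"
     "\<forall>p. (i0, j0) < p \<and> p < (i1, j1) \<and> p \<noteq> (i0, j1) \<longrightarrow> M p = 0"
     "\<forall>p. p \<le> (i1, j0) \<and> \<not> below p D \<longrightarrow> M p = 0"
| iv_a:
  "simple_move (M, D)
     (\<lambda>x. M x - E (i0, j0) x - E (i1, j1) x - E (i2, j2) x
              + E (i1, j2) x + E (i2, j0) x + E (i0, j1) x,
      maxset (D \<union> {(i2, j0)}))"
  if "i0 < i2" "i2 < i1" "j2 < j0" "j0 < j1"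
     "(i0, j0) \<in> D" "(i2, j2) \<in> D" "M (i0, j0) = 1" "M (i2, j2) = 1" "M (i1, j1) > 0"
     "\<forall>p. (i0, j2) < p \<and> p < (i1, j1) \<and> \<not> below p D \<and> p \<noteq> (i0, j1) \<and> p \<noteq> (i1, j2)
        \<longrightarrow> M p = 0"
| iv_b:
  "simple_move (M, D)
     (\<lambda>x. M x - E (i0, j0) x - E (i1, j1) x + E (i0, j1) x + E (i1, j0) x, D)"
  if "i0 < i1" "j0 < j1" "M (i0, j0) > 0" "M (i1, j1) > 0"
     "i0 < i2" "i2 < i1" "(i2, j0) \<in> D" "M (i2, j0) = 1" "\<not> below (i0, j1) D"
     "\<forall>p. (i0, j0) < p \<and> p < (i1, j1) \<and> p \<noteq> (i0, j1) \<and> p \<noteq> (i1, j0) \<and> p \<noteq> (i2, j0)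
        \<longrightarrow> M p = 0"
| iv_c:
  "simple_move (M, D)
     (\<lambda>x. M x - E (i0, j0) x - E (i1, j1) x + E (i0, j1) x + E (i1, j0) x, D)"
  if "i0 < i1" "j0 < j1" "M (i0, j0) > 0" "M (i1, j1) > 0"
     "j0 < j2" "j2 < j1" "(i0, j2) \<in> D" "M (i0, j2) = 1" "\<not> below (i1, j0) D"
     "\<forall>p. (i0, j0) < p \<and> p < (i1, j1) \<and> p \<noteq> (i0, j1) \<and> p \<noteq> (i1, j0) \<and> p \<noteq> (i0, j2)
        \<longrightarrow> M p = 0"
| v:
  "simple_move (M, D)
     (\<lambda>x. M x - E (i 0, j 0) x - (\<Sum>s = 1..t. E (i s, j s) x)
              + E (i 0, j 1) x + (\<Sum>s = 1..<t. E (i s, j (s + 1)) x) + E (i t, j 0) x,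
      maxset ((D - (\<lambda>s. (i s, j s)) ` {0..t}) \<union> {(i 0, j 1), (i t, j 0)}))"
  if "(t :: nat) \<ge> 1" "strict_mono_on {0..t} i" "strict_antimono_on {1..t} j" "j t > j 0"
     "\<forall>s\<in>{1..t}. (i s, j s) \<in> D" "M (i 0, j 0) > 0"
     "\<forall>p. (i 0, j 0) < p \<and> (\<exists>s\<in>{1..t}. p \<le> (i s - 1, j s - 1)) \<longrightarrow> M p = 0"

definition move_le :: "decmat \<Rightarrow> decmat \<Rightarrow> bool" where
  "move_le = simple_move\<^sup>*\<^sup>*"

section \<open>The degeneration order\<close>

type_synonym 'v config = "'v set \<times> 'v set list \<times> 'v set list"
type_synonym 'v frame = "'v \<times> (nat \<Rightarrow> 'v) \<times> (nat \<Rightarrow> 'v)"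

context vector_space
begin

definition basis_family :: "'i set \<Rightarrow> ('i \<Rightarrow> 'b) \<Rightarrow> bool" where
  "basis_family I v \<longleftrightarrow> inj_on v I \<and> independent (v ` I) \<and> span (v ` I) = UNIV"

definition Proj :: "'b set set" where
  "Proj = {A. subspace A \<and> dim A = 1}"

text \<open>A flag is the list \<open>[B\<^sub>0, \<dots>, B\<^sub>q]\<close>; the condition on the dimension of the quotient
  \<open>B\<^sub>i / B\<^sub>i\<^sub>-\<^sub>1\<close> is expressed by the difference of the dimensions.\<close>

definition Flag :: "nat list \<Rightarrow> 'b set list set" where
  "Flag b = {B. length B = length b + 1 \<and> (\<forall>U\<in>set B. subspace U) \<and>
     B ! 0 = {0} \<and> B ! length b = UNIV \<and>
     (\<forall>i\<in>{1..length b}. B ! (i - 1) \<subseteq> B ! i \<and> dim (B ! i) = dim (B ! (i - 1)) + b ! (i - 1))}"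

definition Triples :: "nat list \<Rightarrow> nat list \<Rightarrow> 'b config set" where
  "Triples b c = Proj \<times> Flag b \<times> Flag c"

definition index_set :: "nat \<Rightarrow> nat \<Rightarrow> posmat \<Rightarrow> (nat \<times> nat \<times> nat) set" where
  "index_set q r M = {(i, j, k). i \<in> {1..q} \<and> j \<in> {1..r} \<and> k \<in> {1..M (i, j)}}"

fun orbit :: "nat \<Rightarrow> nat \<Rightarrow> decmat \<Rightarrow> 'b config set" where
  "orbit q r (M, D) =
     {(span {\<Sum>(i, j)\<in>D. v (i, j, 1)},
       map (\<lambda>i. span {v (i', j, k) | i' j k. (i', j, k) \<in> index_set q r M \<and> i' \<le> i}) [0..<q + 1],
       map (\<lambda>j. span {v (i, j', k) | i j' k. (i, j', k) \<in> index_set q r M \<and> j' \<le> j}) [0..<r + 1])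
      | v. basis_family (index_set q r M) v}"

text \<open>The Zariski topology on (the rational points of) \<open>\<bbbP>(V) \<times> Flag(b) \<times> Flag(c)\<close> is the quotient
  topology for the presentation \<open>\<bbbP>(V) = (V - {0}) / \<bbbG>\<^sub>m\<close>, \<open>Flag(b) = GL(V) / P\<^sub>b\<close>,
  \<open>Flag(c) = GL(V) / P\<^sub>c\<close> as homogeneous varieties.  Elements of \<open>GL(V)\<close> are given as bases
  \<open>x\<^sub>1, \<dots>, x\<^sub>n\<close> of \<open>V\<close>, which map to the flag with \<open>B\<^sub>i\<close> the span of the first
  \<open>b\<^sub>1 + \<dots> + b\<^sub>i\<close> vectors.  The Zariski closed
  subsets of \<open>(V - {0}) \<times> GL(V) \<times> GL(V)\<close> are the zero sets in it of polynomials in the coordinates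
  of all the vectors; inverses of determinants are not needed, since they can be cleared.\<close>

definition frames :: "'b frame set" where
  "frames = {(a, x, y). a \<noteq> 0 \<and> basis_family {1..dim UNIV} x \<and> basis_family {1..dim UNIV} y}"

definition flag_of :: "nat list \<Rightarrow> (nat \<Rightarrow> 'b) \<Rightarrow> 'b set list" where
  "flag_of b x = map (\<lambda>i. span (x ` {1..sum_list (take i b)})) [0..<length b + 1]"

fun config_of :: "nat list \<Rightarrow> nat list \<Rightarrow> 'b frame \<Rightarrow> 'b config" where
  "config_of b c (a, x, y) = (span {a}, flag_of b x, flag_of c y)"

text \<open>Polynomial functions, without choice of coordinates: the algebra generated by the linear
  functionals applied to the individual vectors.\<close>

inductive_set polyfun :: "('b frame \<Rightarrow> 'a) set" where
  const: "(\<lambda>_. k) \<in> polyfun"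
| line: "Vector_Spaces.linear scale (*) \<phi> \<Longrightarrow> (\<lambda>(a, x, y). \<phi> a) \<in> polyfun"
| fst_flag: "Vector_Spaces.linear scale (*) \<phi> \<Longrightarrow> l \<in> {1..dim UNIV} \<Longrightarrow>
    (\<lambda>(a, x, y). \<phi> (x l)) \<in> polyfun"
| snd_flag: "Vector_Spaces.linear scale (*) \<phi> \<Longrightarrow> l \<in> {1..dim UNIV} \<Longrightarrow>
    (\<lambda>(a, x, y). \<phi> (y l)) \<in> polyfun"
| add: "f \<in> polyfun \<Longrightarrow> g \<in> polyfun \<Longrightarrow> (\<lambda>z. f z + g z) \<in> polyfun"
| mult: "f \<in> polyfun \<Longrightarrow> g \<in> polyfun \<Longrightarrow> (\<lambda>z. f z * g z) \<in> polyfun"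

definition zariski_closed :: "nat list \<Rightarrow> nat list \<Rightarrow> 'b config set \<Rightarrow> bool" where
  "zariski_closed b c Z \<longleftrightarrow> Z \<subseteq> Triples b c \<and>
     (\<exists>P \<subseteq> polyfun. \<forall>z\<in>frames. config_of b c z \<in> Z \<longleftrightarrow> (\<forall>f\<in>P. f z = 0))"

definition zariski_closure :: "nat list \<Rightarrow> nat list \<Rightarrow> 'b config set \<Rightarrow> 'b config set" where
  "zariski_closure b c S = zariski_closed b c hull S"

definition deg_le :: "nat list \<Rightarrow> nat list \<Rightarrow> decmat \<Rightarrow> decmat \<Rightarrow> bool" where
  "deg_le b c X X' \<longleftrightarrow>
     orbit (length b) (length c) X \<subseteq> zariski_closure b c (orbit (length b) (length c) X')"

end

end

theory Submission
  imports Defs "Jordan_Normal_Form.Determinant" "HOL-Computational_Algebra.Polynomial"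
begin

text \<open>Both orders are compared with a third one, the rank order (locale \<open>rank_pair\<close>).  The numbers
  \<open>dim (B\<^sub>i + C\<^sub>j)\<close> and \<open>dim (A + B\<^sub>i + C\<^sub>j)\<close> are lower semicontinuous and are determined on an orbit
  by the partial sums of \<open>M\<close> and by whether \<open>\<Delta>\<close> has an element strictly beyond \<open>(i, j)\<close> in both
  coordinates; so degeneration implies the rank order.  Each simple move is a degeneration along a
  curve of frames that is affine in its parameter.  Finally, if two decorated matrices differ and
  are comparable in the rank order, some simple move from the smaller one stays below the larger
  one.  First \<open>\<Delta>\<close> is enlarged by moves (i) as long as the rank conditions allow.  Then one looks at
  a maximal position \<open>e\<close> among those where both \<open>M\<close> and the excess of the partial sums of \<open>M\<close>
  over those of \<open>M'\<close> are positive.  A rectangle with lower corner \<open>e\<close> on which this excess is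
  positive and whose upper corner is again occupied always exists, by inclusion-exclusion at two
  consecutive corners of the region of positive excess, and it yields a move.\<close>

section \<open>Positions, rank functions and transport matrices\<close>

text \<open>The decoration is what makes the choice of a move delicate. Lowering the excess by one
  may bring it to 0 at a pair \<open>(i, j)\<close> beyond which \<Delta>' has no element; from then
  on no decorated position may lie strictly beyond \<open>(i, j)\<close>, so a swap that is fine for
  the matrices can be spoiled by an element of \<Delta>. Such an element turns out to be the upper
  corner of an admissible rectangle itself, and joining all of these in one staircase is the origin
  of move (v). A second obstacle arises when every maximal \<open>e\<close> is decorated and has
  entry 1: its only vector takes the decoration along, and both corners that could receive it may be
  forbidden, each by a pair on its own side. A second occupied position between these two pairs is
  then found by counting, and its place relative to \<open>e\<close> decides among (ii), (iv) and
  (v). The degeneration side works with rational points only, as the field need not be algebraically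
  closed; that it is infinite enters through one fact: a polynomial in one parameter that vanishes
  at all nonzero values vanishes at 0.\<close>

lemma pair_less_iff: "((i::nat, j::nat) < (k, l)) \<longleftrightarrow> i \<le> k \<and> j \<le> l \<and> (i < k \<or> j < l)"
  by (auto simp: less_prod_def less_eq_prod_def)

lemma below_iff: "below (i, j) D \<longleftrightarrow> (\<exists>k l. (k, l) \<in> D \<and> i \<le> k \<and> j \<le> l)"
  by (force simp: below_def less_eq_prod_def)

definition antichain :: "pos set \<Rightarrow> bool" where
  "antichain D \<longleftrightarrow> (\<forall>i j k l. (i, j) \<in> D \<longrightarrow> (k, l) \<in> D \<longrightarrow> i \<le> k \<longrightarrow> j \<le> l \<longrightarrow> i = k \<and> j = l)"

lemma antichainD:
  "antichain D \<Longrightarrow> (i, j) \<in> D \<Longrightarrow> (k, l) \<in> D \<Longrightarrow> i \<le> k \<Longrightarrow> j \<le> l \<Longrightarrow> i = k \<and> j = l"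
  unfolding antichain_def by blast

lemma antichain_maxset: "antichain (maxset S)"
  unfolding antichain_def maxset_def by (force simp: pair_less_iff)

lemma maxset_antichain: "antichain D \<Longrightarrow> maxset D = D"
  unfolding antichain_def maxset_def by (fastforce simp: pair_less_iff)

lemma maxset_subset: "maxset S \<subseteq> S"
  by (auto simp: maxset_def)

lemma ex_maxset_above:
  assumes "finite S" "(i, j) \<in> S"
  shows "\<exists>k l. (k, l) \<in> maxset S \<and> i \<le> k \<and> j \<le> l"
proof -
  let ?T = "{p \<in> S. (i, j) \<le> p}"
  obtain p where p: "p \<in> ?T" "\<And>x. x \<in> ?T \<Longrightarrow> p \<le> x \<Longrightarrow> p = x"
    using finite_has_maximal[of ?T] assms by (metis (mono_tags, lifting) dual_order.refl empty_iff finite_subset mem_Collect_eq subsetI)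
  have "\<not> p < x" if "x \<in> S" for x
    using p(1) p(2)[of x] that by (auto simp: less_le_not_le intro: order_trans)
  then have "p \<in> maxset S" using p(1) by (auto simp: maxset_def)
  then show ?thesis using p(1) by (cases p) auto
qed

subsection \<open>Rank functions\<close>

text \<open>On the orbit of a decorated matrix this is the dimension of the intersection of B_i and
  C_j. Integer values make differences safe, and starting at index 0 gives the value 0 on the lower
  margin of a transport matrix.\<close>

definition rk :: "posmat \<Rightarrow> nat \<Rightarrow> nat \<Rightarrow> int" where
  "rk M i j = (\<Sum>k\<le>i. \<Sum>l\<le>j. int (M (k, l)))"

text \<open>Open below and closed above, so that inclusion-exclusion in \<open>mass_eq\<close> uses
  the four given indices without shifts.\<close>

definition mass :: "posmat \<Rightarrow> nat \<Rightarrow> nat \<Rightarrow> nat \<Rightarrow> nat \<Rightarrow> int" where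
  "mass M i i' j j' = (\<Sum>k\<in>{i<..i'}. \<Sum>l\<in>{j<..j'}. int (M (k, l)))"

lemma mass_eq:
  assumes "i \<le> i'" "j \<le> j'"
  shows "mass M i i' j j' = rk M i' j' + rk M i j - rk M i j' - rk M i' j"
proof -
  have split: "(\<Sum>k\<le>a'. f k) = (\<Sum>k\<le>a. f k) + (\<Sum>k\<in>{a<..a'}. f k)" if "a \<le> a'"
    for a a' and f :: "nat \<Rightarrow> int"
  proof -
    have "{..a'} = {..a} \<union> {a<..a'}" using that by auto
    then show ?thesis by (simp add: sum.union_disjoint ivl_disj_int)
  qed
  have "rk M i' y = rk M i y + (\<Sum>k\<in>{i<..i'}. \<Sum>l\<le>y. int (M (k, l)))" for y
    unfolding rk_def by (rule split[OF assms(1)])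
  from this[of j] this[of j'] show ?thesis
    by (simp add: mass_def split[OF assms(2)] sum.distrib)
qed

lemma mass_nonneg: "0 \<le> mass M i i' j j'"
  by (simp add: mass_def sum_nonneg)

lemma mass_ge:
  assumes "i < k" "k \<le> i'" "j < l" "l \<le> j'"
  shows "int (M (k, l)) \<le> mass M i i' j j'"
proof -
  have "int (M (k, l)) \<le> (\<Sum>l\<in>{j<..j'}. int (M (k, l)))"
    using assms by (intro member_le_sum) auto
  also have "\<dots> \<le> mass M i i' j j'"
    unfolding mass_def using assms
    by (intro member_le_sum[where f = "\<lambda>k. \<Sum>l\<in>{j<..j'}. int (M (k, l))"]) (auto intro: sum_nonneg)
  finally show ?thesis .
qed

lemma mass_pos_ex:
  assumes "0 < mass M i i' j j'"
  obtains k l where "i < k" "k \<le> i'" "j < l" "l \<le> j'" "0 < M (k, l)"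
proof -
  have "\<exists>k\<in>{i<..i'}. \<exists>l\<in>{j<..j'}. M (k, l) \<noteq> 0"
  proof (rule ccontr)
    assume "\<not> ?thesis"
    then have "mass M i i' j j' = 0" unfolding mass_def by (intro sum.neutral ballI) auto
    then show False using assms by simp
  qed
  then show thesis using that by auto
qed

lemma mass_single:
  assumes "i < k" "k \<le> i'" "j < l" "l \<le> j'"
    and "\<And>x y. i < x \<Longrightarrow> x \<le> i' \<Longrightarrow> j < y \<Longrightarrow> y \<le> j' \<Longrightarrow> (x, y) \<noteq> (k, l) \<Longrightarrow> M (x, y) = 0"
  shows "mass M i i' j j' = int (M (k, l))"
proof -
  have "mass M i i' j j' = (\<Sum>x\<in>{i<..i'}. if x = k then int (M (k, l)) else 0)"
    unfolding mass_def
  proof (rule sum.cong[OF refl])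
    fix x assume x: "x \<in> {i<..i'}"
    have "(\<Sum>y\<in>{j<..j'}. int (M (x, y))) = (\<Sum>y\<in>{j<..j'}. if y = l \<and> x = k then int (M (k, l)) else 0)"
      using assms(5) x by (intro sum.cong) auto
    then show "(\<Sum>y\<in>{j<..j'}. int (M (x, y))) = (if x = k then int (M (k, l)) else 0)"
      using assms by (auto simp: sum.delta)
  qed
  then show ?thesis using assms by (simp add: sum.delta)
qed

lemma rk_mono:
  assumes "i \<le> i'" "j \<le> j'" shows "rk M i j \<le> rk M i' j'"
proof -
  have "rk M i j \<le> (\<Sum>k\<le>i. \<Sum>l\<le>j'. int (M (k, l)))"
    unfolding rk_def using assms by (intro sum_mono sum_mono2) auto
  also have "\<dots> \<le> rk M i' j'"
    unfolding rk_def using assms by (intro sum_mono2) (auto intro: sum_nonneg)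
  finally show ?thesis .
qed

lemma rk_nonneg: "0 \<le> rk M i j"
  by (simp add: rk_def sum_nonneg)

lemma le_rk: "int (M (i, j)) \<le> rk M i j"
proof -
  have "int (M (i, j)) \<le> (\<Sum>l\<le>j. int (M (i, l)))" by (intro member_le_sum) auto
  also have "\<dots> \<le> rk M i j"
    unfolding rk_def
    by (intro member_le_sum[where f = "\<lambda>k. \<Sum>l\<le>j. int (M (k, l))"]) (auto intro: sum_nonneg)
  finally show ?thesis .
qed

text \<open>The two flags play symmetric roles; transposition lets one half of a symmetric argument
  serve for both.\<close>

definition tpose :: "posmat \<Rightarrow> posmat" where
  "tpose M = (\<lambda>p. M (prod.swap p))"

lemma tpose_apply [simp]: "tpose M (i, j) = M (j, i)"
  by (simp add: tpose_def)

lemma rk_tpose: "rk (tpose M) i j = rk M j i"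
  unfolding rk_def by (simp add: sum.swap[of _ "{..i}"])

lemma rk_inject:
  assumes "\<And>i j. rk M i j = rk N i j" shows "M = N"
proof -
  have row: "(\<Sum>l\<le>j. int (M (i, l))) = (\<Sum>l\<le>j. int (N (i, l)))" for i j
  proof (cases i)
    case 0 then show ?thesis using assms[of 0 j] by (simp add: rk_def)
  next
    case (Suc a) then show ?thesis using assms[of a j] assms[of i j] by (simp add: rk_def)
  qed
  have "M (i, j) = N (i, j)" for i j
  proof (cases j)
    case 0 then show ?thesis using row[of i 0] by simp
  next
    case (Suc a) then show ?thesis using row[of i j] row[of i a] by simp
  qed
  then show ?thesis by (simp add: fun_eq_iff)
qed

subsection \<open>Transport matrices\<close>

lemma transport_outside:
  assumes "transport b c M" "0 < M (i, j)"
  shows "0 < i \<and> i \<le> length b \<and> 0 < j \<and> j \<le> length c"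
  using assms unfolding transport_def by (metis (no_types, lifting) SigmaD1 SigmaD2 atLeastAtMost_iff less_eq_Suc_le less_numeral_extra(3) One_nat_def)

lemma transport_rk_zero:
  assumes "transport b c M" "i = 0 \<or> j = 0" shows "rk M i j = 0"
proof -
  have "M (k, l) = 0" if "k \<le> i" "l \<le> j" for k l
    using transport_outside[OF assms(1), of k l] assms(2) that by (cases "M (k, l)") auto
  then show ?thesis unfolding rk_def by (intro sum.neutral ballI) auto
qed

lemma rk_row_sum:
  assumes "i \<noteq> 0" "\<And>i j. 0 < M (i, j) \<Longrightarrow> 0 < i \<and> 0 < j"
  shows "int (\<Sum>j = 1..r. M (i, j)) = rk M i r - rk M (i - 1) r"
proof -
  obtain a where a: "i = Suc a" using assms(1) by (cases i) auto
  have "{..r} = insert 0 {1..r}" by auto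
  moreover have "M (i, 0) = 0" using assms(2)[of i 0] by (metis gr0I less_numeral_extra(3))
  ultimately show ?thesis by (simp add: rk_def a)
qed

lemma rk_col_sum:
  assumes "j \<noteq> 0" "\<And>i j. 0 < M (i, j) \<Longrightarrow> 0 < i \<and> 0 < j"
  shows "int (\<Sum>i = 1..q. M (i, j)) = rk M q j - rk M q (j - 1)"
proof -
  have "0 < k \<and> 0 < l" if "0 < tpose M (k, l)" for k l
    using assms(2)[of l k] that unfolding tpose_apply by blast
  then have "int (\<Sum>i = 1..q. tpose M (j, i)) = rk (tpose M) j q - rk (tpose M) (j - 1) q"
    by (rule rk_row_sum[OF assms(1)])
  then show ?thesis unfolding rk_tpose tpose_apply .
qed

text \<open>Pairs at which one of the two flag members is zero or the whole space, so that
  \<open>b\<close> and \<open>c\<close> alone determine the rank function there.\<close>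

definition margin :: "nat list \<Rightarrow> nat list \<Rightarrow> nat \<Rightarrow> nat \<Rightarrow> bool" where
  "margin b c i j \<longleftrightarrow> i = 0 \<or> j = 0 \<or> length b \<le> i \<or> length c \<le> j"

lemma rk_zero_imp:
  assumes "rk M i j = 0" "k \<le> i" "l \<le> j" shows "M (k, l) = 0"
  using le_rk[of M k l] rk_mono[OF assms(2,3), of M] assms(1) by simp

lemma rk_beyond:
  assumes "\<And>k l. 0 < M (k, l) \<Longrightarrow> k \<le> q \<and> l \<le> r"
  shows "rk M i j = rk M (min i q) (min j r)"
proof -
  have "rk M i j = (\<Sum>k\<le>i. \<Sum>l\<le>min j r. int (M (k, l)))"
    unfolding rk_def using assms by (intro sum.cong sum.mono_neutral_right) fastforce+
  also have "\<dots> = rk M (min i q) (min j r)"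
    unfolding rk_def using assms
    by (intro sum.mono_neutral_right) (fastforce intro!: sum.neutral)+
  finally show ?thesis .
qed

text \<open>Row sums, column sums and vanishing outside the matrix are all differences of ranks on
  the margin. A move that changes the rank function only in the interior therefore keeps the
  transport property.\<close>

lemma transport_if_rk_eq:
  assumes M: "transport b c M" and eq: "\<And>i j. margin b c i j \<Longrightarrow> rk N i j = rk M i j"
  shows "transport b c N"
proof -
  let ?q = "length b" and ?r = "length c"
  have beyond: "rk M i j = rk M (min i ?q) (min j ?r)" for i j
    using transport_outside[OF M] by (intro rk_beyond) blast
  have out: "N p = 0" if p: "p \<notin> {1..?q} \<times> {1..?r}" for p
  proof (cases p)
    case (Pair i j)
    consider "i = 0 \<or> j = 0" | "i \<noteq> 0" "j \<noteq> 0" "?q < i" | "i \<noteq> 0" "j \<noteq> 0" "?r < j"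
      using p unfolding Pair by (auto simp: not_le Suc_le_eq)
    then show ?thesis
    proof cases
      case 1
      then have "rk N i j = 0" using eq[of i j] transport_rk_zero[OF M 1] by (auto simp: margin_def)
      then show ?thesis using rk_zero_imp[of N i j i j] Pair by simp
    next
      case 2
      have "rk N i j = rk M i j" "rk N ?q j = rk M ?q j" "rk N i 0 = rk M i 0" "rk N ?q 0 = rk M ?q 0"
        using 2 by (auto intro!: eq simp: margin_def)
      moreover have "rk M i j = rk M ?q j"
        using 2 beyond[of i j] beyond[of ?q j] by (simp add: min_absorb2)
      moreover have "rk M i 0 = 0" "rk M ?q 0 = 0" using transport_rk_zero[OF M] by blast+
      \<comment> \<open>The strip of rows past the last one carries no mass, so none of its entries
        can be positive.\<close>
      ultimately have "mass N ?q i 0 j = 0" using 2 by (simp add: mass_eq)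
      then show ?thesis using mass_ge[of ?q i i 0 j j N] 2 Pair by simp
    next
      case 3
      have "rk N i j = rk M i j" "rk N i ?r = rk M i ?r" "rk N 0 j = rk M 0 j" "rk N 0 ?r = rk M 0 ?r"
        using 3 by (auto intro!: eq simp: margin_def)
      moreover have "rk M i j = rk M i ?r"
        using 3 beyond[of i j] beyond[of i ?r] by (simp add: min_absorb2)
      moreover have "rk M 0 j = 0" "rk M 0 ?r = 0" using transport_rk_zero[OF M] by blast+
      ultimately have "mass N 0 i ?r j = 0" using 3 by (simp add: mass_eq)
      then show ?thesis using mass_ge[of 0 i i ?r j j N] 3 Pair by simp
    qed
  qed
  then have posN: "0 < i \<and> 0 < j" if "0 < N (i, j)" for i j
    using out[of "(i, j)"] that by (cases "i = 0 \<or> j = 0") auto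
  have posM: "0 < M (i, j) \<Longrightarrow> 0 < i \<and> 0 < j" for i j using transport_outside[OF M] by blast
  have "int (\<Sum>j = 1..?r. N (i, j)) = int (\<Sum>j = 1..?r. M (i, j))" if "i \<noteq> 0" for i
    using rk_row_sum[OF that posN, where r = ?r] rk_row_sum[OF that posM, where r = ?r] eq[of i ?r] eq[of "i - 1" ?r]
    by (simp only: margin_def order_refl simp_thms)
  then have rows: "(\<Sum>j = 1..?r. N (i, j)) = (\<Sum>j = 1..?r. M (i, j))" if "i \<noteq> 0" for i
    using that of_nat_eq_iff by blast
  have "int (\<Sum>i = 1..?q. N (i, j)) = int (\<Sum>i = 1..?q. M (i, j))" if "j \<noteq> 0" for j
    using rk_col_sum[OF that posN, where q = ?q] rk_col_sum[OF that posM, where q = ?q]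
      eq[of ?q j] eq[of ?q "j - 1"]
    by (simp only: margin_def order_refl simp_thms)
  then have cols: "(\<Sum>i = 1..?q. N (i, j)) = (\<Sum>i = 1..?q. M (i, j))" if "j \<noteq> 0" for j
    using that of_nat_eq_iff by blast
  show ?thesis
    using M out rows cols unfolding transport_def by fastforce
qed

lemma transport_tpose:
  "transport b c M \<Longrightarrow> transport c b (tpose M)"
  unfolding transport_def tpose_def by auto

text \<open>Along the last column consecutive ranks differ by a row sum, which \<open>b\<close>
  prescribes; the last row follows by transposition, and past the matrix ranks are constant.\<close>

lemma transport_rk_margin:
  assumes M: "transport b c M" and N: "transport b c N" and "margin b c i j"
  shows "rk M i j = rk N i j"
proof -
  let ?q = "length b" and ?r = "length c"
  have row: "rk M i (length c) = rk N i (length c)"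
    if "transport b c M" "transport b c N" "i \<le> length b" for b c i M N
    using that(3)
  proof (induction i)
    case 0 then show ?case using transport_rk_zero that by simp
  next
    case (Suc i)
    have "int (\<Sum>j = 1..length c. M (Suc i, j)) = int (\<Sum>j = 1..length c. N (Suc i, j))"
      using Suc.prems that unfolding transport_def by simp
    moreover have "0 < M (i, j) \<Longrightarrow> 0 < i \<and> 0 < j" "0 < N (i, j) \<Longrightarrow> 0 < i \<and> 0 < j" for i j
      using transport_outside that by blast+
    ultimately have "rk M (Suc i) (length c) - rk M i (length c) = rk N (Suc i) (length c) - rk N i (length c)"
      using rk_row_sum[of "Suc i" M "length c"] rk_row_sum[of "Suc i" N "length c"]
      by (metis diff_Suc_1 nat.distinct(1))
    then show ?case using Suc by simp
  qed
  have beyond: "rk M i j = rk M (min i ?q) (min j ?r)" "rk N i j = rk N (min i ?q) (min j ?r)" for i j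
    using rk_beyond[of M ?q ?r i j] rk_beyond[of N ?q ?r i j] transport_outside[OF M]
      transport_outside[OF N] by blast+
  consider "i = 0 \<or> j = 0" | "?r \<le> j" | "?q \<le> i" using assms(3) by (auto simp: margin_def)
  then show ?thesis
  proof cases
    case 1 then show ?thesis using transport_rk_zero M N by metis
  next
    case 2 then show ?thesis using beyond[of i j] row[OF M N, of "min i ?q"] by (simp add: min_def)
  next
    case 3
    have "rk M ?q (min j ?r) = rk N ?q (min j ?r)"
      using row[OF transport_tpose[OF M] transport_tpose[OF N], of "min j ?r"] by (simp add: rk_tpose)
    then show ?thesis using beyond[of i j] 3 by (simp add: min_absorb2)
  qed
qed

text \<open>Rows increasing and columns decreasing along a list means that the set is an antichain;
  sorting by row recovers the list. The bounds on the positions follow from positivity of the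
  entries.\<close>

lemma decorated_iff:
  "decorated b c (M, D) \<longleftrightarrow> transport b c M \<and> D \<noteq> {} \<and> antichain D \<and> (\<forall>p\<in>D. 0 < M p)"
proof
  assume L: "decorated b c (M, D)"
  then obtain ps where ps: "ps \<noteq> []" "D = set ps" "sorted_wrt (\<lambda>(i, j) (i', j'). i < i' \<and> j > j') ps"
    by auto
  have "antichain D"
    unfolding antichain_def ps(2)
  proof (intro allI impI)
    fix i j k l assume *: "(i, j) \<in> set ps" "(k, l) \<in> set ps" "i \<le> k" "j \<le> l"
    then obtain x y where xy: "x < length ps" "y < length ps" "ps ! x = (i, j)" "ps ! y = (k, l)"
      by (metis in_set_conv_nth)
    then show "i = k \<and> j = l"
      using sorted_wrt_nth_less[OF ps(3), of x y] sorted_wrt_nth_less[OF ps(3), of y x] *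
      by (cases x y rule: linorder_cases) auto
  qed
  then show "transport b c M \<and> D \<noteq> {} \<and> antichain D \<and> (\<forall>p\<in>D. 0 < M p)"
    using L ps(1,2) by auto
next
  assume R: "transport b c M \<and> D \<noteq> {} \<and> antichain D \<and> (\<forall>p\<in>D. 0 < M p)"
  have sub: "D \<subseteq> {1..length b} \<times> {1..length c}"
  proof (rule subrelI)
    fix i j assume "(i, j) \<in> D"
    then show "(i, j) \<in> {1..length b} \<times> {1..length c}"
      using R transport_outside[of b c M i j] by auto
  qed
  then have fin: "finite D" by (rule finite_subset) auto
  then obtain xs where xs: "set xs = D" "distinct xs" using finite_distinct_list by blast
  define ps where "ps = sort_key fst xs"
  have ps: "set ps = D" "distinct ps" "sorted (map fst ps)" unfolding ps_def using xs by auto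
  have "sorted_wrt (\<lambda>(i, j) (i', j'). i < i' \<and> j > j') ps"
    unfolding sorted_wrt_iff_nth_less
  proof (intro allI impI)
    fix x y assume xy: "x < y" "y < length ps"
    obtain i j where ij: "ps ! x = (i, j)" by fastforce
    obtain k l where kl: "ps ! y = (k, l)" by fastforce
    have in_D: "(i, j) \<in> D" "(k, l) \<in> D" using ps(1) xy ij kl by (metis nth_mem order.strict_trans)+
    have "(i, j) \<noteq> (k, l)" using ps(2) xy ij kl by (metis nth_eq_iff_index_eq order.strict_trans less_irrefl)
    moreover have "i \<le> k" using xy ij kl
       sorted_nth_mono[OF ps(3), of x y] by simp
    ultimately have "j > l" "i < k"
      using R in_D antichainD[of D i j k l] antichainD[of D k l i j]
      by (metis nat_le_linear order.not_eq_order_implies_strict prod.inject)+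
    then show "(case ps ! x of (i, j) \<Rightarrow> \<lambda>(i', j'). i < i' \<and> j > j') (ps ! y)"
      using \<open>j > l\<close> \<open>i < k\<close> ij kl by simp
  qed
  then show "decorated b c (M, D)" using R sub ps(1) by auto
qed

subsection \<open>Rank functions of the matrices produced by the moves\<close>

lemma rk_E: "rk (E (a, b)) i j = of_bool (a \<le> i \<and> b \<le> j)"
proof -
  have "(\<Sum>l\<le>j. int (E (a, b) (k, l))) = (if k = a then of_bool (b \<le> j) else 0)" for k
  proof -
    have "(\<Sum>l\<le>j. int (E (a, b) (k, l))) = (\<Sum>l\<le>j. if l = b then of_bool (k = a) else 0)"
      by (intro sum.cong) (auto simp: E_def)
    then show ?thesis by (simp add: sum.delta)
  qed
  then show ?thesis by (simp add: rk_def sum.delta)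
qed

lemma rk_add: "rk (\<lambda>x. P x + Q x) i j = rk P i j + rk Q i j"
  by (simp add: rk_def sum.distrib)

lemma rk_sum: "rk (\<lambda>x. \<Sum>s\<in>S. P s x) i j = (\<Sum>s\<in>S. rk (P s) i j)"
proof -
  have "rk (\<lambda>x. \<Sum>s\<in>S. P s x) i j = (\<Sum>k\<le>i. \<Sum>s\<in>S. \<Sum>l\<le>j. int (P s (k, l)))"
    unfolding rk_def of_nat_sum by (subst sum.swap) simp
  also have "\<dots> = (\<Sum>s\<in>S. rk (P s) i j)"
    unfolding rk_def by (rule sum.swap)
  finally show ?thesis .
qed

text \<open>The subtracted units stand on the left-hand side, so truncated subtraction never has to
  be unfolded when ranks are computed.\<close>

lemma rk_balance:
  assumes "\<And>x. N x + P x = M x + Q x"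
  shows "rk N i j = rk M i j + rk Q i j - rk P i j"
proof -
  have "(\<lambda>x. N x + P x) = (\<lambda>x. M x + Q x)" using assms by blast
  then have "rk (\<lambda>x. N x + P x) i j = rk (\<lambda>x. M x + Q x) i j" by simp
  then show ?thesis by (simp add: rk_add)
qed

text \<open>The matrix part of moves (ii), (iii) and (iv)(b), (c); \<open>cyc_mat\<close> belongs to
  (iv)(a) and \<open>chain_mat\<close> to (v).\<close>

definition swap_mat :: "posmat \<Rightarrow> nat \<Rightarrow> nat \<Rightarrow> nat \<Rightarrow> nat \<Rightarrow> posmat" where
  "swap_mat M i0 j0 i1 j1 =
     (\<lambda>x. M x - E (i0, j0) x - E (i1, j1) x + E (i0, j1) x + E (i1, j0) x)"

definition cyc_mat :: "posmat \<Rightarrow> nat \<Rightarrow> nat \<Rightarrow> nat \<Rightarrow> nat \<Rightarrow> nat \<Rightarrow> nat \<Rightarrow> posmat" where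
  "cyc_mat M i0 j0 i2 j2 i1 j1 =
     (\<lambda>x. M x - E (i0, j0) x - E (i1, j1) x - E (i2, j2) x
              + E (i1, j2) x + E (i2, j0) x + E (i0, j1) x)"

definition chain_mat :: "posmat \<Rightarrow> (nat \<Rightarrow> nat) \<Rightarrow> (nat \<Rightarrow> nat) \<Rightarrow> nat \<Rightarrow> posmat" where
  "chain_mat M i j t =
     (\<lambda>x. M x - E (i 0, j 0) x - (\<Sum>s = 1..t. E (i s, j s) x)
              + E (i 0, j 1) x + (\<Sum>s = 1..<t. E (i s, j (s + 1)) x) + E (i t, j 0) x)"

lemma swap_mat_balance:
  assumes "0 < M (i0, j0)" "0 < M (i1, j1)" "i0 < i1"
  shows "swap_mat M i0 j0 i1 j1 x + (E (i0, j0) x + E (i1, j1) x)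
       = M x + (E (i0, j1) x + E (i1, j0) x)"
  using assms by (auto simp: swap_mat_def E_def)

lemma rk_swap_mat:
  assumes "0 < M (i0, j0)" "0 < M (i1, j1)" "i0 < i1" "j0 < j1"
  shows "rk (swap_mat M i0 j0 i1 j1) i j
       = rk M i j - of_bool (i0 \<le> i \<and> i < i1 \<and> j0 \<le> j \<and> j < j1)"
  using rk_balance[OF swap_mat_balance[OF assms(1-3)], where i = i and j = j] assms(3,4)
  by (auto simp: rk_add rk_E)

lemma cyc_mat_balance:
  assumes "0 < M (i0, j0)" "0 < M (i1, j1)" "0 < M (i2, j2)" "i0 < i2" "i2 < i1"
  shows "cyc_mat M i0 j0 i2 j2 i1 j1 x + (E (i0, j0) x + E (i1, j1) x + E (i2, j2) x)
       = M x + (E (i1, j2) x + E (i2, j0) x + E (i0, j1) x)"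
  using assms by (auto simp: cyc_mat_def E_def)

lemma rk_cyc_mat:
  assumes "0 < M (i0, j0)" "0 < M (i1, j1)" "0 < M (i2, j2)" "i0 < i2" "i2 < i1" "j2 < j0" "j0 < j1"
  shows "rk (cyc_mat M i0 j0 i2 j2 i1 j1) i j
       = rk M i j - of_bool ((i0 \<le> i \<and> j0 \<le> j \<or> i2 \<le> i \<and> j2 \<le> j) \<and> i < i1 \<and> j < j1)"
  using rk_balance[OF cyc_mat_balance[OF assms(1-5)], where i = i and j = j] assms(4-)
  by (auto simp: rk_add rk_E)

text \<open>Strictly increasing rows make the chain positions distinct, so the subtracted units
  together stay below \<open>M\<close>.\<close>

lemma chain_mat_balance:
  assumes i: "strict_mono_on {0..t} i" and pos: "\<And>s. s \<le> t \<Longrightarrow> 0 < M (i s, j s)"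
  shows "chain_mat M i j t x + (\<Sum>s\<le>t. E (i s, j s) x)
       = M x + (E (i 0, j 1) x + (\<Sum>s = 1..<t. E (i s, j (s + 1)) x) + E (i t, j 0) x)"
proof -
  have inj: "s = s'" if "i s = i s'" "s \<le> t" "s' \<le> t" for s s'
    using that strict_mono_on_imp_inj_on[OF i] by (auto simp: inj_on_def)
  have "(\<Sum>s\<le>t. E (i s, j s) x) \<le> M x"
  proof (cases "\<exists>s\<le>t. x = (i s, j s)")
    case True
    then obtain s where s: "s \<le> t" "x = (i s, j s)" by blast
    have "(\<Sum>s'\<le>t. E (i s', j s') x) = (\<Sum>s'\<le>t. if s' = s then 1 else 0)"
    proof (rule sum.cong[OF refl])
      fix s' assume "s' \<in> {..t}"
      then show "E (i s', j s') x = (if s' = s then 1 else 0)"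
        using inj[of s' s] s by (cases "i s' = i s") (auto simp: E_def)
    qed
    then show ?thesis using s pos[of s] by (simp add: sum.delta)
  next
    case False
    then have "(\<Sum>s\<le>t. E (i s, j s) x) = 0" by (auto simp: E_def)
    then show ?thesis by simp
  qed
  moreover have "{..t} = insert 0 {1..t}" by auto
  then have "(\<Sum>s\<le>t. E (i s, j s) x) = E (i 0, j 0) x + (\<Sum>s = 1..t. E (i s, j s) x)" by simp
  ultimately show ?thesis unfolding chain_mat_def by linarith
qed

text \<open>Each matrix unit contributes a product of a row indicator and a column indicator. Along
  the chain the row indicators decrease and the column indicators increase, so the alternating sum
  telescopes to the indicator of a staircase, the union of the rectangles from corner 0 to the
  corners \<open>1..t\<close>.\<close>

lemma rk_chain_mat:
  assumes t: "1 \<le> t" and i: "strict_mono_on {0..t} i" and j: "strict_antimono_on {1..t} j"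
    and jt: "j 0 < j t" and pos: "\<And>s. s \<le> t \<Longrightarrow> 0 < M (i s, j s)"
  shows "rk (chain_mat M i j t) x y
       = rk M x y - of_bool (i 0 \<le> x \<and> j 0 \<le> y \<and> (\<exists>s\<in>{1..t}. x < i s \<and> y < j s))"
proof -
  let ?A = "\<lambda>s. of_bool (i s \<le> x) :: int" and ?B = "\<lambda>s. of_bool (j s \<le> y) :: int"
  have mono: "i s \<le> x \<Longrightarrow> i s' \<le> x" if "s' \<le> s" "s \<le> t" for s s'
    using strict_mono_onD[OF i, of s' s] that by (cases "s' = s") auto
  have anti: "j s \<le> y \<Longrightarrow> j s' \<le> y" if "s \<le> s'" "1 \<le> s" "s' \<le> t" for s s'
    using monotone_onD[OF j, of s s'] that by (cases "s' = s") auto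
  \<comment> \<open>At most one difference of consecutive \<open>?B\<close> is 1, and the factor
    \<open>?A s\<close> there decides whether \<open>(x, y)\<close> lies under corner
    \<open>s\<close>.\<close>
  have tel: "?A 0 * ?B 1 + (\<Sum>s\<in>{1..<m}. ?A s * (?B (s + 1) - ?B s))
     = ?A 0 * ?B m - of_bool (i 0 \<le> x \<and> j m \<le> y \<and> (\<exists>s\<in>{1..<m}. x < i s \<and> y < j s))"
    if "1 \<le> m" "m \<le> t" for m
    using that
  proof (induction m rule: dec_induct)
    case base then show ?case by simp
  next
    case (step m)
    have "{1..<Suc m} = insert m {1..<m}" using step by auto
    then have "(\<Sum>s\<in>{1..<Suc m}. ?A s * (?B (s + 1) - ?B s))
        = ?A m * (?B (Suc m) - ?B m) + (\<Sum>s\<in>{1..<m}. ?A s * (?B (s + 1) - ?B s))" by simp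
    moreover define P where "P \<longleftrightarrow> (\<exists>s\<in>{1..<m}. x < i s \<and> y < j s)"
    moreover have "(\<exists>s\<in>{1..<Suc m}. x < i s \<and> y < j s) \<longleftrightarrow> (x < i m \<and> y < j m) \<or> P"
      unfolding P_def \<open>{1..<Suc m} = insert m {1..<m}\<close> by blast
    moreover have "\<not> P" if "i m \<le> x"
      unfolding P_def
    proof (rule ccontr, simp)
      assume "\<exists>s\<in>{Suc 0..<m}. x < i s \<and> y < j s"
      then obtain s where "s < m" "x < i s" by auto
      then show False using mono[of s m] that step.prems by simp
    qed
    moreover have "j m \<le> y \<Longrightarrow> j (Suc m) \<le> y" using anti[of m "Suc m"] step by simp
    moreover have "i m \<le> x \<Longrightarrow> i 0 \<le> x" using mono[of 0 m] step by simp
    moreover have "?A 0 * ?B 1 + (\<Sum>s\<in>{1..<m}. ?A s * (?B (s + 1) - ?B s))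
        = ?A 0 * ?B m - of_bool (i 0 \<le> x \<and> j m \<le> y \<and> P)"
      unfolding P_def using step.IH step.prems by simp
    ultimately show ?case
      by (cases "i m \<le> x"; cases "j m \<le> y"; cases "i 0 \<le> x"; cases "j (Suc m) \<le> y"; cases P)
        (simp_all add: not_le)
  qed
  have split: "(\<Sum>s\<le>t. ?A s * ?B s) = ?A 0 * ?B 0 + ?A t * ?B t + (\<Sum>s\<in>{1..<t}. ?A s * ?B s)"
  proof -
    have "{..t} = insert 0 (insert t {1..<t})" using t by auto
    then show ?thesis using t by simp
  qed
  have E: "rk (E (i s, j s')) x y = ?A s * ?B s'" for s s' by (simp add: rk_E)
  have "rk (chain_mat M i j t) x y = rk M x y
      + (?A 0 * ?B 1 + (\<Sum>s\<in>{1..<t}. ?A s * ?B (s + 1)) + ?A t * ?B 0) - (\<Sum>s\<le>t. ?A s * ?B s)"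
    using rk_balance[OF chain_mat_balance[where M = M and i = i and j = j, OF i pos], where i = x and j = y]
    by (simp add: rk_add rk_sum rk_E of_bool_conj)
  also have "\<dots> = rk M x y + (?A 0 * ?B t - of_bool (i 0 \<le> x \<and> j t \<le> y \<and> (\<exists>s\<in>{1..<t}. x < i s \<and> y < j s)))
      + ?A t * ?B 0 - ?A 0 * ?B 0 - ?A t * ?B t"
    using tel[OF t order_refl] split by (simp add: right_diff_distrib sum_subtractf)
  also have "\<dots> = rk M x y - of_bool (i 0 \<le> x \<and> j 0 \<le> y \<and> (\<exists>s\<in>{1..t}. x < i s \<and> y < j s))"
  proof -
    have ex: "(\<exists>s\<in>{1..t}. x < i s \<and> y < j s) \<longleftrightarrow> (x < i t \<and> y < j t) \<or> (\<exists>s\<in>{1..<t}. x < i s \<and> y < j s)"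
    proof -
      have "{1..t} = insert t {1..<t}" using t by auto
      then show ?thesis by auto
    qed
    have 1: "\<not> (\<exists>s\<in>{1..<t}. x < i s \<and> y < j s)" if "i t \<le> x"
    proof
      assume "\<exists>s\<in>{1..<t}. x < i s \<and> y < j s"
      then obtain s where "s < t" "x < i s" by auto
      then show False using mono[of s t] that by simp
    qed
    have 2: "i t \<le> x \<Longrightarrow> i 0 \<le> x" using mono[of 0 t] by simp
    have 3: "j t \<le> y \<Longrightarrow> j 0 \<le> y" using jt by simp
    show ?thesis
      unfolding ex using 1 2 3
      by (cases "i t \<le> x"; cases "j t \<le> y"; cases "i 0 \<le> x"; cases "j 0 \<le> y") (auto simp: not_le)
  qed
  finally show ?thesis .
qed

subsection \<open>The rank order\<close>

text \<open>This encodes the comparison of dim (B_i + C_j) and of dim (A + B_i + C_j) on the two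
  orbits. The second number exceeds the first by 0 or 1, so it adds a condition only where the first
  comparison is an equality; that condition is \<open>dominated\<close>.\<close>

locale rank_pair =
  fixes b c :: "nat list" and M M' :: posmat and D D' :: "pos set"
  assumes dec: "decorated b c (M, D)" and dec': "decorated b c (M', D')"
    and rk_le: "rk M' i j \<le> rk M i j"
    and dominated: "(k, l) \<in> D \<Longrightarrow> i < k \<Longrightarrow> j < l \<Longrightarrow> rk M i j = rk M' i j
      \<Longrightarrow> \<exists>k' l'. (k', l') \<in> D' \<and> i < k' \<and> j < l'"

text \<open>Moves (ii) to (v) lower the rank function. Move (i) keeps the matrix and puts more
  positions below the decoration, which is the second component.\<close>

fun progress :: "nat list \<Rightarrow> nat list \<Rightarrow> decmat \<Rightarrow> nat \<times> nat" where
  "progress b c (M, D) = (nat (\<Sum>i\<le>length b. \<Sum>j\<le>length c. rk M i j),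
     card {p \<in> {1..length b} \<times> {1..length c}. \<not> below p D})"

section \<open>Gap function, blocked pairs and allowed positions\<close>

context rank_pair
begin

definition gap :: "nat \<Rightarrow> nat \<Rightarrow> int" where
  "gap i j = rk M i j - rk M' i j"

text \<open>Where the matrices have no slack left and \<Delta>' has nothing beyond, no decoration on
  the way to the target may reach strictly beyond \<open>(i, j)\<close>. The allowed positions are
  those that no blocked pair forbids.\<close>

definition blocked :: "nat \<Rightarrow> nat \<Rightarrow> bool" where
  "blocked i j \<longleftrightarrow> gap i j = 0 \<and> (\<forall>k l. (k, l) \<in> D' \<longrightarrow> \<not> (i < k \<and> j < l))"

definition allowed :: "nat \<Rightarrow> nat \<Rightarrow> bool" where
  "allowed k l \<longleftrightarrow> (\<forall>i j. blocked i j \<longrightarrow> \<not> (i < k \<and> j < l))"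

lemma transp: "transport b c M" and nonempty: "D \<noteq> {}" and anti: "antichain D"
  and D_pos: "p \<in> D \<Longrightarrow> 0 < M p"
  and transp': "transport b c M'" and D'_pos: "p \<in> D' \<Longrightarrow> 0 < M' p"
  using dec dec' unfolding decorated_iff by auto

lemma gap_nonneg: "0 \<le> gap i j"
  using rk_le by (simp add: gap_def)

lemma gap_margin: "margin b c i j \<Longrightarrow> gap i j = 0"
  using transport_rk_margin[OF transp transp'] by (simp add: gap_def)

lemma gap_posD: "0 < gap i j \<Longrightarrow> 0 < i \<and> 0 < j \<and> i < length b \<and> j < length c"
  using gap_margin[of i j] by (force simp: margin_def not_le)

lemma gap_pos_iff: "0 < gap i j \<longleftrightarrow> gap i j \<noteq> 0"
  using gap_nonneg[of i j] by auto

lemma D_allowed: "(k, l) \<in> D \<Longrightarrow> allowed k l"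
  using dominated unfolding allowed_def blocked_def gap_def by (metis eq_iff_diff_eq_0)

lemma allowed_mono: "allowed k l \<Longrightarrow> i \<le> k \<Longrightarrow> j \<le> l \<Longrightarrow> allowed i j"
  unfolding allowed_def by (meson less_le_trans)

lemma blocked_mono: "blocked i j \<Longrightarrow> i \<le> k \<Longrightarrow> j \<le> l \<Longrightarrow> gap k l = 0 \<Longrightarrow> blocked k l"
  unfolding blocked_def by (meson le_less_trans)

lemma gap_mass:
  assumes "i \<le> i'" "j \<le> j'"
  shows "mass M i i' j j' - mass M' i i' j j' = gap i' j' + gap i j - gap i j' - gap i' j"
  using assms by (simp add: mass_eq gap_def)

lemma rank_pair_tpose: "rank_pair c b (tpose M) (tpose M') (prod.swap ` D) (prod.swap ` D')"
proof
  have A: "decorated c b (tpose N, prod.swap ` S)" if "decorated b c (N, S)" for N S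
    using that unfolding decorated_iff
    by (auto simp: transport_tpose antichain_def)
  show "decorated c b (tpose M, prod.swap ` D)" "decorated c b (tpose M', prod.swap ` D')"
    using A dec dec' by blast+
  show "rk (tpose M') i j \<le> rk (tpose M) i j" for i j by (simp add: rk_tpose rk_le)
  fix k l i j assume *: "(k, l) \<in> prod.swap ` D" "i < k" "j < l" "rk (tpose M) i j = rk (tpose M') i j"
  then have "\<exists>k' l'. (k', l') \<in> D' \<and> j < k' \<and> i < l'"
    using dominated[of l k j i] by (auto simp: rk_tpose)
  then show "\<exists>k' l'. (k', l') \<in> prod.swap ` D' \<and> i < k' \<and> j < l'" by force
qed

definition step :: "posmat \<Rightarrow> pos set \<Rightarrow> bool" where
  "step M1 D1 \<longleftrightarrow> rank_pair b c M1 M' D1 D' \<and>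
     (progress b c (M1, D1), progress b c (M, D)) \<in> less_than <*lex*> less_than"

text \<open>A move that lowers the rank function on \<open>W\<close> stays below the target as long as the points
  of \<open>W\<close> that become blocked do not obstruct the new decoration.\<close>

lemma step_drop:
  assumes rk1: "\<And>i j. rk M1 i j = rk M i j - of_bool (W i j)"
    and W_pos: "\<And>i j. W i j \<Longrightarrow> 0 < gap i j" and W_ne: "W a b'"
    and S: "finite S" "S \<noteq> {}" and M1_pos: "\<And>p. p \<in> maxset S \<Longrightarrow> 0 < M1 p"
    and S_allowed: "\<And>k l. (k, l) \<in> S \<Longrightarrow> allowed k l"
    and new: "\<And>i j k l. W i j \<Longrightarrow> gap i j = 1 \<Longrightarrow> (k, l) \<in> S \<Longrightarrow> i < k \<Longrightarrow> j < l
       \<Longrightarrow> \<exists>k' l'. (k', l') \<in> D' \<and> i < k' \<and> j < l'"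
  shows "step M1 (maxset S)"
  unfolding step_def
proof
  have t: "transport b c M1"
  proof (rule transport_if_rk_eq[OF transp])
    fix i j assume "margin b c i j"
    then show "rk M1 i j = rk M i j" using rk1 W_pos[of i j] gap_margin by auto
  qed
  obtain s where "s \<in> S" using S by blast
  then have "maxset S \<noteq> {}" using ex_maxset_above[OF S(1), of "fst s" "snd s"] by auto
  then have d: "decorated b c (M1, maxset S)"
    using t M1_pos by (simp add: decorated_iff antichain_maxset del: decorated.simps)
  show "rank_pair b c M1 M' (maxset S) D'"
  proof
    show "decorated b c (M1, maxset S)" "decorated b c (M', D')" by (rule d, rule dec')
    show "rk M' i j \<le> rk M1 i j" for i j
      using rk1[of i j] W_pos[of i j] rk_le[of i j] by (auto simp: gap_def of_bool_def)
    fix k l i j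
    assume *: "(k, l) \<in> maxset S" "i < k" "j < l" "rk M1 i j = rk M' i j"
    then have kl: "(k, l) \<in> S" using maxset_subset by blast
    show "\<exists>k' l'. (k', l') \<in> D' \<and> i < k' \<and> j < l'"
    proof (cases "W i j")
      case True
      \<comment> \<open>Only a pair whose gap was exactly 1 becomes tight through the move; outside
        \<open>W\<close> tightness is old, and \<open>S_allowed\<close> applies.\<close>
      then have "gap i j = 1" using * rk1[of i j] by (simp add: gap_def)
      then show ?thesis using new True kl * by blast
    next
      case False
      then have "gap i j = 0" using * rk1[of i j] by (simp add: gap_def)
      then show ?thesis using S_allowed[OF kl] * unfolding allowed_def blocked_def by blast
    qed
  qed
  have "(\<Sum>i\<le>length b. \<Sum>j\<le>length c. rk M1 i j) < (\<Sum>i\<le>length b. \<Sum>j\<le>length c. rk M i j)"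
  proof (rule sum_strict_mono_ex1)
    have le: "rk M1 i j \<le> rk M i j" for i j by (simp add: rk1)
    then show "\<forall>x\<in>{..length b}. (\<Sum>j\<le>length c. rk M1 x j) \<le> (\<Sum>j\<le>length c. rk M x j)"
      by (simp add: sum_mono)
    have ab: "a < length b" "b' < length c" using gap_posD[OF W_pos[OF W_ne]] by auto
    have "(\<Sum>j\<le>length c. rk M1 a j) < (\<Sum>j\<le>length c. rk M a j)"
      using le ab W_ne by (intro sum_strict_mono_ex1) (auto simp: rk1 intro!: bexI[of _ b'])
    then show "\<exists>x\<in>{..length b}. (\<Sum>j\<le>length c. rk M1 x j) < (\<Sum>j\<le>length c. rk M x j)"
      using ab by (intro bexI[of _ a]) auto
  qed simp
  moreover have "0 \<le> (\<Sum>i\<le>length b. \<Sum>j\<le>length c. rk M1 i j)" by (simp add: sum_nonneg rk_nonneg)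
  ultimately show "(progress b c (M1, maxset S), progress b c (M, D)) \<in> less_than <*lex*> less_than"
    by simp
qed

lemma finite_D: "finite D"
proof (rule finite_subset)
  show "D \<subseteq> {..length b} \<times> {..length c}"
  proof (rule subrelI)
    fix i j assume "(i, j) \<in> D"
    then show "(i, j) \<in> {..length b} \<times> {..length c}"
      using D_pos transport_outside[OF transp, of i j] by auto
  qed
qed simp

end

subsection \<open>Rectangles of positive gap\<close>

lemma antichain_subset: "antichain D \<Longrightarrow> S \<subseteq> D \<Longrightarrow> antichain S"
  unfolding antichain_def by blast

text \<open>The shape in which move (v) takes its positions: index 0 holds the base corner, which is
  not in \<open>S\<close>, and the elements of \<open>S\<close> follow in order of their
  rows.\<close>

lemma antichain_enum:
  assumes S: "finite S" "S \<noteq> {}" "antichain S" and above: "\<And>k l. (k, l) \<in> S \<Longrightarrow> i0 < k \<and> j0 < l"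
  obtains t i j where "1 \<le> t" "strict_mono_on {0..t} i" "strict_antimono_on {1..t} j"
    "i 0 = i0" "j 0 = j0" "j 0 < j t" "S = (\<lambda>s. (i s, j s)) ` {1..t :: nat}"
proof -
  have "finite (fst ` S)" using S by simp
  define xs where "xs = sorted_list_of_set (fst ` S)"
  have xs: "set xs = fst ` S" "sorted_wrt (<) xs" unfolding xs_def using S by auto
  define i where "i s = (case s of 0 \<Rightarrow> i0 | Suc m \<Rightarrow> xs ! m)" for s
  \<comment> \<open>An antichain meets each row at most once, so the column is a function of the
    row.\<close>
  define f where "f k = (THE l. (k, l) \<in> S)" for k
  define j where "j s = (if s = 0 then j0 else f (i s))" for s
  define t where "t = length xs"
  have f: "f k = l" if "(k, l) \<in> S" for k l
    unfolding f_def using that antichainD[OF S(3)] by (intro the_equality) (metis nat_le_linear order_refl)+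
  have iS: "(i s, j s) \<in> S" if s: "s \<in> {1..t}" for s
  proof -
    obtain m where m: "s = Suc m" using s by (cases s) auto
    then have "i s \<in> fst ` S" using s xs(1) by (auto simp: i_def t_def)
    then obtain l where "(i s, l) \<in> S" by force
    then show ?thesis using f[of "i s" l] m by (simp add: j_def)
  qed
  have t: "1 \<le> t" using S(2) xs(1) unfolding t_def by (cases xs) auto
  have mono: "strict_mono_on {0..t} i"
  proof (rule strict_mono_onI)
    fix s s' assume *: "s \<in> {0..t}" "s' \<in> {0..t}" "s < s'"
    then obtain m where m: "s' = Suc m" by (cases s') auto
    show "i s < i s'"
    proof (cases s)
      case 0
      have "(i s', j s') \<in> S" using * by (intro iS) auto
      then show ?thesis using above[of "i s'" "j s'"] 0 by (simp add: i_def)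
    next
      case (Suc a)
      then show ?thesis using * m sorted_wrt_nth_less[OF xs(2), of a m] by (simp add: i_def t_def)
    qed
  qed
  have amono: "strict_antimono_on {1..t} j"
  proof (rule monotone_onI)
    fix s s' assume *: "s \<in> {1..t}" "s' \<in> {1..t}" "s < s'"
    have "i s < i s'" using strict_mono_onD[OF mono, of s s'] * by auto
    then show "j s > j s'"
      using antichainD[OF S(3) iS[OF *(1)] iS[OF *(2)]] by (metis less_imp_le_nat not_le less_irrefl)
  qed
  have "S = (\<lambda>s. (i s, j s)) ` {1..t}"
  proof
    show "S \<subseteq> (\<lambda>s. (i s, j s)) ` {1..t}"
    proof (rule subrelI)
      fix k l assume kl: "(k, l) \<in> S"
      then have "k \<in> set xs" using xs(1) by force
      then obtain m where m: "m < length xs" "xs ! m = k" by (auto simp: in_set_conv_nth)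
      then have "(k, l) = (i (Suc m), j (Suc m))" using f[OF kl] by (simp add: i_def j_def)
      then show "(k, l) \<in> (\<lambda>s. (i s, j s)) ` {1..t}"
        using m(1) by (intro image_eqI[of _ _ "Suc m"]) (auto simp: t_def)
    qed
  qed (use iS in auto)
  moreover have "j 0 < j t" using above[OF iS[of t]] t by (simp add: j_def)
  ultimately show thesis using that[of t i j] t mono amono by (simp add: i_def j_def)
qed

context rank_pair
begin

text \<open>A seen pair stays unblocked even when its gap drops to 0.\<close>

definition seen :: "nat \<Rightarrow> nat \<Rightarrow> bool" where
  "seen i j \<longleftrightarrow> (\<exists>k l. (k, l) \<in> D' \<and> i < k \<and> j < l)"

text \<open>Half-open because these are exactly the pairs at which a swap with the given corners
  lowers the rank function, see \<open>rk_swap_mat\<close>.\<close>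

definition clear :: "nat \<Rightarrow> nat \<Rightarrow> nat \<Rightarrow> nat \<Rightarrow> bool" where
  "clear i j k l \<longleftrightarrow> (\<forall>x y. i \<le> x \<longrightarrow> x < k \<longrightarrow> j \<le> y \<longrightarrow> y < l \<longrightarrow> 0 < gap x y)"

text \<open>The upper corners of swaps with lower corner \<open>(i, j)\<close> that keep the rank
  function above that of \<open>M'\<close>.\<close>

definition target :: "nat \<Rightarrow> nat \<Rightarrow> nat \<Rightarrow> nat \<Rightarrow> bool" where
  "target i j k l \<longleftrightarrow> i < k \<and> j < l \<and> 0 < M (k, l) \<and> clear i j k l"

definition top :: "nat \<Rightarrow> nat \<Rightarrow> bool" where
  "top i j \<longleftrightarrow> 0 < M (i, j) \<and> 0 < gap i j \<and>
     (\<forall>k l. i \<le> k \<longrightarrow> j \<le> l \<longrightarrow> 0 < M (k, l) \<longrightarrow> 0 < gap k l \<longrightarrow> k = i \<and> l = j)"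

lemma blocked_iff: "blocked i j \<longleftrightarrow> gap i j = 0 \<and> \<not> seen i j"
  by (auto simp: blocked_def seen_def)

lemma seen_mono: "seen k l \<Longrightarrow> i \<le> k \<Longrightarrow> j \<le> l \<Longrightarrow> seen i j"
  unfolding seen_def by (meson le_less_trans)

lemma allowedD: "allowed k l \<Longrightarrow> i < k \<Longrightarrow> j < l \<Longrightarrow> gap i j = 0 \<Longrightarrow> seen i j"
  unfolding allowed_def blocked_iff by blast

lemma clearD: "clear i j k l \<Longrightarrow> i \<le> x \<Longrightarrow> x < k \<Longrightarrow> j \<le> y \<Longrightarrow> y < l \<Longrightarrow> gap x y \<noteq> 0"
  unfolding clear_def by fastforce

lemma clear_mono: "clear i j k l \<Longrightarrow> i \<le> i' \<Longrightarrow> j \<le> j' \<Longrightarrow> k' \<le> k \<Longrightarrow> l' \<le> l \<Longrightarrow> clear i' j' k' l'"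
  unfolding clear_def by (meson le_trans less_le_trans)

lemma D_eqI: "(i, j) \<in> D \<Longrightarrow> (k, l) \<in> D \<Longrightarrow> i \<le> k \<Longrightarrow> j \<le> l \<Longrightarrow> i = k \<and> j = l"
  using antichainD[OF anti] .

text \<open>The alternating sum of \<open>gap\<close> over a rectangle is the mass of
  \<open>M\<close> minus the mass of \<open>M'\<close>, and the latter is not negative. All occupied
  positions needed for the moves come from here.\<close>

lemma block_ex:
  assumes "i \<le> i'" "j \<le> j'" "0 < gap i' j' + gap i j - gap i j' - gap i' j"
  shows "\<exists>k l. i < k \<and> k \<le> i' \<and> j < l \<and> l \<le> j' \<and> 0 < M (k, l)"
proof -
  have "0 < mass M i i' j j'"
    using gap_mass[OF assms(1,2)] assms(3) mass_nonneg[of M' i i' j j'] by linarith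
  then show ?thesis by (rule mass_pos_ex) blast
qed

text \<open>Take the first zero of \<open>gap\<close> in row \<open>i\<close> past column
  \<open>j\<close>, and a zero to its left in the first row that has one. The corner
  \<open>(i, yz)\<close> of the rectangle they span has positive gap, so the rectangle contains an
  occupied position; the choice of both zeros as first ones keeps everything before that position
  clear.\<close>

lemma ex_target:
  assumes "0 < gap i j"
  shows "\<exists>k l. target i j k l"
proof -
  define jz where "jz = (LEAST y. j \<le> y \<and> gap i y = 0)"
  have jz: "j \<le> jz \<and> gap i jz = 0"
    unfolding jz_def by (rule LeastI[of _ "max j (length c)"]) (simp add: gap_margin margin_def)
  have jz_least: "gap i y \<noteq> 0" if "j \<le> y" "y < jz" for y
    using not_less_Least[of y "\<lambda>y. j \<le> y \<and> gap i y = 0"] that unfolding jz_def by blast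
  have "j < jz" using jz assms by (cases "j = jz") auto
  let ?Q = "\<lambda>x. i \<le> x \<and> (\<exists>y. j \<le> y \<and> y < jz \<and> gap x y = 0)"
  define iz where "iz = (LEAST x. ?Q x)"
  have "?Q (max i (length b))" using \<open>j < jz\<close> by (auto intro!: exI[of _ j] simp: gap_margin margin_def)
  then have iz: "?Q iz" unfolding iz_def by (rule LeastI)
  then obtain yz where yz: "j \<le> yz" "yz < jz" "gap iz yz = 0" by blast
  have iz_least: "gap x y \<noteq> 0" if "i \<le> x" "x < iz" "j \<le> y" "y < jz" for x y
    using not_less_Least[of x ?Q] that unfolding iz_def by blast
  have "0 < gap i yz" using jz_least yz gap_pos_iff by blast
  then have "0 < gap iz jz + gap i yz - gap i jz - gap iz yz"
    using yz jz gap_nonneg[of iz jz] by simp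
  then obtain k l where kl: "i < k" "k \<le> iz" "yz < l" "l \<le> jz" "0 < M (k, l)"
    using block_ex[of i iz yz jz] iz yz by auto
  then have "target i j k l"
    using yz iz_least unfolding target_def clear_def gap_pos_iff by auto
  then show ?thesis by blast
qed

lemma target_shrink: "target i j k l \<Longrightarrow> i < k' \<Longrightarrow> j < l' \<Longrightarrow> k' \<le> k \<Longrightarrow> l' \<le> l \<Longrightarrow> 0 < M (k', l')
    \<Longrightarrow> target i j k' l'"
  unfolding target_def by (meson clear_mono order_refl)

lemma ex_min_target:
  assumes "target i j k l"
  shows "\<exists>k' l'. target i j k' l' \<and> k' \<le> k \<and> l' \<le> l \<and>
    (\<forall>x y. target i j x y \<longrightarrow> x \<le> k' \<longrightarrow> y \<le> l' \<longrightarrow> x = k' \<and> y = l')"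
  using assms
proof (induction "k + l" arbitrary: k l rule: less_induct)
  case less
  show ?case
  proof (cases "\<forall>x y. target i j x y \<longrightarrow> x \<le> k \<longrightarrow> y \<le> l \<longrightarrow> x = k \<and> y = l")
    case True then show ?thesis using less.prems by blast
  next
    case False
    then obtain x y where xy: "target i j x y" "x \<le> k" "y \<le> l" "x \<noteq> k \<or> y \<noteq> l" by blast
    then have "x + y < k + l" by linarith
    from less.hyps[OF this xy(1)] show ?thesis using xy(2,3) by (meson le_trans)
  qed
qed

text \<open>An occupied position inside has positive gap and contradicts the maximality of the top;
  one on the two far edges is a smaller target.\<close>

lemma min_target_inner:
  assumes top: "top i j" and f: "target i j k l"
    and min: "\<And>x y. target i j x y \<Longrightarrow> x \<le> k \<Longrightarrow> y \<le> l \<Longrightarrow> x = k \<and> y = l"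
    and xy: "i \<le> x" "j \<le> y" "x \<le> k" "y \<le> l" "(x, y) \<notin> {(i, j), (k, l), (i, l), (k, j)}"
  shows "M (x, y) = 0"
proof (rule ccontr)
  assume "M (x, y) \<noteq> 0"
  then have pos: "0 < M (x, y)" by simp
  show False
  proof (cases "x < k \<and> y < l")
    case True
    then have "0 < gap x y" using f xy unfolding target_def clear_def by blast
    then show False using top pos xy unfolding top_def by blast
  next
    case False
    then have "i < x \<and> j < y" using xy f unfolding target_def by auto
    then have "target i j x y" using target_shrink[OF f] xy pos by blast
    then show False using min xy by blast
  qed
qed

lemma ex_top:
  assumes "0 < M (i, j)" "0 < gap i j"
  shows "\<exists>k l. top k l \<and> i \<le> k \<and> j \<le> l"
  using assms
proof (induction "length b + length c - (i + j)" arbitrary: i j rule: less_induct)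
  case less
  show ?case
  proof (cases "top i j")
    case True then show ?thesis by blast
  next
    case False
    then obtain k l where kl: "i \<le> k" "j \<le> l" "0 < M (k, l)" "0 < gap k l" "k \<noteq> i \<or> l \<noteq> j"
      using less.prems unfolding top_def by blast
    have "length b + length c - (k + l) < length b + length c - (i + j)"
      using kl gap_posD[OF kl(4)] by linarith
    from less.hyps[OF this kl(3,4)] show ?thesis using kl(1,2) by (meson le_trans)
  qed
qed

text \<open>At an empty cell, inclusion-exclusion passes a positive gap on to the left or upper
  neighbour. This descent must end at an occupied cell, since \<open>gap\<close> vanishes on the
  margin.\<close>

lemma ex_gap_M_pos:
  assumes "0 < gap i j"
  shows "\<exists>k l. 0 < M (k, l) \<and> 0 < gap k l"
  using assms
proof (induction "i + j" arbitrary: i j rule: less_induct)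
  case less
  obtain a e where ij: "i = Suc a" "j = Suc e" using gap_posD[OF less.prems] by (meson gr0_implies_Suc)
  show ?case
  proof (cases "0 < M (i, j)")
    case True then show ?thesis using less.prems by blast
  next
    case False
    have "mass M a i e j = int (M (i, j))" by (rule mass_single) (auto simp: ij le_Suc_eq)
    then have "gap i j + gap a e - gap a j - gap i e \<le> 0"
      using gap_mass[of a i e j] False ij mass_nonneg[of M' a i e j] by simp
    then have "0 < gap a j \<or> 0 < gap i e" using less.prems gap_nonneg[of a e] by linarith
    then show ?thesis using less.hyps[of a j] less.hyps[of i e] ij by auto
  qed
qed

text \<open>\<open>z\<close> is a pair that the move would make blocked and \<open>(k, l)\<close> a
  decorated position beyond it. A zero of \<open>gap\<close> to the left of column \<open>z2\<close>
  would, by inclusion-exclusion between \<open>z\<close> and the first such zero, produce a target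
  with \<open>(k, l)\<close> strictly beyond it, contrary to \<open>none\<close>.\<close>

lemma harmless_half:
  assumes none: "\<And>k l k' l'. target i j k l \<Longrightarrow> (k', l') \<in> D \<Longrightarrow> \<not> (k < k' \<and> l < l')"
    and z: "i \<le> z1" "j \<le> z2" "clear i j (Suc z1) (Suc z2)" "gap z1 z2 = 1" "\<not> seen z1 z2"
    and d: "(k, l) \<in> D" "z1 < k" "z2 < l"
    and y: "i \<le> y1" "j \<le> y2" "y1 < k" "y2 < z2" "gap y1 y2 = 0"
  shows False
proof -
  let ?Q = "\<lambda>x. i \<le> x \<and> x < k \<and> (\<exists>y. j \<le> y \<and> y < z2 \<and> gap x y = 0)"
  define x where "x = (LEAST x. ?Q x)"
  have "?Q y1" using y by blast
  then have "?Q x" unfolding x_def by (rule LeastI)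
  then obtain w where w: "i \<le> x" "x < k" "j \<le> w" "w < z2" "gap x w = 0" by blast
  have least: "gap x' y' \<noteq> 0" if "i \<le> x'" "x' < x" "j \<le> y'" "y' < z2" for x' y'
  proof
    assume "gap x' y' = 0"
    then have "?Q x'" using that w by auto
    then show False using not_less_Least[of x' ?Q] that unfolding x_def by blast
  qed
  have zx: "z1 < x" using clearD[OF z(3), of x w] w by fastforce
  \<comment> \<open>A zero here lies strictly before the decorated \<open>(k, l)\<close>, so it
    would be seen; then \<open>z\<close>, which is weakly before it, would be seen as well.\<close>
  have "gap x z2 \<noteq> 0"
    using allowedD[OF D_allowed[OF d(1)], of x z2] w d z(5) seen_mono[of x z2 z1 z2] zx by auto
  moreover have "gap z1 w \<noteq> 0" using clearD[OF z(3), of z1 w] z w by auto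
  ultimately have "0 < gap x z2 + gap z1 w - gap z1 z2 - gap x w"
    using z(4) w(5) gap_nonneg[of x z2] gap_nonneg[of z1 w] by linarith
  then obtain a e where ae: "z1 < a" "a \<le> x" "w < e" "e \<le> z2" "0 < M (a, e)"
    using block_ex[of z1 x w z2] zx w by auto
  have "target i j a e"
    unfolding target_def clear_def gap_pos_iff using ae z w least by auto
  then show False using none[of a e k l] ae w d by linarith
qed

text \<open>Identifies the notions of the transposed instance with the original ones, coordinates
  exchanged, so that one-sided lemmas can be applied to both sides.\<close>

lemma tpose_simps:
  "rank_pair.gap (tpose M) (tpose M') i j = gap j i"
  "rank_pair.seen (prod.swap ` D') i j = seen j i"
  "rank_pair.blocked (tpose M) (tpose M') (prod.swap ` D') i j = blocked j i"
  "rank_pair.allowed (tpose M) (tpose M') (prod.swap ` D') i j = allowed j i"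
  "rank_pair.clear (tpose M) (tpose M') i j k l = clear j i l k"
  "rank_pair.target (tpose M) (tpose M') i j k l = target j i l k"
proof -
  interpret T: rank_pair c b "tpose M" "tpose M'" "prod.swap ` D" "prod.swap ` D'"
    by (rule rank_pair_tpose)
  show g: "T.gap i j = gap j i" for i j by (simp add: T.gap_def gap_def rk_tpose)
  show s: "T.seen i j = seen j i" for i j unfolding T.seen_def seen_def by force
  show bl: "T.blocked i j = blocked j i" for i j unfolding T.blocked_iff blocked_iff g s ..
  show "T.allowed i j = allowed j i" unfolding T.allowed_def allowed_def bl by blast
  show cl: "T.clear i j k l = clear j i l k" unfolding T.clear_def clear_def g by blast
  show "T.target i j k l = target j i l k" unfolding T.target_def target_def cl by auto
qed

text \<open>A decorated position that would be spoiled by the drop at \<open>z\<close> is itself a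
  target. Otherwise its rectangle contains a zero of \<open>gap\<close>, which is seen and hence not
  beyond \<open>z\<close>, nor before \<open>z\<close> by clearness; it lies to the left of
  \<open>z\<close> or above it, and \<open>harmless_half\<close> excludes both.\<close>

lemma harmless:
  assumes none: "\<And>k l k' l'. target i j k l \<Longrightarrow> (k', l') \<in> D \<Longrightarrow> \<not> (k < k' \<and> l < l')"
    and f: "target i j k0 l0"
    and z: "i \<le> z1" "j \<le> z2" "z1 < k0" "z2 < l0" "gap z1 z2 = 1" "\<not> seen z1 z2"
    and d: "(k, l) \<in> D" "z1 < k" "z2 < l"
  shows "target i j k l"
proof (rule ccontr)
  assume "\<not> target i j k l"
  then have "\<not> clear i j k l" using d z D_pos[OF d(1)] unfolding target_def by auto
  then obtain y1 y2 where y: "i \<le> y1" "y1 < k" "j \<le> y2" "y2 < l" "gap y1 y2 = 0"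
    unfolding clear_def gap_pos_iff by blast
  have cz: "clear i j (Suc z1) (Suc z2)"
    using f clear_mono[of i j k0 l0 i j "Suc z1" "Suc z2"] z unfolding target_def by simp
  have "seen y1 y2" using allowedD[OF D_allowed[OF d(1)]] y by blast
  then have "\<not> (z1 \<le> y1 \<and> z2 \<le> y2)" using z(6) seen_mono by blast
  moreover have "\<not> (y1 \<le> z1 \<and> y2 \<le> z2)" using clearD[OF cz, of y1 y2] y by auto
  ultimately consider "y2 < z2" | "y1 < z1" by linarith
  then show False
  proof cases
    case 1
    show False by (rule harmless_half[OF none z(1,2) cz z(5,6) d y(1,3,2) 1 y(5)])
  next
    case 2
    interpret T: rank_pair c b "tpose M" "tpose M'" "prod.swap ` D" "prod.swap ` D'"
      by (rule rank_pair_tpose)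
    show False
    proof (rule T.harmless_half[of j i z2 z1 l k y2 y1], unfold tpose_simps)
      fix a e a' e' assume "target i j e a" "(a', e') \<in> prod.swap ` D"
      then show "\<not> (a < a' \<and> e < e')" using none[of e a e' a'] by auto
    qed (use z cz d y 2 in auto)
  qed
qed

subsection \<open>Moves below a target\<close>

text \<open>\<open>e\<close> and \<open>f\<close> keep the entries at decorated positions positive;
  \<open>new\<close> excludes that a pair that becomes blocked has a decorated position beyond
  it.\<close>

lemma swap_keep:
  assumes lt: "i0 < i1" "j0 < j1" and pos: "0 < M (i0, j0)" "0 < M (i1, j1)"
    and clear: "clear i0 j0 i1 j1"
    and e: "(i0, j0) \<notin> D \<or> 1 < M (i0, j0)" and f: "(i1, j1) \<notin> D"
    and new: "\<And>x y k l. i0 \<le> x \<Longrightarrow> x < i1 \<Longrightarrow> j0 \<le> y \<Longrightarrow> y < j1 \<Longrightarrow> gap x y = 1 \<Longrightarrow> (k, l) \<in> D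
      \<Longrightarrow> x < k \<Longrightarrow> y < l \<Longrightarrow> seen x y"
  shows "step (swap_mat M i0 j0 i1 j1) D"
proof -
  have *: "maxset D = D" using anti by (rule maxset_antichain)
  have "0 < swap_mat M i0 j0 i1 j1 p" if "p \<in> D" for p
    using swap_mat_balance[OF pos lt(1), of p] D_pos[OF that] that e f
    by (auto simp: E_def split: if_splits)
  then have "step (swap_mat M i0 j0 i1 j1) (maxset D)"
    using new clear lt unfolding clear_def seen_def
    by (intro step_drop[where a = i0 and b' = j0 and
          W = "\<lambda>i j. i0 \<le> i \<and> i < i1 \<and> j0 \<le> j \<and> j < j1"] rk_swap_mat[OF pos lt])
      (auto simp: * finite_D nonempty D_allowed)
  then show ?thesis by (simp add: *)
qed

text \<open>No pair of the rectangle becomes an obstruction: an element of the antichain strictly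
  beyond it would exceed the decorated \<open>(i0, j0)\<close>, and \<open>p\<close> shares a row or
  a column with that corner.\<close>

lemma swap_add:
  assumes lt: "i0 < i1" "j0 < j1" and pos: "0 < M (i1, j1)"
    and clear: "clear i0 j0 i1 j1" and e: "(i0, j0) \<in> D"
    and p: "p = (i0, j1) \<or> p = (i1, j0)" and al: "allowed (fst p) (snd p)"
  shows "step (swap_mat M i0 j0 i1 j1) (maxset (D \<union> {p}))"
proof -
  have pos0: "0 < M (i0, j0)" using D_pos e by blast
  have f: "(i1, j1) \<notin> D" using D_eqI[OF e, of i1 j1] lt by auto
  have ep: "(i0, j0) < p" using p lt by (auto simp: pair_less_iff)
  have "0 < swap_mat M i0 j0 i1 j1 x" if "x \<in> maxset (D \<union> {p})" for x
  proof (cases "x = p")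
    case True then show ?thesis using p by (auto simp: swap_mat_def E_def)
  next
    case False
    then have "x \<in> D" "x \<noteq> (i0, j0)" using that ep by (auto simp: maxset_def)
    then show ?thesis
      using swap_mat_balance[OF pos0 pos lt(1), of x] D_pos[of x] f by (auto simp: E_def split: if_splits)
  qed
  moreover have "\<exists>k' l'. (k', l') \<in> D' \<and> x < k' \<and> y < l'"
    if "i0 \<le> x \<and> x < i1 \<and> j0 \<le> y \<and> y < j1" "(k, l) \<in> D \<union> {p}" "x < k" "y < l" for x y k l
    using that p D_eqI[OF e, of k l] by auto
  ultimately show ?thesis
    using clear lt al p unfolding clear_def
    by (intro step_drop[where a = i0 and b' = j0 and
          W = "\<lambda>i j. i0 \<le> i \<and> i < i1 \<and> j0 \<le> j \<and> j < j1"] rk_swap_mat[OF pos0 pos lt])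
      (auto simp: finite_D D_allowed)
qed

text \<open>As in \<open>swap_add\<close>, with two decorated corners: an old decorated position
  strictly beyond a dropped pair would exceed one of them, and \<open>(i2, j0)\<close> shares a
  column with the first and a row with the second.\<close>

lemma cyc_add:
  assumes lt: "i0 < i2" "i2 < i1" "j2 < j0" "j0 < j1" and pos: "0 < M (i1, j1)"
    and clear: "clear i0 j0 i1 j1" "clear i2 j2 i1 j1" and e: "(i0, j0) \<in> D" "(i2, j2) \<in> D"
    and al: "allowed i2 j0"
  shows "step (cyc_mat M i0 j0 i2 j2 i1 j1) (maxset (D \<union> {(i2, j0)}))"
proof -
  have pos0: "0 < M (i0, j0)" and pos2: "0 < M (i2, j2)" using D_pos e by blast+
  have f: "(i1, j1) \<notin> D" using D_eqI[OF e(1), of i1 j1] lt by auto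
  have "0 < cyc_mat M i0 j0 i2 j2 i1 j1 x" if "x \<in> maxset (D \<union> {(i2, j0)})" for x
  proof (cases "x = (i2, j0)")
    case True then show ?thesis by (auto simp: cyc_mat_def E_def)
  next
    case False
    moreover have "(i0, j0) < (i2, j0)" "(i2, j2) < (i2, j0)" using lt by (auto simp: pair_less_iff)
    ultimately have "x \<in> D" "x \<noteq> (i0, j0)" "x \<noteq> (i2, j2)"
      using that by (auto simp: maxset_def)
    then show ?thesis
      using cyc_mat_balance[OF pos0 pos pos2 lt(1,2), of x] D_pos[of x] f
      by (auto simp: E_def split: if_splits)
  qed
  moreover have "\<exists>k' l'. (k', l') \<in> D' \<and> x < k' \<and> y < l'"
    if "(i0 \<le> x \<and> j0 \<le> y \<or> i2 \<le> x \<and> j2 \<le> y) \<and> x < i1 \<and> y < j1"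
      "(k, l) \<in> D \<union> {(i2, j0)}" "x < k" "y < l" for x y k l
    using that D_eqI[OF e(1), of k l] D_eqI[OF e(2), of k l] by auto
  ultimately show ?thesis
    using clear lt al unfolding clear_def
    by (intro step_drop[where a = i0 and b' = j0 and
          W = "\<lambda>i j. (i0 \<le> i \<and> j0 \<le> j \<or> i2 \<le> i \<and> j2 \<le> j) \<and> i < i1 \<and> j < j1"]
        rk_cyc_mat[OF pos0 pos pos2 lt])
      (auto simp: finite_D D_allowed)
qed

text \<open>The elements of the chain leave the decoration, so \<open>new\<close> concerns only the
  others. The two positions that enter are dominated by the first and the last element of the chain,
  hence allowed, and they share a row or a column with the base corner, hence lie beyond no dropped
  pair.\<close>

lemma chain_step:
  assumes t: "1 \<le> t" and i: "strict_mono_on {0..t} i" and j: "strict_antimono_on {1..t} j"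
    and jt: "j 0 < j t" and inD: "\<And>s. s \<in> {1..t} \<Longrightarrow> (i s, j s) \<in> D" and pos: "0 < M (i 0, j 0)"
    and clear: "\<And>s. s \<in> {1..t} \<Longrightarrow> clear (i 0) (j 0) (i s) (j s)"
    and new: "\<And>x y k l s. s \<in> {1..t} \<Longrightarrow> i 0 \<le> x \<Longrightarrow> x < i s \<Longrightarrow> j 0 \<le> y \<Longrightarrow> y < j s \<Longrightarrow> gap x y = 1
      \<Longrightarrow> (k, l) \<in> D \<Longrightarrow> (k, l) \<notin> (\<lambda>s. (i s, j s)) ` {1..t} \<Longrightarrow> x < k \<Longrightarrow> y < l \<Longrightarrow> seen x y"
  shows "step (chain_mat M i j t)
    (maxset ((D - (\<lambda>s. (i s, j s)) ` {0..t}) \<union> {(i 0, j 1), (i t, j 0)}))"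
proof -
  let ?I = "(\<lambda>s. (i s, j s)) ` {0..t}"
  let ?S = "(D - ?I) \<union> {(i 0, j 1), (i t, j 0)}"
  have pos': "0 < M (i s, j s)" if "s \<le> t" for s
    using that inD[of s] D_pos pos by (cases s) auto
  have i0: "i 0 < i s" if "s \<in> {1..t}" for s using strict_mono_onD[OF i, of 0 s] that by auto
  have jt': "j t \<le> j s" if "s \<in> {1..t}" for s
    using monotone_onD[OF j, of s t] that by (cases "s = t") auto
  have M1: "0 < chain_mat M i j t p" if "p \<in> ?S" for p
  proof -
    consider "p = (i 0, j 1)" | "p = (i t, j 0)" | "p \<in> D" "p \<notin> ?I" using \<open>p \<in> ?S\<close> by blast
    then show ?thesis
    proof cases
      case 3
      then have "(\<Sum>s\<le>t. E (i s, j s) p) = 0" by (auto simp: E_def)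
      then show ?thesis using chain_mat_balance[where M = M and i = i and j = j, OF i pos', of p] D_pos[OF 3(1)] by simp
    qed (auto simp: chain_mat_def E_def)
  qed
  have al: "allowed (i 0) (j 1)" "allowed (i t) (j 0)"
    using allowed_mono[OF D_allowed[OF inD[of 1]], of "i 0" "j 1"] i0[of 1]
      allowed_mono[OF D_allowed[OF inD[of t]], of "i t" "j 0"] t jt by auto
  show ?thesis
  proof (rule step_drop[where a = "i 0" and b' = "j 0" and W = "\<lambda>x y. i 0 \<le> x \<and> j 0 \<le> y
        \<and> (\<exists>s\<in>{1..t}. x < i s \<and> y < j s)", OF rk_chain_mat[where M = M and i = i and j = j, OF t i j jt pos']])
    show "i 0 \<le> i 0 \<and> j 0 \<le> j 0 \<and> (\<exists>s\<in>{1..t}. i 0 < i s \<and> j 0 < j s)"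
      using i0[of t] t jt by (intro conjI bexI[of _ t]) auto
    show "0 < gap x y" if "i 0 \<le> x \<and> j 0 \<le> y \<and> (\<exists>s\<in>{1..t}. x < i s \<and> y < j s)" for x y
      using that clear unfolding clear_def by blast
    show "finite ?S" "?S \<noteq> {}" using finite_D by auto
    show "0 < chain_mat M i j t p" if "p \<in> maxset ?S" for p using M1 that maxset_subset by blast
    show "allowed k l" if "(k, l) \<in> ?S" for k l using that al D_allowed by auto
    fix x y k l
    assume W: "i 0 \<le> x \<and> j 0 \<le> y \<and> (\<exists>s\<in>{1..t}. x < i s \<and> y < j s)" and "gap x y = 1"
      "(k, l) \<in> ?S" "x < k" "y < l"
    moreover from this have "(k, l) \<in> D" "(k, l) \<notin> (\<lambda>s. (i s, j s)) ` {1..t}" by auto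
    ultimately have "seen x y" using new by blast
    then show "\<exists>k' l'. (k', l') \<in> D' \<and> x < k' \<and> y < l'" unfolding seen_def .
  qed
qed

lemma move_ii:
  assumes "i0 < i1" "j0 < j1" "0 < M (i0, j0)" "0 < M (i1, j1)"
    and "\<And>x y. i0 \<le> x \<Longrightarrow> x \<le> i1 \<Longrightarrow> j0 \<le> y \<Longrightarrow> y \<le> j1
      \<Longrightarrow> (x, y) \<notin> {(i0, j0), (i1, j1), (i0, j1), (i1, j0)} \<Longrightarrow> M (x, y) = 0"
    and "(i1, j1) \<notin> D" "(i0, j1) \<notin> D \<or> (i1, j0) \<notin> D" "(i0, j0) \<notin> D \<or> 1 < M (i0, j0)"
  shows "simple_move (M, D) (swap_mat M i0 j0 i1 j1, D)"
  unfolding swap_mat_def using assms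
  by (intro simple_move.ii) (auto simp: pair_less_iff)

lemma chain_move:
  assumes t: "1 \<le> t" and i: "strict_mono_on {0..t} i" and j: "strict_antimono_on {1..t} j"
    and jt: "j 0 < j t" and inD: "\<And>s. s \<in> {1..t} \<Longrightarrow> (i s, j s) \<in> D" and pos: "0 < M (i 0, j 0)"
    and zero: "\<And>x y s. s \<in> {1..t} \<Longrightarrow> i 0 \<le> x \<Longrightarrow> x < i s \<Longrightarrow> j 0 \<le> y \<Longrightarrow> y < j s
      \<Longrightarrow> (x, y) \<noteq> (i 0, j 0) \<Longrightarrow> M (x, y) = 0"
  shows "simple_move (M, D) (chain_mat M i j t,
    maxset ((D - (\<lambda>s. (i s, j s)) ` {0..t}) \<union> {(i 0, j 1), (i t, j 0)}))"
  unfolding chain_mat_def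
proof (rule simple_move.v[where M = M and i = i and j = j, OF t i j jt _ pos])
  show "\<forall>s\<in>{1..t}. (i s, j s) \<in> D" using inD by blast
  show "\<forall>p. (i 0, j 0) < p \<and> (\<exists>s\<in>{1..t}. p \<le> (i s - 1, j s - 1)) \<longrightarrow> M p = 0"
  proof (intro allI impI, elim conjE bexE)
    fix p s assume *: "(i 0, j 0) < p" "s \<in> {1..t}" "p \<le> (i s - 1, j s - 1)"
    obtain x y where p: "p = (x, y)" by fastforce
    \<comment> \<open>Decorated positions are 1-based, so \<open>i s - 1\<close> and
      \<open>j s - 1\<close> do not truncate.\<close>
    have "0 < i s \<and> 0 < j s" using transport_outside[OF transp D_pos[OF inD[OF *(2)]]] by simp
    then show "M p = 0" using zero[OF *(2), of x y] * by (auto simp: p pair_less_iff)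
  qed
qed

section \<open>Choice of a move\<close>

definition saturated :: bool where
  "saturated \<longleftrightarrow> (\<forall>i j. allowed i j \<longrightarrow> 0 < M (i, j) \<longrightarrow> below (i, j) D)"

text \<open>A position of least coordinate sum is added: smaller positions are allowed too, so
  occupied ones among them are already below the decoration, as move (i) demands.\<close>

lemma step_unsaturated:
  assumes "\<not> saturated"
  shows "\<exists>D1. simple_move (M, D) (M, D1) \<and> step M D1"
proof -
  let ?Q = "\<lambda>n. \<exists>i j. n = i + j \<and> allowed i j \<and> 0 < M (i, j) \<and> \<not> below (i, j) D"
  have ex: "\<exists>n. ?Q n" using assms unfolding saturated_def by blast
  then obtain i j where ij: "(LEAST n. ?Q n) = i + j" "allowed i j" "0 < M (i, j)" "\<not> below (i, j) D"
    using LeastI_ex[OF ex] by blast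
  have least: "M (k, l) = 0" if "(k, l) < (i, j)" "\<not> below (k, l) D" for k l
  proof (rule ccontr)
    assume "M (k, l) \<noteq> 0"
    then have "?Q (k + l)" using that ij(2) allowed_mono[of i j k l] by (auto simp: pair_less_iff)
    moreover have "k + l < i + j" using that(1) by (auto simp: pair_less_iff)
    ultimately show False using not_less_Least[of "k + l" ?Q] ij(1) by simp
  qed
  let ?D1 = "maxset (D \<union> {(i, j)})"
  have "simple_move (M, D) (M, ?D1)"
    by (rule simple_move.i) (use ij least in auto)
  moreover have "step M ?D1"
    unfolding step_def
  proof
    have fin: "finite (D \<union> {(i, j)})" using finite_D by simp
    have ne: "?D1 \<noteq> {}" using ex_maxset_above[OF fin, of i j] by auto
    show "rank_pair b c M M' ?D1 D'"
    proof
      show "decorated b c (M, ?D1)"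
        unfolding decorated_iff
      proof (intro conjI ballI transp ne antichain_maxset)
        fix p assume "p \<in> ?D1"
        then have "p \<in> D \<union> {(i, j)}" using maxset_subset by blast
        then show "0 < M p" using D_pos ij by blast
      qed
      show "\<exists>k' l'. (k', l') \<in> D' \<and> x < k' \<and> y < l'"
        if "(k, l) \<in> ?D1" "x < k" "y < l" "rk M x y = rk M' x y" for k l x y
        using that maxset_subset[of "D \<union> {(i, j)}"] D_allowed[of k l] ij(2) allowedD[of k l x y]
        unfolding seen_def gap_def by auto
    qed (use dec' rk_le in auto)
    let ?N = "\<lambda>D. {p \<in> {1..length b} \<times> {1..length c}. \<not> below p D}"
    have "?N ?D1 \<subset> ?N D"
    proof
      show "?N ?D1 \<subseteq> ?N D"
      proof -
        have "below (x, y) ?D1" if "below (x, y) D" for x y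
        proof -
          obtain k l where "(k, l) \<in> D" "x \<le> k" "y \<le> l" using \<open>below (x, y) D\<close> by (auto simp: below_iff)
          then show ?thesis using ex_maxset_above[OF fin, of k l] unfolding below_iff by (meson UnI1 le_trans)
        qed
        then show ?thesis by auto
      qed
      have "(i, j) \<in> ?N D" using ij transport_outside[OF transp ij(3)] by auto
      moreover have "below (i, j) ?D1" using ex_maxset_above[OF fin, of i j] by (auto simp: below_iff)
      ultimately show "?N ?D1 \<noteq> ?N D" by blast
    qed
    then have "card (?N ?D1) < card (?N D)" by (intro psubset_card_mono) auto
    then show "(progress b c (M, ?D1), progress b c (M, D)) \<in> less_than <*lex*> less_than" by simp
  qed
  ultimately show ?thesis by blast
qed

text \<open>Without gap the matrices agree, and each decoration lies below the other: one direction
  because its positions are allowed, the other by saturation. Antichains that dominate each other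
  are equal.\<close>

lemma saturated_gap_zero:
  assumes sat: saturated and zero: "\<And>i j. gap i j = 0"
  shows "M = M' \<and> D = D'"
proof
  show MM: "M = M'" using zero by (intro rk_inject) (simp add: gap_def)
  have anti': "antichain D'" using dec' by (simp add: decorated_iff del: decorated.simps)
  have 1: "\<exists>k l. (k, l) \<in> D' \<and> i \<le> k \<and> j \<le> l" if ij: "(i, j) \<in> D" for i j
  proof -
    \<comment> \<open>Strictly beyond the diagonal predecessor means weakly beyond
      \<open>(i, j)\<close>.\<close>
    obtain a e where "i = Suc a" "j = Suc e"
      using transport_outside[OF transp D_pos[OF ij]] by (meson gr0_implies_Suc)
    then show ?thesis
      using allowedD[OF D_allowed[OF ij], of a e] zero unfolding seen_def by (auto simp: Suc_le_eq)
  qed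
  have 2: "\<exists>k l. (k, l) \<in> D \<and> i \<le> k \<and> j \<le> l" if "(i, j) \<in> D'" for i j
  proof -
    have "allowed i j" using that unfolding allowed_def blocked_iff seen_def by blast
    then show ?thesis using sat D'_pos[OF that] MM unfolding saturated_def below_iff by metis
  qed
  show "D = D'"
  proof (intro equalityI subrelI)
    fix i j assume ij: "(i, j) \<in> D"
    obtain k l where kl: "(k, l) \<in> D'" "i \<le> k" "j \<le> l" using 1[OF ij] by blast
    obtain x y where xy: "(x, y) \<in> D" "k \<le> x" "l \<le> y" using 2[OF kl(1)] by blast
    show "(i, j) \<in> D'" using D_eqI[OF ij xy(1)] kl xy by (metis le_antisym le_trans)
  next
    fix i j assume ij: "(i, j) \<in> D'"
    obtain k l where kl: "(k, l) \<in> D" "i \<le> k" "j \<le> l" using 2[OF ij] by blast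
    obtain x y where xy: "(x, y) \<in> D'" "k \<le> x" "l \<le> y" using 1[OF kl(1)] by blast
    show "(i, j) \<in> D" using antichainD[OF anti' ij xy(1)] kl xy by (metis le_antisym le_trans)
  qed
qed

text \<open>A copy at the top can be moved without touching the decoration. If some target has a
  decorated position strictly beyond it, a minimal target below it is seen and nothing new gets
  blocked. If not, \<open>harmless\<close> says that only decorated targets can be spoiled: without
  any, the swap to a minimal target works; otherwise all of them form the staircase of move
  (v).\<close>

lemma step_free_top:
  assumes sat: saturated and top: "top i0 j0" and e: "(i0, j0) \<notin> D \<or> 1 < M (i0, j0)"
  shows "\<exists>M1 D1. simple_move (M, D) (M1, D1) \<and> step M1 D1"
proof -
  have pos: "0 < M (i0, j0)" and gap0: "0 < gap i0 j0" using top unfolding top_def by auto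
  have swap: "\<exists>M1 D1. simple_move (M, D) (M1, D1) \<and> step M1 D1"
    if f: "target i0 j0 i1 j1"
      and min: "\<And>x y. target i0 j0 x y \<Longrightarrow> x \<le> i1 \<Longrightarrow> y \<le> j1 \<Longrightarrow> x = i1 \<and> y = j1"
      and f_notin: "(i1, j1) \<notin> D"
      and new: "\<And>x y k l. i0 \<le> x \<Longrightarrow> x < i1 \<Longrightarrow> j0 \<le> y \<Longrightarrow> y < j1 \<Longrightarrow> gap x y = 1 \<Longrightarrow> (k, l) \<in> D
        \<Longrightarrow> x < k \<Longrightarrow> y < l \<Longrightarrow> seen x y" for i1 j1
  proof -
    have lt: "i0 < i1" "j0 < j1" "0 < M (i1, j1)" and cl: "clear i0 j0 i1 j1"
      using f unfolding target_def by auto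
    \<comment> \<open>If both side corners were decorated, no blocked pair could forbid
      \<open>(i1, j1)\<close>; saturation would then put it below a decorated position that exceeds
      \<open>(i0, j1)\<close>.\<close>
    have ab: "(i0, j1) \<notin> D \<or> (i1, j0) \<notin> D"
    proof (rule ccontr)
      assume "\<not> ?thesis"
      then have ab: "(i0, j1) \<in> D" "(i1, j0) \<in> D" by auto
      have "allowed i1 j1"
        unfolding allowed_def
      proof (intro allI impI notI)
        fix x y assume bl: "blocked x y" "x < i1 \<and> y < j1"
        then have gz: "gap x y = 0" and ns: "\<not> seen x y" unfolding blocked_iff by auto
        have "\<not> x < i0" using allowedD[OF D_allowed[OF ab(1)], of x y] gz ns bl by auto
        moreover have "\<not> y < j0" using allowedD[OF D_allowed[OF ab(2)], of x y] gz ns bl by auto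
        ultimately show False using clearD[OF cl, of x y] gz bl by auto
      qed
      then obtain k l where "(k, l) \<in> D" "i1 \<le> k" "j1 \<le> l"
        using sat lt(3) unfolding saturated_def below_iff by blast
      then show False using D_eqI[OF ab(1), of k l] lt by auto
    qed
    have "simple_move (M, D) (swap_mat M i0 j0 i1 j1, D)"
      by (rule move_ii[OF lt(1,2) pos lt(3) _ f_notin ab e]) (rule min_target_inner[OF top f min], auto)
    moreover have "step (swap_mat M i0 j0 i1 j1) D"
      by (rule swap_keep[OF lt(1,2) pos lt(3) cl e f_notin]) (rule new)
    ultimately show ?thesis by blast
  qed
  show ?thesis
  proof (cases "\<exists>k l k' l'. target i0 j0 k l \<and> (k', l') \<in> D \<and> k < k' \<and> l < l'")
    case True
    then obtain k l k' l' where kl: "target i0 j0 k l" "(k', l') \<in> D" "k < k'" "l < l'" by blast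
    from ex_min_target[OF kl(1)] obtain i1 j1
      where f: "target i0 j0 i1 j1" "i1 \<le> k" "j1 \<le> l"
        and min: "\<And>x y. target i0 j0 x y \<Longrightarrow> x \<le> i1 \<Longrightarrow> y \<le> j1 \<Longrightarrow> x = i1 \<and> y = j1"
      by auto
    have lt: "i0 < i1" "j0 < j1" "0 < M (i1, j1)" using f unfolding target_def by auto
    \<comment> \<open>An occupied position beyond a top cannot have positive gap. Being tight and
      before a decorated position, it is seen, and so is the whole rectangle.\<close>
    have "gap i1 j1 = 0"
    proof (rule ccontr)
      assume "gap i1 j1 \<noteq> 0"
      then have "0 < gap i1 j1" by (simp add: gap_pos_iff)
      then show False using top lt unfolding top_def by (metis less_imp_le_nat less_irrefl)
    qed
    then have "seen i1 j1" using allowedD[OF D_allowed[OF kl(2)], of i1 j1] f kl by auto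
    then have "seen x y" if "x < i1" "y < j1" for x y using seen_mono that by (meson less_imp_le_nat)
    moreover have "(i1, j1) \<notin> D" using D_eqI[of i1 j1 k' l'] f kl by auto
    ultimately show ?thesis using swap[OF f(1) min] by blast
  next
    case False
    then have none: "target i0 j0 k l \<Longrightarrow> (k', l') \<in> D \<Longrightarrow> \<not> (k < k' \<and> l < l')" for k l k' l' by blast
    \<comment> \<open>All decorated targets at once: any of them left out of the chain could be
      spoiled by the drop.\<close>
    define S where "S = {(k, l). (k, l) \<in> D \<and> target i0 j0 k l}"
    have SD: "S \<subseteq> D" unfolding S_def by auto
    show ?thesis
    proof (cases "S = {}")
      case True
      obtain k l where kl: "target i0 j0 k l" using ex_target[OF gap0] by blast
      from ex_min_target[OF kl] obtain i1 j1
        where f: "target i0 j0 i1 j1"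
          and min: "\<And>x y. target i0 j0 x y \<Longrightarrow> x \<le> i1 \<Longrightarrow> y \<le> j1 \<Longrightarrow> x = i1 \<and> y = j1"
        by auto
      have noS: "\<not> target i0 j0 k l" if "(k, l) \<in> D" for k l using True that unfolding S_def by blast
      have notin: "(i1, j1) \<notin> D" using noS f by blast
      show ?thesis
      proof (rule swap[OF f min notin], assumption, assumption, assumption, rule ccontr)
        fix x y k l
        assume *: "i0 \<le> x" "x < i1" "j0 \<le> y" "y < j1" "gap x y = 1" "(k, l) \<in> D" "x < k" "y < l" "\<not> seen x y"
        show False using harmless[OF none f *(1,3,2,4,5,9,6,7,8)] noS[OF *(6)] by blast
      qed
    next
      case False
      have finS: "finite S" using SD finite_D by (rule finite_subset)
      have antiS: "antichain S" using anti SD by (rule antichain_subset)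
      have aboveS: "i0 < k \<and> j0 < l" if "(k, l) \<in> S" for k l
        using that unfolding S_def target_def by blast
      obtain t i j where t: "1 \<le> t" "strict_mono_on {0..t} i" "strict_antimono_on {1..t} j"
        and ij: "i 0 = i0" "j 0 = j0" "j 0 < j t" and S: "S = (\<lambda>s. (i s, j s)) ` {1..t :: nat}"
        by (rule antichain_enum[OF finS False antiS aboveS])
      have inS: "(i s, j s) \<in> S" if "s \<in> {1..t}" for s using that S by blast
      then have inD: "(i s, j s) \<in> D" and tg: "target i0 j0 (i s) (j s)" if "s \<in> {1..t}" for s
        using that unfolding S_def by auto
      have cl: "clear (i 0) (j 0) (i s) (j s)" if "s \<in> {1..t}" for s
        using tg[OF that] unfolding target_def ij by blast
      have pos': "0 < M (i 0, j 0)" using pos ij by simp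
      have "simple_move (M, D) (chain_mat M i j t,
          maxset ((D - (\<lambda>s. (i s, j s)) ` {0..t}) \<union> {(i 0, j 1), (i t, j 0)}))"
      proof (rule chain_move[OF t ij(3) inD pos'])
        fix x y s
        assume *: "s \<in> {1..t}" "i 0 \<le> x" "x < i s" "j 0 \<le> y" "y < j s" "(x, y) \<noteq> (i 0, j 0)"
        then have "0 < gap x y" using cl[OF *(1)] unfolding clear_def by blast
        then show "M (x, y) = 0" using top * unfolding top_def ij by (metis gr0I)
      qed
      moreover have "step (chain_mat M i j t)
          (maxset ((D - (\<lambda>s. (i s, j s)) ` {0..t}) \<union> {(i 0, j 1), (i t, j 0)}))"
      proof (rule chain_step[OF t ij(3) inD pos' cl], assumption, assumption, rule ccontr)
        fix x y k l s
        assume *: "s \<in> {1..t}" "i 0 \<le> x" "x < i s" "j 0 \<le> y" "y < j s" "gap x y = 1" "(k, l) \<in> D"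
          "(k, l) \<notin> (\<lambda>s. (i s, j s)) ` {1..t}" "x < k" "y < l" "\<not> seen x y"
        have "target i0 j0 k l"
          by (rule harmless[OF none tg[OF *(1)], of x y k l]) (use * ij in auto)
        then show False using *(7,8) unfolding S[symmetric] S_def by blast
      qed
      ultimately show ?thesis by blast
    qed
  qed
qed

text \<open>\<open>u\<close> is a blocked pair that forbids \<open>(i0, j1)\<close>, and
  \<open>w\<close> is one that forbids \<open>(i1, j0)\<close>. A zero of \<open>gap\<close> weakly
  beyond a blocked pair is blocked again; so by clearness and the maximality of \<open>u1\<close>
  and \<open>w2\<close>, a rightmost zero in the rows between \<open>u1\<close> and
  \<open>i1\<close> passes neither below \<open>w\<close> nor to the right of \<open>u\<close>. In
  column \<open>w2\<close> the pair \<open>w\<close> itself is taken.\<close>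

lemma corner_half:
  assumes cl: "clear i0 j0 i1 j1"
    and u: "blocked u1 u2" "u1 < i0" "j0 \<le> u2" "u2 < j1"
    and u_max: "\<forall>x y. blocked x y \<longrightarrow> x < i0 \<longrightarrow> j0 \<le> y \<longrightarrow> y < j1 \<longrightarrow> x \<le> u1"
    and w: "blocked w1 w2" "w2 < j0" "i0 \<le> w1" "w1 < i1"
    and w_max: "\<forall>x y. blocked x y \<longrightarrow> y < j0 \<longrightarrow> i0 \<le> x \<longrightarrow> x < i1 \<longrightarrow> y \<le> w2"
  obtains z1 z2 where "gap z1 z2 = 0" "u1 < z1" "z1 \<le> w1" "w2 \<le> z2" "z2 < u2"
    "\<forall>x y. gap x y = 0 \<longrightarrow> u1 < x \<longrightarrow> x < i1 \<longrightarrow> y < j1 \<longrightarrow> y \<le> z2"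
    "z2 = w2 \<longrightarrow> z1 = w1"
proof -
  let ?Q = "\<lambda>y. y < j1 \<and> (\<exists>x. gap x y = 0 \<and> u1 < x \<and> x < i1)"
  define z2 where "z2 = Greatest ?Q"
  have gw: "gap w1 w2 = 0" and gu: "gap u1 u2 = 0" using u w unfolding blocked_iff by auto
  have Qw: "?Q w2" using gw w u by (auto intro!: exI[of _ w1])
  have Qz: "?Q z2" unfolding z2_def by (rule GreatestI_nat[of ?Q w2 j1]) (use Qw in auto)
  have le: "y \<le> z2" if "gap x y = 0" "u1 < x" "x < i1" "y < j1" for x y
    unfolding z2_def by (rule Greatest_le_nat[of ?Q y j1]) (use that in auto)
  have wz: "w2 \<le> z2" using le[OF gw] w u by auto
  obtain z1 where z1: "gap z1 z2 = 0" "u1 < z1" "z1 < i1" "z2 = w2 \<Longrightarrow> z1 = w1"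
  proof (cases "z2 = w2")
    case True then show thesis using that[of w1] gw w u by auto
  next
    case False then show thesis using that Qz by auto
  qed
  have "z1 \<le> w1"
  proof (rule ccontr)
    assume *: "\<not> z1 \<le> w1"
    then have bz: "blocked z1 z2" using blocked_mono[OF w(1), of z1 z2] wz z1 by auto
    have "z2 < j0" using clearD[OF cl, of z1 z2] z1 Qz * w by fastforce
    then have "z2 = w2" using w_max bz wz z1 * w by (metis le_antisym le_trans nat_le_linear)
    then show False using z1 * by auto
  qed
  moreover have "z2 < u2"
  proof (rule ccontr)
    assume *: "\<not> z2 < u2"
    then have bz: "blocked z1 z2" using blocked_mono[OF u(1), of z1 z2] z1 by auto
    have "z1 < i0" using clearD[OF cl, of z1 z2] z1 Qz * u by fastforce
    then have "z1 \<le> u1" using u_max bz Qz * u by (meson le_trans not_le)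
    then show False using z1 by simp
  qed
  ultimately show thesis using that[of z1 z2] z1 wz le by blast
qed

text \<open>If \<open>e = (i0, j0)\<close> were alone, inclusion-exclusion between \<open>u\<close>
  and the zero \<open>z\<close>, and between \<open>w\<close> and the mirror zero \<open>y\<close>,
  would both yield \<open>e\<close>. The first gives \<open>i0 \<le> z1\<close>, the second
  \<open>y1 < i0\<close>. But \<open>z\<close> is one of the zeros among which \<open>y1\<close> is
  maximal, unless \<open>z = w\<close>; and that is excluded because \<open>z\<close> is seen and
  \<open>w\<close> is not.\<close>

lemma ex_second:
  assumes lt: "i0 < i1" "j0 < j1" and cl: "clear i0 j0 i1 j1"
    and u: "blocked u1 u2" "u1 < i0" "j0 \<le> u2" "u2 < j1"
    and u_max: "\<forall>x y. blocked x y \<longrightarrow> x < i0 \<longrightarrow> j0 \<le> y \<longrightarrow> y < j1 \<longrightarrow> x \<le> u1"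
    and w: "blocked w1 w2" "w2 < j0" "i0 \<le> w1" "w1 < i1"
    and w_max: "\<forall>x y. blocked x y \<longrightarrow> y < j0 \<longrightarrow> i0 \<le> x \<longrightarrow> x < i1 \<longrightarrow> y \<le> w2"
    and e: "(i0, j0) \<in> D" "M (i0, j0) = 1"
  shows "\<exists>k l. u1 < k \<and> k \<le> w1 \<and> w2 < l \<and> l \<le> u2 \<and> 0 < M (k, l) \<and> (k, l) \<noteq> (i0, j0) \<and> clear k l i1 j1"
proof (rule ccontr)
  assume "\<not> ?thesis"
  then have only: "(k, l) = (i0, j0)"
    if "u1 < k" "k \<le> w1" "w2 < l" "l \<le> u2" "0 < M (k, l)" "clear k l i1 j1" for k l
    using that by blast
  have gu: "gap u1 u2 = 0" "\<not> seen u1 u2" and gw: "gap w1 w2 = 0" "\<not> seen w1 w2"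
    using u w unfolding blocked_iff by auto
  obtain z1 z2 where z: "gap z1 z2 = 0" "u1 < z1" "z1 \<le> w1" "w2 \<le> z2" "z2 < u2"
    and z_max: "\<forall>x y. gap x y = 0 \<longrightarrow> u1 < x \<longrightarrow> x < i1 \<longrightarrow> y < j1 \<longrightarrow> y \<le> z2"
    and z_w: "z2 = w2 \<longrightarrow> z1 = w1"
    by (rule corner_half[OF cl u u_max w w_max])
  have clz: "clear k l i1 j1" if "u1 < k" "z2 < l" for k l
    unfolding clear_def gap_pos_iff using z_max that by (meson le_less_trans less_le_trans not_le)
  have gz: "0 < gap z1 u2" using z_max[rule_format, of z1 u2] z w u gap_pos_iff by fastforce
  then have "0 < gap z1 u2 + gap u1 z2 - gap u1 u2 - gap z1 z2"
    using gap_nonneg[of u1 z2] gu z by linarith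
  then obtain k l where kl: "u1 < k" "k \<le> z1" "z2 < l" "l \<le> u2" "0 < M (k, l)"
    using block_ex[of u1 z1 z2 u2] z by auto
  then have "(k, l) = (i0, j0)" using only[of k l] clz[of k l] z by auto
  with kl have ez: "i0 \<le> z1" "z2 < j0" by auto
  \<comment> \<open>With \<open>e\<close> as the only occupied position the mass is 1, which is used
    up by the positive gap at \<open>(z1, u2)\<close>. So \<open>M'\<close> is empty on this
    rectangle and \<open>gap\<close> vanishes at its lower corner.\<close>
  have "mass M u1 z1 z2 u2 = int (M (i0, j0))"
  proof (rule mass_single)
    show "M (x, y) = 0" if "u1 < x" "x \<le> z1" "z2 < y" "y \<le> u2" "(x, y) \<noteq> (i0, j0)" for x y
      using only[of x y] clz[of x y] that z by (cases "M (x, y)") auto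
  qed (use u ez in auto)
  then have m: "1 - mass M' u1 z1 z2 u2 = gap z1 u2 + gap u1 z2"
    using gap_mass[of u1 z1 z2 u2] z gu e by auto
  have m0: "mass M' u1 z1 z2 u2 = 0" and "gap u1 z2 = 0"
    using m mass_nonneg[of M' u1 z1 z2 u2] gz gap_nonneg[of u1 z2] by linarith+
  \<comment> \<open>The tight pair \<open>(u1, z2)\<close> lies strictly before the decorated
    \<open>e\<close>. The element of \<Delta>' beyond it cannot pass column \<open>u2\<close> and
    cannot lie where \<open>M'\<close> is empty, so it is beyond \<open>z\<close>.\<close>
  then have "seen u1 z2" using allowedD[OF D_allowed[OF e(1)], of u1 z2] u ez by auto
  then obtain a d where ad: "(a, d) \<in> D'" "u1 < a" "z2 < d" unfolding seen_def by blast
  have "d \<le> u2" using gu(2) ad unfolding seen_def by (meson not_le)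
  have "z1 < a"
  proof (rule ccontr)
    assume "\<not> z1 < a"
    then have "int (M' (a, d)) \<le> 0" using mass_ge[of u1 a z1 z2 d u2 M'] ad \<open>d \<le> u2\<close> m0 by auto
    then show False using D'_pos[OF ad(1)] by simp
  qed
  then have "seen z1 z2" using ad unfolding seen_def by blast
  then have "w2 < z2" using z z_w gw by (cases "z2 = w2") auto
  interpret T: rank_pair c b "tpose M" "tpose M'" "prod.swap ` D" "prod.swap ` D'"
    by (rule rank_pair_tpose)
  have w_max': "\<forall>x y. blocked y x \<longrightarrow> x < j0 \<longrightarrow> i0 \<le> y \<longrightarrow> y < i1 \<longrightarrow> x \<le> w2"
    and u_max': "\<forall>x y. blocked y x \<longrightarrow> y < i0 \<longrightarrow> j0 \<le> x \<longrightarrow> x < j1 \<longrightarrow> y \<le> u1"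
    using u_max w_max by blast+
  \<comment> \<open>The mirror image of \<open>z\<close>: here the row of the zero is
    maximal.\<close>
  obtain y2 y1 where y: "gap y1 y2 = 0" "w2 < y2" "y2 \<le> u2" "u1 \<le> y1" "y1 < w1"
    and y_max: "\<forall>y x. gap x y = 0 \<longrightarrow> w2 < y \<longrightarrow> y < j1 \<longrightarrow> x < i1 \<longrightarrow> x \<le> y1"
    by (rule T.corner_half[of j0 i0 j1 i1 w2 w1 u2 u1, unfolded tpose_simps,
          OF cl w(1,2,3,4) w_max' u(1,2,3,4) u_max'])
  have cly: "clear k l i1 j1" if "y1 < k" "w2 < l" for k l
    unfolding clear_def gap_pos_iff using y_max that by (meson le_less_trans less_le_trans not_le)
  have "0 < gap w1 y2" using y_max[rule_format, of w1 y2] y w u gap_pos_iff by fastforce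
  then have "0 < gap w1 y2 + gap y1 w2 - gap y1 y2 - gap w1 w2"
    using gap_nonneg[of y1 w2] gw y by linarith
  then obtain k' l' where kl': "y1 < k'" "k' \<le> w1" "w2 < l'" "l' \<le> y2" "0 < M (k', l')"
    using block_ex[of y1 w1 w2 y2] y by auto
  then have "(k', l') = (i0, j0)" using only[of k' l'] cly[of k' l'] y by auto
  then have "y1 < i0" using kl' by auto
  moreover have "z1 \<le> y1" using y_max[rule_format, of z1 z2] z w u \<open>w2 < z2\<close> by auto
  ultimately show False using ez by auto
qed

text \<open>Moving \<open>e\<close> carries its decoration along. If one of the two new corners is
  allowed, the decoration passes there by move (iii). Otherwise blocked pairs \<open>u\<close> and
  \<open>w\<close> forbid both. A second top between them gives (iv)(a); failing that, a second
  occupied position is moved instead of \<open>e\<close>: by (v) if it is strictly before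
  \<open>e\<close> in both coordinates, by (ii) or (iv)(b), (c) if it shares a column or a row with
  \<open>e\<close>.\<close>

lemma step_all_tops_decorated:
  assumes sat: saturated and gap: "0 < gap i j"
    and tops: "\<And>i j. top i j \<Longrightarrow> (i, j) \<in> D \<and> M (i, j) = 1"
  shows "\<exists>M1 D1. simple_move (M, D) (M1, D1) \<and> step M1 D1"
proof -
  \<comment> \<open>The coordinate sum is minimised over the targets of all tops together, so the
    chosen target is minimal for every top that reaches it; (iv)(a) needs this for two tops.\<close>
  let ?R = "\<lambda>n. \<exists>i j k l. n = k + l \<and> top i j \<and> target i j k l"
  have "\<exists>n. ?R n"
  proof -
    obtain k l where "top k l" using ex_gap_M_pos[OF gap] ex_top by blast
    moreover from this obtain x y where "target k l x y" using ex_target unfolding top_def by blast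
    ultimately show ?thesis by blast
  qed
  then obtain i0 j0 i1 j1 where least: "(LEAST n. ?R n) = i1 + j1"
    and top: "top i0 j0" and f: "target i0 j0 i1 j1"
    using LeastI_ex[of ?R] by blast
  have fmin: "x = i1 \<and> y = j1" if "top i j" "target i j x y" "x \<le> i1" "y \<le> j1" for i j x y
    using Least_le[of ?R "x + y"] that least by fastforce
  have lt: "i0 < i1" "j0 < j1" and posf: "0 < M (i1, j1)" and cl: "clear i0 j0 i1 j1"
    using f unfolding target_def by auto
  have e: "(i0, j0) \<in> D" "M (i0, j0) = 1" using tops[OF top] by auto
  have below_pos: "\<exists>k l. top k l \<and> x \<le> k \<and> y \<le> l" if "0 < M (x, y)" "0 < gap x y" for x y
    using ex_top that by blast
  have D_top: "top k l" if kl: "(k, l) \<in> D" "0 < gap k l" for k l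
  proof -
    obtain x y where t: "top x y" "k \<le> x" "l \<le> y" using ex_top[OF D_pos[OF kl(1)] kl(2)] by blast
    then have "k = x \<and> l = y" using D_eqI[OF kl(1)] tops by blast
    then show ?thesis using t by simp
  qed
  note inner = min_target_inner[OF top f fmin[OF top]]
  show ?thesis
  proof (cases "allowed i0 j1")
    case al: True
    have "step (swap_mat M i0 j0 i1 j1) (maxset (D \<union> {(i0, j1)}))"
      by (rule swap_add[OF lt posf cl e(1)]) (use al in auto)
    moreover have "simple_move (M, D) (swap_mat M i0 j0 i1 j1, maxset (D \<union> {(i0, j1)}))"
      unfolding swap_mat_def
    proof (rule simple_move.iii_a[OF lt e posf])
      \<comment> \<open>If occupied, saturation would put it below a decorated position, which would
        exceed the decorated \<open>(i0, j0)\<close>.\<close>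
      have "M (i0, j1) = 0"
      proof (rule ccontr)
        assume "M (i0, j1) \<noteq> 0"
        then obtain k l where "(k, l) \<in> D" "i0 \<le> k" "j1 \<le> l"
          using sat al unfolding saturated_def below_iff by blast
        then show False using D_eqI[OF e(1), of k l] lt by auto
      qed
      then have "M (x, y) = 0" if "(i0, j0) < (x, y)" "(x, y) < (i1, j1)" "(x, y) \<noteq> (i1, j0)" for x y
        using inner[of x y] that by (cases "(x, y) = (i0, j1)") (auto simp: pair_less_iff)
      then show "\<forall>p. (i0, j0) < p \<and> p < (i1, j1) \<and> p \<noteq> (i1, j0) \<longrightarrow> M p = 0"
        by (metis surj_pair)
      show "\<forall>p. p \<le> (i0, j1) \<and> \<not> below p D \<longrightarrow> M p = 0"
        using sat allowed_mono[OF al] unfolding saturated_def by auto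
    qed
    ultimately show ?thesis by blast
  next
    case na: False
    show ?thesis
    proof (cases "allowed i1 j0")
      case al: True
      have "step (swap_mat M i0 j0 i1 j1) (maxset (D \<union> {(i1, j0)}))"
        by (rule swap_add[OF lt posf cl e(1)]) (use al in auto)
      moreover have "simple_move (M, D) (swap_mat M i0 j0 i1 j1, maxset (D \<union> {(i1, j0)}))"
        unfolding swap_mat_def
      proof (rule simple_move.iii_b[OF lt e posf])
        have "M (i1, j0) = 0"
        proof (rule ccontr)
          assume "M (i1, j0) \<noteq> 0"
          then obtain k l where "(k, l) \<in> D" "i1 \<le> k" "j0 \<le> l"
            using sat al unfolding saturated_def below_iff by blast
          then show False using D_eqI[OF e(1), of k l] lt by auto
        qed
        then have "M (x, y) = 0" if "(i0, j0) < (x, y)" "(x, y) < (i1, j1)" "(x, y) \<noteq> (i0, j1)" for x y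
          using inner[of x y] that by (cases "(x, y) = (i1, j0)") (auto simp: pair_less_iff)
        then show "\<forall>p. (i0, j0) < p \<and> p < (i1, j1) \<and> p \<noteq> (i0, j1) \<longrightarrow> M p = 0"
          by (metis surj_pair)
        show "\<forall>p. p \<le> (i1, j0) \<and> \<not> below p D \<longrightarrow> M p = 0"
          using sat allowed_mono[OF al] unfolding saturated_def by auto
      qed
      ultimately show ?thesis by blast
    next
      case nb: False
      have e_allowed: "\<not> (x < i0 \<and> y < j0)" if "blocked x y" for x y
        using D_allowed[OF e(1)] that unfolding allowed_def by blast
      \<comment> \<open>A pair forbidding \<open>(i0, j1)\<close> cannot lie before \<open>e\<close>
        in both coordinates, since \<open>e\<close> is decorated; so it lies above row
        \<open>i0\<close> and from column \<open>j0\<close> on. Symmetrically for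
        \<open>(i1, j0)\<close>. The pairs nearest to \<open>e\<close> are taken.\<close>
      let ?U = "\<lambda>x. \<exists>y. blocked x y \<and> x < i0 \<and> j0 \<le> y \<and> y < j1"
      let ?V = "\<lambda>y. \<exists>x. blocked x y \<and> y < j0 \<and> i0 \<le> x \<and> x < i1"
      have "\<exists>x. ?U x" using na e_allowed unfolding allowed_def by (meson not_le)
      then have "?U (Greatest ?U)" by (elim exE, rule_tac GreatestI_nat[where b = i0]) auto
      then obtain u1 u2 where u: "blocked u1 u2" "u1 < i0" "j0 \<le> u2" "u2 < j1" and u1: "u1 = Greatest ?U" by blast
      have u_max: "x \<le> u1" if "blocked x y" "x < i0" "j0 \<le> y" "y < j1" for x y
        unfolding u1 by (rule Greatest_le_nat[where b = i0]) (use that in auto)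
      have "\<exists>y. ?V y" using nb e_allowed unfolding allowed_def by (meson not_le)
      then have "?V (Greatest ?V)" by (elim exE, rule_tac GreatestI_nat[where b = j0]) auto
      then obtain w1 w2 where w: "blocked w1 w2" "w2 < j0" "i0 \<le> w1" "w1 < i1" and w2: "w2 = Greatest ?V" by blast
      have w_max: "y \<le> w2" if "blocked x y" "y < j0" "i0 \<le> x" "x < i1" for x y
        unfolding w2 by (rule Greatest_le_nat[where b = j0]) (use that in auto)
      \<comment> \<open>The maximal choice of \<open>u1\<close> and \<open>w2\<close> empties this
        window of blocked pairs; this is what makes the new decorated position of (iv)(a)
        allowed.\<close>
      have between: False if xy: "blocked x y" "u1 < x" "w2 < y" "x < i1" "y < j1" for x y
      proof -
        have "\<not> (i0 \<le> x \<and> j0 \<le> y)" using clearD[OF cl, of x y] xy unfolding blocked_iff by auto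
        then consider "x < i0" "j0 \<le> y" | "i0 \<le> x" "y < j0" using e_allowed[OF xy(1)] by linarith
        then show False
          using u_max[OF xy(1)] w_max[OF xy(1)] xy by cases auto
      qed
      have D_box: "k \<le> w1 \<and> l \<le> u2" if "(k, l) \<in> D" "u1 < k" "w2 < l" for k l
        using D_allowed[OF that(1)] u(1) w(1) that unfolding allowed_def by (meson not_le)
      have u_D: "(k, l) \<notin> D" if "u1 < k" "u2 < l" for k l
        using D_allowed[of k l] u(1) that unfolding allowed_def by blast
      have w_D: "(k, l) \<notin> D" if "w1 < k" "w2 < l" for k l
        using D_allowed[of k l] w(1) that unfolding allowed_def by blast
      have gap_f: "0 < gap k l" if "clear k l i1 j1" "k < i1" "l < j1" for k l
        using that unfolding clear_def by blast
      show ?thesis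
      proof (cases "\<exists>k l. top k l \<and> (k, l) \<noteq> (i0, j0) \<and> u1 < k \<and> w2 < l \<and> clear k l i1 j1")
        case True
        then obtain k l where g: "top k l" "(k, l) \<noteq> (i0, j0)" "u1 < k" "w2 < l" "clear k l i1 j1" by blast
        \<comment> \<open>Stated for two tops in open roles, because the second top may lie on
          either side of \<open>e\<close>.\<close>
        have cyc: ?thesis
          if a: "top a0 b0" "top a2 b2" "clear a0 b0 i1 j1" "clear a2 b2 i1 j1"
            and l: "a0 < a2" "a2 < i1" "b2 < b0" "b0 < j1" "u1 < a0" "w2 < b2" for a0 b0 a2 b2
        proof -
          have D: "(a0, b0) \<in> D" "(a2, b2) \<in> D" and one: "M (a0, b0) = 1" "M (a2, b2) = 1"
            using tops a by auto
          have al: "allowed a2 b0"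
            unfolding allowed_def
          proof (intro allI impI notI)
            fix x y assume bl: "blocked x y" "x < a2 \<and> y < b0"
            have "a0 \<le> x" using D_allowed[OF D(1)] bl unfolding allowed_def by (meson not_le)
            moreover have "b2 \<le> y" using D_allowed[OF D(2)] bl unfolding allowed_def by (meson not_le)
            ultimately show False using between[OF bl(1)] bl l by auto
          qed
          have "step (cyc_mat M a0 b0 a2 b2 i1 j1) (maxset (D \<union> {(a2, b0)}))"
            by (rule cyc_add[OF l(1-4) posf a(3,4) D al])
          moreover have "simple_move (M, D) (cyc_mat M a0 b0 a2 b2 i1 j1, maxset (D \<union> {(a2, b0)}))"
            unfolding cyc_mat_def
          proof (rule simple_move.iv_a[OF l(1-4) D one posf], intro allI impI, elim conjE, rule ccontr)
            fix p assume p: "(a0, b2) < p" "p < (i1, j1)" "\<not> below p D" "p \<noteq> (a0, j1)" "p \<noteq> (i1, b2)" "M p \<noteq> 0"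
            obtain x y where xy: "p = (x, y)" by fastforce
            have le: "a0 \<le> x" "b2 \<le> y" "x \<le> i1" "y \<le> j1" and pos: "0 < M (x, y)"
              using p unfolding xy by (auto simp: pair_less_iff)
            consider "x < i1" "y < j1" | "x = i1" "y < j1" "b2 < y" | "y = j1" "x < i1" "a0 < x"
            proof -
              have "x < i1 \<or> y < j1" "x \<noteq> i1 \<or> y \<noteq> b2" "x \<noteq> a0 \<or> y \<noteq> j1"
                using p unfolding xy by (auto simp: pair_less_iff)
              then show thesis using that le by (metis le_neq_implies_less)
            qed
            then show False
            proof cases
              case 1
              show False
              proof (cases "b0 \<le> y \<or> a2 \<le> x")
                case True
                then have "0 < gap x y" using a(3,4) le 1 unfolding clear_def by blast
                then show False using below_pos[OF pos] tops p(3) unfolding xy below_iff by blast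
              next
                case False
                then have "allowed x y" using allowed_mono[OF al, of x y] by auto
                then show False using sat pos p(3) unfolding saturated_def xy by blast
              qed
            next
              case 2
              have "target a2 b2 i1 y" using a(4) clear_mono[of a2 b2 i1 j1 a2 b2 i1 y] 2 l pos
                unfolding target_def by auto
              then show False using fmin[OF a(2), of i1 y] 2 by auto
            next
              case 3
              have "target a0 b0 x j1" using a(3) clear_mono[of a0 b0 i1 j1 a0 b0 x j1] 3 l pos
                unfolding target_def by auto
              then show False using fmin[OF a(1), of x j1] 3 by auto
            qed
          qed
          ultimately show ?thesis by blast
        qed
        have kD: "(k, l) \<in> D" using tops g by blast
        have klt: "k < i1" "l < j1" using D_box[OF kD g(3,4)] u w by auto
        consider "i0 < k" "l < j0" | "k < i0" "j0 < l"
          using D_eqI[OF e(1) kD] D_eqI[OF kD e(1)] g(2) by fastforce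
        then show ?thesis
        proof cases
          case 1
          then show ?thesis using cyc[OF top g(1) cl g(5)] klt lt u g by auto
        next
          case 2
          then show ?thesis using cyc[OF g(1) top g(5) cl] klt lt w g by auto
        qed
      next
        case False
        then have only: "(k, l) = (i0, j0)" if "top k l" "u1 < k" "w2 < l" "clear k l i1 j1" for k l
          using that by blast
        \<comment> \<open>With the largest coordinate sum, only \<open>e\<close> can be occupied
          between the chosen position and the far corner.\<close>
        let ?H = "\<lambda>n. \<exists>k l. n = k + l \<and> u1 < k \<and> w2 < l \<and> k < i1 \<and> l < j1 \<and> 0 < M (k, l)
          \<and> (k, l) \<noteq> (i0, j0) \<and> clear k l i1 j1"
        obtain k' l' where "u1 < k'" "k' \<le> w1" "w2 < l'" "l' \<le> u2" "0 < M (k', l')"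
            "(k', l') \<noteq> (i0, j0)" "clear k' l' i1 j1"
          using ex_second[OF lt cl u _ w _ e] u_max w_max by blast
        moreover from this have "k' < i1" "l' < j1" using u w by auto
        ultimately have "\<exists>n. ?H n" by blast
        then have "?H (Greatest ?H)" by (elim exE, rule_tac GreatestI_nat[where b = "i1 + j1"]) auto
        then obtain k l where great: "Greatest ?H = k + l"
          and kl: "u1 < k" "w2 < l" "k < i1" "l < j1" "0 < M (k, l)" "(k, l) \<noteq> (i0, j0)"
            "clear k l i1 j1"
          by (elim exE conjE) (rule that)
        have greatest: "x + y \<le> k + l" if "u1 < x" "w2 < y" "x < i1" "y < j1" "0 < M (x, y)"
          "(x, y) \<noteq> (i0, j0)" "clear x y i1 j1" for x y
          unfolding great[symmetric] by (rule Greatest_le_nat[where b = "i1 + j1"]) (use that in auto)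
        \<comment> \<open>A top above such a position lies in the same window, where
          \<open>e\<close> is the only top.\<close>
        have le_e: "x \<le> i0 \<and> y \<le> j0" if xy: "k \<le> x" "l \<le> y" "x < i1" "y < j1" "0 < M (x, y)" for x y
        proof -
          have cxy: "clear x y i1 j1" using clear_mono[OF kl(7)] xy by auto
          obtain x' y' where t: "top x' y'" "x \<le> x'" "y \<le> y'"
            using below_pos[OF xy(5) gap_f[OF cxy xy(3,4)]] by blast
          then have "clear x' y' i1 j1" using clear_mono[OF cxy] by auto
          then have "(x', y') = (i0, j0)" using only[OF t(1)] t xy kl by auto
          then show ?thesis using t by auto
        qed
        have two: "(x, y) = (k, l) \<or> (x, y) = (i0, j0)"
          if "k \<le> x" "l \<le> y" "x < i1" "y < j1" "0 < M (x, y)" for x y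
          using greatest[of x y] clear_mono[OF kl(7) that(1,2)] that kl by force
        \<comment> \<open>So a drop beyond \<open>(k, l)\<close> can conflict with no decorated
          position except \<open>e\<close>.\<close>
        have D_e: "(x, y) = (i0, j0)" if "(x, y) \<in> D" "k \<le> x" "l \<le> y" for x y
        proof -
          have lt': "x < i1" "y < j1" using D_box[OF that(1)] that kl u w by auto
          have "clear x y i1 j1" using clear_mono[OF kl(7)] that by auto
          then show ?thesis using only D_top[OF that(1)] gap_f lt' that kl by auto
        qed
        have kle: "k \<le> i0" "l \<le> j0" using le_e[of k l] kl by auto
        have kl_notin: "(k, l) \<notin> D" using D_e[of k l] kl by auto
        consider "k < i0" "l < j0" | "k < i0" "l = j0" | "k = i0" "l < j0" using kle kl(6) by fastforce
        then show ?thesis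
        proof cases
          case 1
          \<comment> \<open>Move (v) with \<open>t = 1\<close>: the decorated \<open>e\<close> is
            traded for the two side corners \<open>(k, j0)\<close> and
            \<open>(i0, l)\<close>.\<close>
          define i where "i s = (if s = 0 then k else i0)" for s :: nat
          define j where "j s = (if s = 0 then l else j0)" for s :: nat
          have ij: "(1::nat) \<le> 1" "strict_mono_on {0..1} i" "strict_antimono_on {1..1} j" "j 0 < j 1"
            "\<And>s. s \<in> {1..1} \<Longrightarrow> (i s, j s) \<in> D" "0 < M (i 0, j 0)"
            using 1 e kl by (auto simp: i_def j_def strict_mono_on_def monotone_on_def)
          let ?D = "maxset ((D - (\<lambda>s. (i s, j s)) ` {0..1}) \<union> {(i 0, j 1), (i 1, j 0)})"
          have "step (chain_mat M i j 1) ?D"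
          proof (rule chain_step[OF ij], assumption)
            show "clear (i 0) (j 0) (i s) (j s)" if "s \<in> {1..1}" for s
              using that clear_mono[OF kl(7), of k l i0 j0] lt by (auto simp: i_def j_def)
            fix x y k' l' s assume "s \<in> {1..1::nat}" "i 0 \<le> x" "j 0 \<le> y" "(k', l') \<in> D"
              "(k', l') \<notin> (\<lambda>s. (i s, j s)) ` {1..1}" "x < k'" "y < l'"
            then show "seen x y" using D_e[of k' l'] by (auto simp: i_def j_def)
          qed
          moreover have "simple_move (M, D) (chain_mat M i j 1, ?D)"
          proof (rule chain_move[OF ij], assumption, rule ccontr)
            fix x y s assume *: "s \<in> {1..1::nat}" "i 0 \<le> x" "x < i s" "j 0 \<le> y" "y < j s"
              "(x, y) \<noteq> (i 0, j 0)" "M (x, y) \<noteq> 0"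
            then show False using two[of x y] lt by (auto simp: i_def j_def)
          qed
          ultimately show ?thesis by blast
        next
          case 2
          \<comment> \<open>The far corner is the first occupied position of column
            \<open>j1\<close> past row \<open>k\<close>. Up to row \<open>i0\<close> the swap is a
            move (ii); past it, minimality of the target forces row \<open>i1\<close>, and the
            decorated \<open>e\<close> in between makes it a move (iv)(b).\<close>
          let ?Q = "\<lambda>x. k < x \<and> x \<le> i1 \<and> 0 < M (x, j1)"
          define x where "x = (LEAST x. ?Q x)"
          have x: "k < x" "x \<le> i1" "0 < M (x, j1)"
            using LeastI[of ?Q i1] posf kl unfolding x_def by auto
          have x_least: "M (x', j1) = 0" if "k < x'" "x' < x" for x'
            using not_less_Least[of x' ?Q] that x unfolding x_def[symmetric] by auto
          have "step (swap_mat M k l x j1) D"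
          proof (rule swap_keep[OF x(1) kl(4,5) x(3)])
            show "clear k l x j1" using clear_mono[OF kl(7)] x by auto
            show "(x, j1) \<notin> D" using u_D x kl u by auto
            fix x' y k' l' assume "k \<le> x'" "l \<le> y" "(k', l') \<in> D" "x' < k'" "y < l'"
            then show "seen x' y" using D_e[of k' l'] 2 by auto
          qed (use kl_notin in auto)
          moreover have "simple_move (M, D) (swap_mat M k l x j1, D)"
          proof (cases "x \<le> i0")
            case True
            show ?thesis
            proof (rule move_ii[OF x(1) kl(4,5) x(3)], rule ccontr)
              fix a d assume *: "k \<le> a" "a \<le> x" "l \<le> d" "d \<le> j1"
                "(a, d) \<notin> {(k, l), (x, j1), (k, j1), (x, l)}" "M (a, d) \<noteq> 0"
              show False
              proof (cases "d < j1")
                case True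
                then show False using two[of a d] * \<open>x \<le> i0\<close> lt 2 by auto
              next
                case False
                then show False using x_least[of a] * by auto
              qed
            qed (use u_D[of x j1] u_D[of k j1] x kl u kl_notin in auto)
          next
            case False
            have "target i0 j0 x j1" using False lt x(3) clear_mono[OF cl, of i0 j0 x j1] x(2)
              unfolding target_def by auto
            then have xi: "x = i1" using fmin[OF top] x by auto
            have nb': "\<not> below (k, j1) D"
              using u_D kl u unfolding below_iff by (meson less_le_trans)
            show ?thesis
              unfolding swap_mat_def xi
            proof (rule simple_move.iv_b[where ?i2.0 = i0], use kl 2 lt e posf nb' in \<open>simp_all\<close>)
              show "\<forall>a d. (k, j0) < (a, d) \<and> (a, d) < (i1, j1) \<and> (a = k \<longrightarrow> d \<noteq> j1) \<and> (a = i1 \<longrightarrow> d \<noteq> j0)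
                \<and> (a = i0 \<longrightarrow> d \<noteq> j0) \<longrightarrow> M (a, d) = 0"
              proof (intro allI impI, elim conjE, rule ccontr)
                fix a d assume *: "(k, j0) < (a, d)" "(a, d) < (i1, j1)" "a = k \<longrightarrow> d \<noteq> j1"
                  "a = i1 \<longrightarrow> d \<noteq> j0" "a = i0 \<longrightarrow> d \<noteq> j0" "M (a, d) \<noteq> 0"
                consider "a < i1" "d < j1" | "d = j1" "a < i1" | "a = i1" "d < j1" "j0 < d"
                proof -
                  have "a \<le> i1" "d \<le> j1" "a < i1 \<or> d < j1" "a \<noteq> i1 \<or> d \<noteq> j0" "j0 \<le> d"
                    using * by (auto simp: pair_less_iff)
                  then show thesis using that by (metis le_neq_implies_less)
                qed
                then show False
                proof cases
                  case 1
                  then show False using two[of a d] * 2 by (auto simp: pair_less_iff)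
                next
                  case 3
                  then have "target i0 j0 i1 d" using lt clear_mono[OF cl, of i0 j0 i1 d] *
                    unfolding target_def by auto
                  then show False using fmin[OF top, of i1 d] 3 by auto
                qed (use x_least[of a] xi * in \<open>auto simp: pair_less_iff\<close>)
              qed
            qed
          qed
          ultimately show ?thesis by blast
        next
          case 3
          \<comment> \<open>The mirror case along row \<open>i1\<close>, ending in a move (ii) or
            (iv)(c).\<close>
          let ?Q = "\<lambda>y. l < y \<and> y \<le> j1 \<and> 0 < M (i1, y)"
          define y where "y = (LEAST y. ?Q y)"
          have y: "l < y" "y \<le> j1" "0 < M (i1, y)"
            using LeastI[of ?Q j1] posf kl unfolding y_def by auto
          have y_least: "M (i1, y') = 0" if "l < y'" "y' < y" for y'
            using not_less_Least[of y' ?Q] that y unfolding y_def[symmetric] by auto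
          have "step (swap_mat M k l i1 y) D"
          proof (rule swap_keep[OF kl(3) y(1) kl(5) y(3)])
            show "clear k l i1 y" using clear_mono[OF kl(7)] y by auto
            show "(i1, y) \<notin> D" using w_D y kl w by auto
            fix x' y k' l' assume "k \<le> x'" "l \<le> y" "(k', l') \<in> D" "x' < k'" "y < l'"
            then show "seen x' y" using D_e[of k' l'] 3 by auto
          qed (use kl_notin in auto)
          moreover have "simple_move (M, D) (swap_mat M k l i1 y, D)"
          proof (cases "y \<le> j0")
            case True
            show ?thesis
            proof (rule move_ii[OF kl(3) y(1) kl(5) y(3)], rule ccontr)
              fix a d assume *: "k \<le> a" "a \<le> i1" "l \<le> d" "d \<le> y"
                "(a, d) \<notin> {(k, l), (i1, y), (k, y), (i1, l)}" "M (a, d) \<noteq> 0"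
              show False
              proof (cases "a < i1")
                case True
                then show False using two[of a d] * \<open>y \<le> j0\<close> lt 3 by auto
              next
                case False
                then show False using y_least[of d] * by auto
              qed
            qed (use w_D[of i1 y] w_D[of i1 l] y kl w kl_notin in auto)
          next
            case False
            have "target i0 j0 i1 y" using False lt y(3) clear_mono[OF cl, of i0 j0 i1 y] y(2)
              unfolding target_def by auto
            then have yj: "y = j1" using fmin[OF top] y by auto
            have nb': "\<not> below (i1, l) D"
              using w_D kl w unfolding below_iff by (meson less_le_trans)
            show ?thesis
              unfolding swap_mat_def yj
            proof (rule simple_move.iv_c[where ?j2.0 = j0], use kl 3 lt e posf nb' in \<open>simp_all\<close>)
              show "\<forall>a d. (i0, l) < (a, d) \<and> (a, d) < (i1, j1) \<and> (a = i0 \<longrightarrow> d \<noteq> j1) \<and> (a = i1 \<longrightarrow> d \<noteq> l)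
                \<and> (a = i0 \<longrightarrow> d \<noteq> j0) \<longrightarrow> M (a, d) = 0"
              proof (intro allI impI, elim conjE, rule ccontr)
                fix a d assume *: "(i0, l) < (a, d)" "(a, d) < (i1, j1)" "a = i0 \<longrightarrow> d \<noteq> j1"
                  "a = i1 \<longrightarrow> d \<noteq> l" "a = i0 \<longrightarrow> d \<noteq> j0" "M (a, d) \<noteq> 0"
                consider "a < i1" "d < j1" | "a = i1" "d < j1" | "d = j1" "a < i1" "i0 < a"
                proof -
                  have "a \<le> i1" "d \<le> j1" "a < i1 \<or> d < j1" "a \<noteq> i0 \<or> d \<noteq> j1" "i0 \<le> a"
                    using * by (auto simp: pair_less_iff)
                  then show thesis using that by (metis le_neq_implies_less)
                qed
                then show False
                proof cases
                  case 1
                  then show False using two[of a d] * 3 by (auto simp: pair_less_iff)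
                next
                  case 3
                  then have "target i0 j0 a j1" using lt clear_mono[OF cl, of i0 j0 a j1] *
                    unfolding target_def by auto
                  then show False using fmin[OF top, of a j1] 3 by auto
                qed (use y_least[of d] yj * in \<open>auto simp: pair_less_iff\<close>)
              qed
            qed
          qed
          ultimately show ?thesis by blast
        qed
      qed
    qed
  qed
qed

lemma ex_step:
  assumes "(M, D) \<noteq> (M', D')"
  shows "\<exists>M1 D1. simple_move (M, D) (M1, D1) \<and> step M1 D1"
proof (cases saturated)
  case False then show ?thesis using step_unsaturated by blast
next
  case sat: True
  obtain i j where gap: "0 < gap i j" using saturated_gap_zero[OF sat] assms gap_pos_iff by blast
  show ?thesis
  proof (cases "\<exists>i j. top i j \<and> ((i, j) \<notin> D \<or> 1 < M (i, j))")
    case True then show ?thesis using step_free_top[OF sat] by blast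
  next
    case False
    then have "top i j \<Longrightarrow> (i, j) \<in> D \<and> M (i, j) = 1" for i j
      using D_pos[of "(i, j)"] by (metis One_nat_def Suc_lessI)
    then show ?thesis using step_all_tops_decorated[OF sat gap] by blast
  qed
qed

end

text \<open>Well-founded recursion on \<open>progress\<close>: every step stays in the locale with
  the same target, and only equality with the target stops it.\<close>

theorem rank_pair_imp_move_le:
  assumes "rank_pair b c M M' D D'"
  shows "move_le (M, D) (M', D')"
  using assms
proof (induction "(M, D)" arbitrary: M D rule: wf_induct_rule[OF wf_inv_image[OF wf_lex_prod[OF wf_less_than wf_less_than], of "progress b c"]])
  case (1 M D)
  interpret rank_pair b c M M' D D' by fact
  show ?case
  proof (cases "(M, D) = (M', D')")
    case True then show ?thesis by (simp add: move_le_def)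
  next
    case False
    then obtain M1 D1 where *: "simple_move (M, D) (M1, D1)" "step M1 D1" using ex_step by blast
    then have "move_le (M1, D1) (M', D')"
      using 1(1)[of M1 D1] unfolding step_def by (simp add: inv_image_def del: progress.simps)
    then show ?thesis using *(1) unfolding move_le_def by (rule converse_rtranclp_into_rtranclp[rotated])
  qed
qed

section \<open>Orbits\<close>

context finite_dimensional_vector_space
begin

lemma basis_family_card: "basis_family I v \<Longrightarrow> card I = dim (UNIV :: 'b set)"
  unfolding basis_family_def by (metis card_image dim_eq_card dim_span)

lemma basis_family_finite: "basis_family I v \<Longrightarrow> finite I"
  unfolding basis_family_def using finite_imageD finiteI_independent by blast

lemma basis_family_comp:
  assumes "basis_family I v" "bij_betw e J I"
  shows "basis_family J (v \<circ> e)"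
  using assms unfolding basis_family_def bij_betw_def
  by (metis comp_inj_on image_comp)

lemma basis_familyI:
  assumes "finite I" "card I = dim (UNIV :: 'b set)" "span (v ` I) = UNIV"
  shows "basis_family I v"
proof -
  have "dim (UNIV :: 'b set) \<le> card (v ` I)"
    using dim_le_card[of UNIV "v ` I"] assms by simp
  then have card: "card (v ` I) = dim (UNIV :: 'b set)" using assms card_image_le[of I v] by simp
  then have "independent (v ` I)"
    using card_eq_dim[of "v ` I" UNIV] assms by auto
  moreover have "inj_on v I" using card assms by (intro eq_card_imp_inj_on) auto
  ultimately show ?thesis using assms unfolding basis_family_def by blast
qed

lemma basis_family_dim:
  assumes "basis_family I v" "J \<subseteq> I"
  shows "dim (span (v ` J)) = card J"
proof -
  have "independent (v ` J)"
    using assms independent_mono[of "v ` I" "v ` J"] unfolding basis_family_def by blast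
  then show ?thesis
    using assms card_image[of v J] inj_on_subset dim_span_eq_card_independent
    unfolding basis_family_def by metis
qed

lemma basis_family_sum_in_span:
  assumes v: "basis_family I v" and "K \<subseteq> I" "J \<subseteq> I"
  shows "(\<Sum>\<iota>\<in>K. v \<iota>) \<in> span (v ` J) \<longleftrightarrow> K \<subseteq> J"
proof
  assume "K \<subseteq> J"
  then show "(\<Sum>\<iota>\<in>K. v \<iota>) \<in> span (v ` J)" by (intro span_sum span_base) auto
next
  assume in_span: "(\<Sum>\<iota>\<in>K. v \<iota>) \<in> span (v ` J)"
  show "K \<subseteq> J"
  proof (rule ccontr)
    assume "\<not> K \<subseteq> J"
    then obtain k where k: "k \<in> K" "k \<notin> J" by blast
    have finK: "finite K" using basis_family_finite[OF v] assms(2) by (rule finite_subset[rotated])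
    have inj: "inj_on v I" and ind: "independent (v ` I)" using v unfolding basis_family_def by auto
    have sub: "v ` (I - {k}) \<subseteq> v ` I - {v k}" using inj k assms(2) by (auto simp: inj_on_def)
    have "(\<Sum>\<iota>\<in>K - {k}. v \<iota>) \<in> span (v ` (I - {k}))"
      using assms(2) by (intro span_sum span_base) auto
    moreover have "(\<Sum>\<iota>\<in>K. v \<iota>) \<in> span (v ` (I - {k}))"
      using in_span k assms(3) span_mono[of "v ` J" "v ` (I - {k})"] by blast
    moreover have "v k = (\<Sum>\<iota>\<in>K. v \<iota>) - (\<Sum>\<iota>\<in>K - {k}. v \<iota>)"
      using sum.remove[OF finK k(1), of v] by simp
    ultimately have "v k \<in> span (v ` (I - {k}))" by (metis span_diff)
    then have "v k \<in> span (v ` I - {v k})" using span_mono[OF sub] by blast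
    then show False using ind k assms(2) unfolding dependent_def by blast
  qed
qed

text \<open>A flag adapted to a basis is recorded by the level at which each vector enters. With an
  abstract index set, a degeneration can change the levels and keep the indices.\<close>

definition level_flag :: "nat \<Rightarrow> 'i set \<Rightarrow> ('i \<Rightarrow> nat) \<Rightarrow> ('i \<Rightarrow> 'b) \<Rightarrow> 'b set list" where
  "level_flag q I \<beta> v = map (\<lambda>i. span (v ` {\<iota> \<in> I. \<beta> \<iota> \<le> i})) [0..<q + 1]"

lemma level_flag_cong:
  assumes "\<And>i. span (u ` {\<iota> \<in> I. \<beta> \<iota> \<le> i}) = span (v ` {\<iota> \<in> J. \<gamma> \<iota> \<le> i})"
  shows "level_flag q I \<beta> u = level_flag q J \<gamma> v"
  unfolding level_flag_def using assms by simp

lemma orbit_eq: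
  "orbit q r (M, D) = {(span {\<Sum>(i, j)\<in>D. v (i, j, 1)},
      level_flag q (index_set q r M) fst v, level_flag r (index_set q r M) (fst \<circ> snd) v)
     | v. basis_family (index_set q r M) v}"
proof -
  have 1: "{v (i', j, k) | i' j k. (i', j, k) \<in> index_set q r M \<and> i' \<le> i}
      = v ` {\<iota> \<in> index_set q r M. fst \<iota> \<le> i}" for v :: "nat \<times> nat \<times> nat \<Rightarrow> 'b" and i
    by force
  have 2: "{v (i, j', k) | i j' k. (i, j', k) \<in> index_set q r M \<and> j' \<le> j}
      = v ` {\<iota> \<in> index_set q r M. (fst \<circ> snd) \<iota> \<le> j}" for v :: "nat \<times> nat \<times> nat \<Rightarrow> 'b" and j
    by force
  show ?thesis unfolding orbit.simps level_flag_def 1 2 by simp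
qed

lemma ex_bij_betw_first:
  assumes "finite F" "x \<in> F"
  obtains g where "bij_betw g {1..card F} F" "g 1 = x"
proof -
  obtain h where h: "bij_betw h {1..card F} F" using ex_bij_betw_nat_finite_1[OF assms(1)] by blast
  have "x \<in> h ` {1..card F}" using h assms(2) by (simp add: bij_betw_def)
  then obtain y where y: "y \<in> {1..card F}" "h y = x" by auto
  have "bij_betw (Transposition.transpose 1 y) {1..card F} {1..card F}"
    using y(1) permutes_swap_id[of 1 "{1..card F}" y] permutes_imp_bij by auto
  from bij_betw_trans[OF this h] show thesis using that y(2) by simp
qed

text \<open>A vector adapted to two flags is equivalent to the sum of basis vectors at the maximal
  positions of its support: each remaining vector is absorbed into one at a larger position.\<close>

lemma orbitI:
  assumes u: "basis_family I u"
    and range: "\<And>\<iota>. \<iota> \<in> I \<Longrightarrow> \<beta> \<iota> \<in> {1..q} \<and> \<gamma> \<iota> \<in> {1..r}"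
    and M: "\<And>p. M p = (\<Sum>\<iota>\<in>I. E (\<beta> \<iota>, \<gamma> \<iota>) p)"
    and D: "D = maxset {(\<beta> \<iota>, \<gamma> \<iota>) | \<iota>. \<iota> \<in> I \<and> cf \<iota> \<noteq> 0}"
  shows "(span {\<Sum>\<iota>\<in>I. cf \<iota> *s u \<iota>}, level_flag q I \<beta> u, level_flag r I \<gamma> u) \<in> orbit q r (M, D)"
proof -
  have finI: "finite I" using basis_family_finite[OF u] .
  define pos where "pos \<iota> = (\<beta> \<iota>, \<gamma> \<iota>)" for \<iota>
  define P where "P = {(\<beta> \<iota>, \<gamma> \<iota>) | \<iota>. \<iota> \<in> I \<and> cf \<iota> \<noteq> 0}"
  have finP: "finite P" unfolding P_def using finI by simp
  have DP: "D \<subseteq> P" unfolding D P_def using maxset_subset .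
  have antiD: "p = p'" if "p \<in> D" "p' \<in> D" "p \<le> p'" for p p'
    using antichainD[OF antichain_maxset[of P], of "fst p" "snd p" "fst p'" "snd p'"] that
    unfolding D P_def[symmetric] less_eq_prod_def by (simp add: prod_eq_iff)
  have "\<forall>p\<in>D. \<exists>\<iota>. \<iota> \<in> I \<and> cf \<iota> \<noteq> 0 \<and> pos \<iota> = p" using DP unfolding P_def pos_def by blast
  then obtain pick where pick: "\<And>p. p \<in> D \<Longrightarrow> pick p \<in> I \<and> cf (pick p) \<noteq> 0 \<and> pos (pick p) = p" by metis
  have "\<exists>p\<in>D. pos \<iota> \<le> p" if "\<iota> \<in> I" "cf \<iota> \<noteq> 0" for \<iota>
  proof -
    have "(\<beta> \<iota>, \<gamma> \<iota>) \<in> P" using that unfolding P_def by blast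
    from ex_maxset_above[OF finP this] obtain k l
      where "(k, l) \<in> maxset P" "\<beta> \<iota> \<le> k" "\<gamma> \<iota> \<le> l" by blast
    then show ?thesis
      unfolding D P_def[symmetric] pos_def by (intro bexI[of _ "(k, l)"]) simp_all
  qed
  then obtain up where up: "\<And>\<iota>. \<iota> \<in> I \<Longrightarrow> cf \<iota> \<noteq> 0 \<Longrightarrow> up \<iota> \<in> D \<and> pos \<iota> \<le> up \<iota>" by metis
  have up_pick: "up (pick p) = p" if "p \<in> D" for p
    using up[of "pick p"] pick[OF that] antiD[OF that, of "up (pick p)"] by simp
  \<comment> \<open>The support is split according to a chosen maximal position above each index;
    the picked vector at \<open>p\<close> is replaced by the whole part of the sum assigned to
    \<open>p\<close>.\<close>
  define W where "W p = {\<iota> \<in> I. cf \<iota> \<noteq> 0 \<and> up \<iota> = p}" for p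
  define w where "w \<iota> = (if \<iota> \<in> pick ` D then \<Sum>\<kappa>\<in>W (pos \<iota>). cf \<kappa> *s u \<kappa> else u \<iota>)" for \<iota>
  have w_pick: "w (pick p) = (\<Sum>\<kappa>\<in>W p. cf \<kappa> *s u \<kappa>)" if "p \<in> D" for p
    using that pick[OF that] unfolding w_def by simp
  have pick_W: "pick p \<in> W p" if "p \<in> D" for p
    using pick[OF that] up_pick[OF that] unfolding W_def by simp
  have finW: "finite (W p)" for p unfolding W_def using finI by simp
  have spans: "span (w ` {\<iota> \<in> I. lv \<iota> \<le> i}) = span (u ` {\<iota> \<in> I. lv \<iota> \<le> i})"
    if mono: "\<And>\<iota> p. p \<in> D \<Longrightarrow> \<iota> \<in> W p \<Longrightarrow> lv \<iota> \<le> lv (pick p)" for lv :: "'c \<Rightarrow> nat" and i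
  proof (rule span_eq[THEN iffD2], rule conjI)
    show "w ` {\<iota> \<in> I. lv \<iota> \<le> i} \<subseteq> span (u ` {\<iota> \<in> I. lv \<iota> \<le> i})"
    proof clarify
      fix \<iota> assume \<iota>: "\<iota> \<in> I" "lv \<iota> \<le> i"
      show "w \<iota> \<in> span (u ` {\<iota> \<in> I. lv \<iota> \<le> i})"
      proof (cases "\<iota> \<in> pick ` D")
        case True
        then obtain p where p: "p \<in> D" "\<iota> = pick p" by blast
        have "\<kappa> \<in> I \<and> lv \<kappa> \<le> i" if "\<kappa> \<in> W p" for \<kappa>
          using that mono[OF p(1) that] p \<iota> unfolding W_def by auto
        then show ?thesis unfolding p(2) w_pick[OF p(1)] by (intro span_sum span_scale span_base) auto
      next
        case False
        then show ?thesis using \<iota> unfolding w_def by (auto intro: span_base)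
      qed
    qed
    show "u ` {\<iota> \<in> I. lv \<iota> \<le> i} \<subseteq> span (w ` {\<iota> \<in> I. lv \<iota> \<le> i})"
    proof clarify
      fix \<iota> assume \<iota>: "\<iota> \<in> I" "lv \<iota> \<le> i"
      show "u \<iota> \<in> span (w ` {\<iota> \<in> I. lv \<iota> \<le> i})"
      proof (cases "\<iota> \<in> pick ` D")
        case True
        then obtain p where p: "p \<in> D" "\<iota> = pick p" by blast
        have other: "u \<kappa> \<in> span (w ` {\<iota> \<in> I. lv \<iota> \<le> i})" if "\<kappa> \<in> W p - {\<iota>}" for \<kappa>
        proof -
          have "\<kappa> \<notin> pick ` D" using that p up_pick unfolding W_def by auto
          then have "u \<kappa> = w \<kappa>" unfolding w_def by simp
          moreover have "\<kappa> \<in> I" "lv \<kappa> \<le> i" using that mono[OF p(1), of \<kappa>] p \<iota> unfolding W_def by auto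
          ultimately show ?thesis by (auto intro: span_base)
        qed
        \<comment> \<open>The coefficient of the picked vector is nonzero, so the replacement can be
          undone within the same levels.\<close>
        have "cf \<iota> *s u \<iota> = w \<iota> - (\<Sum>\<kappa>\<in>W p - {\<iota>}. cf \<kappa> *s u \<kappa>)"
          using sum.remove[OF finW pick_W[OF p(1)], of "\<lambda>\<kappa>. cf \<kappa> *s u \<kappa>"] w_pick[OF p(1)] p(2) by simp
        also have "\<dots> \<in> span (w ` {\<iota> \<in> I. lv \<iota> \<le> i})"
          using \<iota> other by (intro span_diff span_sum span_scale) (auto intro: span_base)
        finally have "inverse (cf \<iota>) *s (cf \<iota> *s u \<iota>) \<in> span (w ` {\<iota> \<in> I. lv \<iota> \<le> i})"
          by (rule span_scale)
        then show ?thesis using pick[OF p(1)] p(2) by simp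
      next
        case False
        then have "u \<iota> = w \<iota>" unfolding w_def by simp
        then show ?thesis using \<iota> by (auto intro: span_base)
      qed
    qed
  qed
  have below: "pos \<iota> \<le> pos (pick p)" if "p \<in> D" "\<iota> \<in> W p" for \<iota> p
    using that up pick[OF that(1)] unfolding W_def by auto
  have w_beta: "level_flag q I \<beta> w = level_flag q I \<beta> u"
    by (rule level_flag_cong, rule spans) (use below in \<open>auto simp: pos_def\<close>)
  have w_gamma: "level_flag r I \<gamma> w = level_flag r I \<gamma> u"
    by (rule level_flag_cong, rule spans) (use below in \<open>auto simp: pos_def\<close>)
  have "span (w ` I) = span (u ` I)" using spans[of "\<lambda>_. 0" 0] by simp
  then have w: "basis_family I w"
    using u basis_family_card[OF u] finI by (intro basis_familyI) (auto simp: basis_family_def)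
  have "(\<Sum>\<iota>\<in>I. cf \<iota> *s u \<iota>) = (\<Sum>\<iota>\<in>{\<iota> \<in> I. cf \<iota> \<noteq> 0}. cf \<iota> *s u \<iota>)"
    using finI by (intro sum.mono_neutral_right) auto
  also have "{\<iota> \<in> I. cf \<iota> \<noteq> 0} = (\<Union>p\<in>D. W p)" using up unfolding W_def by blast
  also have "(\<Sum>\<iota>\<in>(\<Union>p\<in>D. W p). cf \<iota> *s u \<iota>) = (\<Sum>p\<in>D. \<Sum>\<iota>\<in>W p. cf \<iota> *s u \<iota>)"
    using finW finite_subset[OF DP finP] by (intro sum.UNION_disjoint) (auto simp: W_def)
  also have "\<dots> = (\<Sum>p\<in>D. w (pick p))" using w_pick by simp
  finally have sum_w: "(\<Sum>\<iota>\<in>I. cf \<iota> *s u \<iota>) = (\<Sum>p\<in>D. w (pick p))" .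
  define F where "F p = {\<iota> \<in> I. pos \<iota> = p}" for p
  have cardF: "card (F p) = M p" for p
  proof -
    have "M p = (\<Sum>\<iota>\<in>I. if pos \<iota> = p then 1 else 0)"
      unfolding M pos_def E_def by (intro sum.cong) auto
    then show ?thesis unfolding F_def using finI by (simp add: sum.If_cases Int_def)
  qed
  have finF: "finite (F p)" for p unfolding F_def using finI by simp
  \<comment> \<open>Orbits put the decoration on third index 1, so the enumeration at a decorated
    position has to start with the picked vector.\<close>
  have "\<exists>g. bij_betw g {1..M p} (F p) \<and> (p \<in> D \<longrightarrow> g 1 = pick p)" for p
  proof (cases "p \<in> D")
    case True
    then have "pick p \<in> F p" using pick unfolding F_def by blast
    then show ?thesis using ex_bij_betw_first[OF finF, of "pick p" p] cardF by metis
  next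
    case False
    then show ?thesis using ex_bij_betw_nat_finite_1[OF finF, of p] cardF by auto
  qed
  then obtain g where g: "\<And>p. bij_betw (g p) {1..M p} (F p)" and g1: "\<And>p. p \<in> D \<Longrightarrow> g p 1 = pick p"
    by metis
  define \<phi> where "\<phi> = (\<lambda>(i, j, k). g (i, j) k)"
  let ?J = "index_set q r M"
  have \<phi>_F: "\<phi> (i, j, k) \<in> F (i, j)" if "(i, j, k) \<in> ?J" for i j k
    using that g[of "(i, j)"] unfolding \<phi>_def index_set_def bij_betw_def by auto
  have \<phi>_image: "\<phi> ` ?J = I"
  proof
    show "\<phi> ` ?J \<subseteq> I" using \<phi>_F unfolding F_def by auto
    show "I \<subseteq> \<phi> ` ?J"
    proof
      fix \<iota> assume \<iota>: "\<iota> \<in> I"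
      then have "\<iota> \<in> F (\<beta> \<iota>, \<gamma> \<iota>)" unfolding F_def pos_def by simp
      then have "\<iota> \<in> g (\<beta> \<iota>, \<gamma> \<iota>) ` {1..M (\<beta> \<iota>, \<gamma> \<iota>)}"
        using g[of "(\<beta> \<iota>, \<gamma> \<iota>)"] by (simp add: bij_betw_def)
      then obtain k where "k \<in> {1..M (\<beta> \<iota>, \<gamma> \<iota>)}" "g (\<beta> \<iota>, \<gamma> \<iota>) k = \<iota>" by auto
      then show "\<iota> \<in> \<phi> ` ?J"
        using range[OF \<iota>] by (intro image_eqI[of _ _ "(\<beta> \<iota>, \<gamma> \<iota>, k)"]) (auto simp: \<phi>_def index_set_def)
    qed
  qed
  have \<phi>_inj: "inj_on \<phi> ?J"
  proof (rule inj_onI)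
    fix x y assume xy: "x \<in> ?J" "y \<in> ?J" "\<phi> x = \<phi> y"
    obtain i j k where x: "x = (i, j, k)" by (cases x)
    obtain i' j' k' where y: "y = (i', j', k')" by (cases y)
    have *: "(i, j, k) \<in> ?J" "(i', j', k') \<in> ?J" "\<phi> (i, j, k) = \<phi> (i', j', k')"
      using xy unfolding x y by simp_all
    then have ij: "i = i'" "j = j'" using \<phi>_F[OF *(1)] \<phi>_F[OF *(2)] unfolding F_def by auto
    then have "g (i, j) k = g (i, j) k'" using * unfolding \<phi>_def by simp
    moreover have "inj_on (g (i, j)) {1..M (i, j)}" using g unfolding bij_betw_def by blast
    ultimately have "k = k'" using * ij unfolding index_set_def by (auto dest: inj_onD)
    then show "x = y" using ij x y by simp
  qed
  have pos_\<phi>: "\<beta> (\<phi> \<iota>) = fst \<iota>" "\<gamma> (\<phi> \<iota>) = fst (snd \<iota>)" if "\<iota> \<in> ?J" for \<iota>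
    using \<phi>_F[of "fst \<iota>" "fst (snd \<iota>)" "snd (snd \<iota>)"] that unfolding F_def pos_def by auto
  define v where "v = w \<circ> \<phi>"
  have "basis_family ?J v"
    unfolding v_def using \<phi>_image \<phi>_inj by (intro basis_family_comp[OF w]) (simp add: bij_betw_def)
  moreover have "level_flag q ?J fst v = level_flag q I \<beta> w"
  proof (rule level_flag_cong)
    fix i
    have "{\<iota> \<in> I. \<beta> \<iota> \<le> i} = \<phi> ` {\<iota> \<in> ?J. fst \<iota> \<le> i}"
      unfolding \<phi>_image[symmetric] using pos_\<phi> by (auto simp del: split_paired_All)
    then show "span (v ` {\<iota> \<in> ?J. fst \<iota> \<le> i}) = span (w ` {\<iota> \<in> I. \<beta> \<iota> \<le> i})"
      unfolding v_def by (simp add: image_comp)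
  qed
  moreover have "level_flag r ?J (fst \<circ> snd) v = level_flag r I \<gamma> w"
  proof (rule level_flag_cong)
    fix i
    have "{\<iota> \<in> I. \<gamma> \<iota> \<le> i} = \<phi> ` {\<iota> \<in> ?J. (fst \<circ> snd) \<iota> \<le> i}"
      unfolding \<phi>_image[symmetric] using pos_\<phi> by (auto simp del: split_paired_All)
    then show "span (v ` {\<iota> \<in> ?J. (fst \<circ> snd) \<iota> \<le> i}) = span (w ` {\<iota> \<in> I. \<gamma> \<iota> \<le> i})"
      unfolding v_def by (simp add: image_comp)
  qed
  moreover have "(\<Sum>(i, j)\<in>D. v (i, j, 1)) = (\<Sum>p\<in>D. w (pick p))"
    unfolding v_def \<phi>_def using g1 by (intro sum.cong) auto
  ultimately show ?thesis
    unfolding orbit_eq sum_w w_beta[symmetric] w_gamma[symmetric] mem_Collect_eq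
    by (intro exI[of _ v]) simp
qed

end

text \<open>Sorting by level turns the condition of level at most \<open>i\<close> into an initial
  segment of the enumeration, whose length is the sum of the first \<open>i\<close> parts; this is
  the form that \<open>flag_of\<close> expects.\<close>

lemma ex_level_enum:
  fixes \<beta> :: "'i \<Rightarrow> nat"
  assumes fin: "finite I" and range: "\<And>\<iota>. \<iota> \<in> I \<Longrightarrow> \<beta> \<iota> \<in> {1..length b}"
    and card: "\<And>i. i \<in> {1..length b} \<Longrightarrow> card {\<iota> \<in> I. \<beta> \<iota> = i} = b ! (i - 1)"
  obtains e where "card I = sum_list b" "bij_betw e {1..card I} I"
    "\<forall>i\<le>length b. e ` {1..sum_list (take i b)} = {\<iota> \<in> I. \<beta> \<iota> \<le> i}"
proof -
  obtain zs where zs: "set zs = I" "distinct zs" using finite_distinct_list[OF fin] by blast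
  define xs where "xs = sort_key \<beta> zs"
  have xs: "set xs = I" "distinct xs" "sorted (map \<beta> xs)" unfolding xs_def using zs by auto
  have len: "length xs = card I" using distinct_card[OF xs(2)] xs(1) by simp
  define e where "e l = xs ! (l - 1)" for l
  have e_card: "e ` {1..m} = (!) xs ` {..<m}" for m
  proof -
    have "{..<m} = (\<lambda>l. l - 1) ` {1..m}"
      by (auto intro!: image_eqI[of _ _ "Suc x" for x])
    then show ?thesis unfolding e_def by (simp add: image_image)
  qed
  have card_le: "card {\<iota> \<in> I. \<beta> \<iota> \<le> i} = sum_list (take i b)" if "i \<le> length b" for i
    using that
  proof (induction i)
    case 0
    have "{\<iota> \<in> I. \<beta> \<iota> \<le> 0} = {}" using range by fastforce
    then show ?case by (simp only: card.empty take_0 sum_list.Nil)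
  next
    case (Suc i)
    have "{\<iota> \<in> I. \<beta> \<iota> \<le> Suc i} = {\<iota> \<in> I. \<beta> \<iota> \<le> i} \<union> {\<iota> \<in> I. \<beta> \<iota> = Suc i}" by auto
    then have "card {\<iota> \<in> I. \<beta> \<iota> \<le> Suc i} = card {\<iota> \<in> I. \<beta> \<iota> \<le> i} + card {\<iota> \<in> I. \<beta> \<iota> = Suc i}"
      using fin by (simp add: card_Un_disjoint disjoint_iff)
    then show ?case using Suc card[of "Suc i"] by (simp add: take_Suc_conv_app_nth)
  qed
  have initial: "{l. l < length xs \<and> \<beta> (xs ! l) \<le> i} = {..<card {\<iota> \<in> I. \<beta> \<iota> \<le> i}}" (is "?A = _") for i
  proof -
    have "(!) xs ` ?A = {\<iota> \<in> I. \<beta> \<iota> \<le> i}" using xs(1) by (auto simp: in_set_conv_nth image_iff)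
    moreover have "inj_on ((!) xs) ?A" using xs(2) by (auto simp: inj_on_def nth_eq_iff_index_eq)
    ultimately have cA: "card ?A = card {\<iota> \<in> I. \<beta> \<iota> \<le> i}" using card_image by fastforce
    \<comment> \<open>A finite downward closed set of naturals is an initial segment.\<close>
    have "?A \<subseteq> {..<card ?A}"
    proof
      fix l assume l: "l \<in> ?A"
      have "{..l} \<subseteq> ?A"
        using l sorted_nth_mono[OF xs(3)] by (auto intro: order_trans)
      then have "card {..l} \<le> card ?A" by (intro card_mono) auto
      then show "l \<in> {..<card ?A}" by simp
    qed
    then have "?A = {..<card ?A}" by (intro card_subset_eq) auto
    then show ?thesis using cA by simp
  qed
  have "e ` {1..sum_list (take i b)} = {\<iota> \<in> I. \<beta> \<iota> \<le> i}" if "i \<le> length b" for i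
  proof -
    have "e ` {1..sum_list (take i b)} = (!) xs ` {l. l < length xs \<and> \<beta> (xs ! l) \<le> i}"
      unfolding e_card card_le[OF that, symmetric] initial ..
    also have "\<dots> = {\<iota> \<in> I. \<beta> \<iota> \<le> i}" using xs(1) by (auto simp: in_set_conv_nth image_iff)
    finally show ?thesis .
  qed
  moreover have "bij_betw e {1..card I} I"
  proof -
    have "e ` {1..card I} = I"
      unfolding e_card len[symmetric] using xs(1) by (auto simp: in_set_conv_nth image_iff)
    then show ?thesis by (simp add: bij_betw_def eq_card_imp_inj_on)
  qed
  moreover have "{\<iota> \<in> I. \<beta> \<iota> \<le> length b} = I" using range by auto
  then have "card I = sum_list b" using card_le[of "length b"] by simp
  ultimately show thesis using that by blast
qed

section \<open>Frames over orbit points\<close>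

context finite_dimensional_vector_space
begin

lemma card_index_set:
  assumes "transport b c M"
  defines "I \<equiv> index_set (length b) (length c) M"
  shows "finite I" "\<And>i. i \<in> {1..length b} \<Longrightarrow> card {\<iota> \<in> I. fst \<iota> = i} = b ! (i - 1)"
    "\<And>j. j \<in> {1..length c} \<Longrightarrow> card {\<iota> \<in> I. fst (snd \<iota>) = j} = c ! (j - 1)"
    "\<And>p. M p = (\<Sum>\<iota>\<in>I. E (fst \<iota>, fst (snd \<iota>)) p)"
    "\<And>\<iota>. \<iota> \<in> I \<Longrightarrow> fst \<iota> \<in> {1..length b} \<and> fst (snd \<iota>) \<in> {1..length c}"
proof -
  have I: "I = (SIGMA i:{1..length b}. SIGMA j:{1..length c}. {1..M (i, j)})"
    unfolding I_def index_set_def by auto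
  show fin: "finite I" unfolding I by auto
  show "card {\<iota> \<in> I. fst \<iota> = i} = b ! (i - 1)" if "i \<in> {1..length b}" for i
  proof -
    have "{\<iota> \<in> I. fst \<iota> = i} = Pair i ` (SIGMA j:{1..length c}. {1..M (i, j)})"
      using that unfolding I by auto
    then have "card {\<iota> \<in> I. fst \<iota> = i} = (\<Sum>j = 1..length c. M (i, j))"
      by (simp add: card_image inj_on_def card_SigmaI)
    then show ?thesis using assms(1) that unfolding transport_def by simp
  qed
  show "card {\<iota> \<in> I. fst (snd \<iota>) = j} = c ! (j - 1)" if "j \<in> {1..length c}" for j
  proof -
    have "{\<iota> \<in> I. fst (snd \<iota>) = j} = (\<lambda>(i, k). (i, j, k)) ` (SIGMA i:{1..length b}. {1..M (i, j)})"
      using that unfolding I by (auto simp: image_iff)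
    moreover have "inj_on (\<lambda>(i, k). (i, j, k)) (SIGMA i:{1..length b}. {1..M (i, j)})"
      by (auto simp: inj_on_def)
    ultimately have "card {\<iota> \<in> I. fst (snd \<iota>) = j} = (\<Sum>i = 1..length b. M (i, j))"
      by (simp add: card_image card_SigmaI)
    then show ?thesis using assms(1) that unfolding transport_def by simp
  qed
  show "M p = (\<Sum>\<iota>\<in>I. E (fst \<iota>, fst (snd \<iota>)) p)" for p
  proof -
    obtain i j where p: "p = (i, j)" by fastforce
    have "(\<Sum>\<iota>\<in>I. E (fst \<iota>, fst (snd \<iota>)) p) = (\<Sum>\<iota>\<in>I. if fst \<iota> = i \<and> fst (snd \<iota>) = j then 1 else 0)"
      by (intro sum.cong) (auto simp: E_def p)
    also have "\<dots> = card {\<iota> \<in> I. fst \<iota> = i \<and> fst (snd \<iota>) = j}"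
      using fin by (simp add: sum.If_cases Int_def)
    also have "{\<iota> \<in> I. fst \<iota> = i \<and> fst (snd \<iota>) = j} = (\<lambda>k. (i, j, k)) ` {1..M (i, j)}"
      using transport_outside[OF assms(1), of i j] unfolding I by (auto simp: image_iff Suc_le_eq)
    also have "card \<dots> = M p" by (simp add: card_image inj_on_def p)
    finally show ?thesis by simp
  qed
  show "fst \<iota> \<in> {1..length b} \<and> fst (snd \<iota>) \<in> {1..length c}" if "\<iota> \<in> I" for \<iota>
    using that unfolding I by auto
qed

lemma flag_of_eq_level_flag:
  assumes "\<forall>i\<le>length b. e ` {1..sum_list (take i b)} = {\<iota> \<in> I. \<beta> \<iota> \<le> i}"
  shows "flag_of b (v \<circ> e) = level_flag (length b) I \<beta> v"
  unfolding flag_of_def level_flag_def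
proof (intro map_cong refl)
  fix i assume "i \<in> set [0..<length b + 1]"
  then have "i \<le> length b" by auto
  then have eq: "e ` {1..sum_list (take i b)} = {\<iota> \<in> I. \<beta> \<iota> \<le> i}" using assms by blast
  show "span ((v \<circ> e) ` {1..sum_list (take i b)}) = span (v ` {\<iota> \<in> I. \<beta> \<iota> \<le> i})"
    unfolding image_comp[symmetric] eq ..
qed

lemma sum_list_take_le: "sum_list (take i (b :: nat list)) \<le> sum_list b"
  by (metis append_take_drop_id le_add1 sum_list.append)

lemma flag_of_in_Flag:
  assumes b: "composition n b" "dim (UNIV :: 'b set) = n" and x: "basis_family {1..n} x"
  shows "flag_of b x \<in> Flag b"
proof -
  have n: "sum_list b = n" using b unfolding composition_def by simp
  have nth: "flag_of b x ! i = span (x ` {1..sum_list (take i b)})" if "i \<le> length b" for i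
    unfolding flag_of_def using that by (simp del: upt_Suc)
  have dim: "dim (flag_of b x ! i) = sum_list (take i b)" if "i \<le> length b" for i
    unfolding nth[OF that] using basis_family_dim[OF x, of "{1..sum_list (take i b)}"]
      sum_list_take_le[of i b] n by simp
  have "flag_of b x ! (i - 1) \<subseteq> flag_of b x ! i \<and>
      dim (flag_of b x ! i) = dim (flag_of b x ! (i - 1)) + b ! (i - 1)" if i: "i \<in> {1..length b}" for i
  proof -
    have s: "sum_list (take i b) = sum_list (take (i - 1) b) + b ! (i - 1)"
      using i take_Suc_conv_app_nth[of "i - 1" b] by (cases i) auto
    have le: "i \<le> length b" "i - 1 \<le> length b" using i by auto
    have "flag_of b x ! (i - 1) \<subseteq> flag_of b x ! i"
      unfolding nth[OF le(1)] nth[OF le(2)] s by (intro span_mono image_mono) auto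
    then show ?thesis using dim[OF le(1)] dim[OF le(2)] s by simp
  qed
  moreover have "flag_of b x ! 0 = {0}" using nth[of 0] by simp
  moreover have "flag_of b x ! length b = UNIV"
    using nth[of "length b"] x n unfolding basis_family_def by simp
  moreover have "length (flag_of b x) = length b + 1" "\<forall>U\<in>set (flag_of b x). subspace U"
    unfolding flag_of_def by (auto simp: subspace_span)
  ultimately show ?thesis unfolding Flag_def by blast
qed

lemma config_of_in_Triples:
  assumes "composition (dim (UNIV :: 'b set)) b" "composition (dim (UNIV :: 'b set)) c" "z \<in> frames"
  shows "config_of b c z \<in> Triples b c"
proof -
  obtain a x y where z: "z = (a, x, y)" "a \<noteq> 0" "basis_family {1..dim (UNIV :: 'b set)} x"
    "basis_family {1..dim (UNIV :: 'b set)} y"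
    using assms(3) unfolding frames_def by blast
  have "span {a} \<in> Proj" unfolding Proj_def using z(2) by (simp add: subspace_span)
  then show ?thesis
    unfolding z(1) Triples_def config_of.simps
    using flag_of_in_Flag[OF assms(1) refl z(3)] flag_of_in_Flag[OF assms(2) refl z(4)] by blast
qed

text \<open>The enumerations do not depend on the bases, and the two flags may use different ones;
  so an affine curve of bases becomes an affine curve of frames.\<close>

lemma config_of_level_flags:
  assumes "finite I" "card I = dim (UNIV :: 'b set)"
    and "\<And>\<iota>. \<iota> \<in> I \<Longrightarrow> \<beta> \<iota> \<in> {1..length b}" "\<And>\<iota>. \<iota> \<in> I \<Longrightarrow> \<gamma> \<iota> \<in> {1..length c}"
    and "\<And>i. i \<in> {1..length b} \<Longrightarrow> card {\<iota> \<in> I. \<beta> \<iota> = i} = b ! (i - 1)"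
    and "\<And>j. j \<in> {1..length c} \<Longrightarrow> card {\<iota> \<in> I. \<gamma> \<iota> = j} = c ! (j - 1)"
  obtains e1 e2 where "e1 ` {1..dim (UNIV :: 'b set)} = I" "e2 ` {1..dim (UNIV :: 'b set)} = I"
    "\<And>a v v'. a \<noteq> 0 \<Longrightarrow> basis_family I v \<Longrightarrow> basis_family I v' \<Longrightarrow> (a, v \<circ> e1, v' \<circ> e2) \<in> frames \<and>
       config_of b c (a, v \<circ> e1, v' \<circ> e2)
         = (span {a}, level_flag (length b) I \<beta> v, level_flag (length c) I \<gamma> v')"
proof -
  obtain e1 where e1: "bij_betw e1 {1..card I} I"
    "\<forall>i\<le>length b. e1 ` {1..sum_list (take i b)} = {\<iota> \<in> I. \<beta> \<iota> \<le> i}"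
    by (rule ex_level_enum[OF assms(1,3,5)])
  obtain e2 where e2: "bij_betw e2 {1..card I} I"
    "\<forall>i\<le>length c. e2 ` {1..sum_list (take i c)} = {\<iota> \<in> I. \<gamma> \<iota> \<le> i}"
    by (rule ex_level_enum[OF assms(1,4,6)])
  show thesis
  proof (rule that[of e1 e2])
    show "e1 ` {1..dim (UNIV :: 'b set)} = I" "e2 ` {1..dim (UNIV :: 'b set)} = I"
      using e1(1) e2(1) assms(2) unfolding bij_betw_def by simp_all
    fix a :: 'b and v v' assume *: "a \<noteq> 0" "basis_family I v" "basis_family I v'"
    show "(a, v \<circ> e1, v' \<circ> e2) \<in> frames \<and> config_of b c (a, v \<circ> e1, v' \<circ> e2)
         = (span {a}, level_flag (length b) I \<beta> v, level_flag (length c) I \<gamma> v')"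
      using * basis_family_comp[OF *(2) e1(1)] basis_family_comp[OF *(3) e2(1)]
        flag_of_eq_level_flag[OF e1(2)] flag_of_eq_level_flag[OF e2(2)]
      unfolding frames_def assms(2) by simp
  qed
qed

lemma orbit_config:
  assumes M: "decorated b c (M, D)" and n: "composition (dim (UNIV :: 'b set)) b"
    and v: "basis_family (index_set (length b) (length c) M) v"
  defines "I \<equiv> index_set (length b) (length c) M"
  obtains e1 e2 where "e1 ` {1..dim (UNIV :: 'b set)} = I" "e2 ` {1..dim (UNIV :: 'b set)} = I"
    "\<And>a v v'. a \<noteq> 0 \<Longrightarrow> basis_family I v \<Longrightarrow> basis_family I v' \<Longrightarrow> (a, v \<circ> e1, v' \<circ> e2) \<in> frames \<and>
       config_of b c (a, v \<circ> e1, v' \<circ> e2)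
         = (span {a}, level_flag (length b) I fst v, level_flag (length c) I (fst \<circ> snd) v')"
proof -
  have t: "transport b c M" using M by (simp add: decorated_iff del: decorated.simps)
  note I = card_index_set[OF t, folded I_def]
  show thesis
    by (rule config_of_level_flags[of I fst b "fst \<circ> snd" c])
      (use I basis_family_card[OF v] that in \<open>auto simp: I_def\<close>)
qed

lemma decoration_vector_nonzero:
  assumes M: "decorated b c (M, D)" and v: "basis_family (index_set (length b) (length c) M) v"
  shows "(\<Sum>(i, j)\<in>D. v (i, j, 1)) = (\<Sum>\<iota>\<in>(\<lambda>(i, j). (i, j, 1)) ` D. v \<iota>)"
    and "(\<lambda>(i, j). (i, j, 1)) ` D \<subseteq> index_set (length b) (length c) M"
    and "(\<Sum>(i, j)\<in>D. v (i, j, 1)) \<noteq> 0"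
proof -
  have t: "transport b c M" and D: "D \<noteq> {}" "\<And>p. p \<in> D \<Longrightarrow> 0 < M p"
    using M by (simp_all add: decorated_iff del: decorated.simps)
  show 1: "(\<Sum>(i, j)\<in>D. v (i, j, 1)) = (\<Sum>\<iota>\<in>(\<lambda>(i, j). (i, j, 1)) ` D. v \<iota>)"
    by (subst sum.reindex) (auto simp: inj_on_def comp_def split_beta)
  show 2: "(\<lambda>(i, j). (i, j, 1)) ` D \<subseteq> index_set (length b) (length c) M"
  proof clarify
    fix i j assume "(i, j) \<in> D"
    then show "(i, j, 1) \<in> index_set (length b) (length c) M"
      using D(2) transport_outside[OF t, of i j] unfolding index_set_def by force
  qed
  show "(\<Sum>(i, j)\<in>D. v (i, j, 1)) \<noteq> 0"
    using basis_family_sum_in_span[OF v 2, of "{}"] D(1) unfolding 1 by auto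
qed

lemma orbit_subset_Triples:
  assumes M: "decorated b c (M, D)" and n: "composition (dim (UNIV :: 'b set)) b"
    "composition (dim (UNIV :: 'b set)) c"
  shows "orbit (length b) (length c) (M, D) \<subseteq> Triples b c"
proof
  fix F assume "F \<in> orbit (length b) (length c) (M, D)"
  then obtain v where v: "basis_family (index_set (length b) (length c) M) v"
    and F: "F = (span {\<Sum>(i, j)\<in>D. v (i, j, 1)},
      level_flag (length b) (index_set (length b) (length c) M) fst v,
      level_flag (length c) (index_set (length b) (length c) M) (fst \<circ> snd) v)"
    unfolding orbit_eq by blast
  obtain e1 e2 where "((\<Sum>(i, j)\<in>D. v (i, j, 1)), v \<circ> e1, v \<circ> e2) \<in> frames \<and>
       config_of b c ((\<Sum>(i, j)\<in>D. v (i, j, 1)), v \<circ> e1, v \<circ> e2) = F"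
    using orbit_config[OF M n(1) v] decoration_vector_nonzero(3)[OF M v] v unfolding F by metis
  then show "F \<in> Triples b c" using config_of_in_Triples[OF n] by metis
qed

lemma orbit_nonempty:
  assumes "decorated b c (M, D)" "composition (dim (UNIV :: 'b set)) b"
  shows "\<exists>v :: nat \<times> nat \<times> nat \<Rightarrow> 'b. basis_family (index_set (length b) (length c) M) v"
proof -
  let ?I = "index_set (length b) (length c) M"
  have t: "transport b c M" using assms(1) by (simp add: decorated_iff del: decorated.simps)
  note I = card_index_set[OF t]
  have "card ?I = sum_list b"
    by (rule ex_level_enum[of ?I fst b]) (use I in auto)
  then have "card ?I = dim (UNIV :: 'b set)" using assms(2) unfolding composition_def by simp
  then have "card ?I = card Basis" by simp
  then obtain v where "bij_betw v ?I Basis"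
    using finite_same_card_bij[OF I(1) finite_Basis] by blast
  then show ?thesis
    using independent_Basis span_Basis unfolding basis_family_def bij_betw_def by blast
qed

section \<open>Rank conditions are closed\<close>

lemma sum_polyfun:
  assumes "finite S" "\<And>s. s \<in> S \<Longrightarrow> f s \<in> polyfun" shows "(\<lambda>z. \<Sum>s\<in>S. f s z) \<in> polyfun"
  using assms by (induction S rule: finite_induct) (auto intro: polyfun.intros)

lemma prod_polyfun:
  assumes "finite S" "\<And>s. s \<in> S \<Longrightarrow> f s \<in> polyfun" shows "(\<lambda>z. \<Prod>s\<in>S. f s z) \<in> polyfun"
  using assms by (induction S rule: finite_induct) (auto intro: polyfun.intros)

lemma det_polyfun:
  assumes "\<And>s t. s < m \<Longrightarrow> t < m \<Longrightarrow> f s t \<in> polyfun"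
  shows "(\<lambda>z. det (mat m m (\<lambda>(s, t). f s t z))) \<in> polyfun"
proof -
  have "(\<lambda>z. \<Sum>p | p permutes {0..<m}. signof p * (\<Prod>i = 0..<m. f i (p i) z)) \<in> polyfun"
  proof (intro sum_polyfun finite_permutations polyfun.mult polyfun.const prod_polyfun assms)
    fix p i assume "p \<in> {p. p permutes {0..<m}}" "i \<in> {0..<m}"
    then show "p i < m" using permutes_in_image[of p "{0..<m}" i] by simp
  qed auto
  moreover have "det (mat m m (\<lambda>(s, t). f s t z))
      = (\<Sum>p | p permutes {0..<m}. signof p * (\<Prod>i = 0..<m. f i (p i) z))" for z
  proof -
    have "p i < m" if "p permutes {0..<m}" "i < m" for p i
      using permutes_in_image[OF that(1), of i] that(2) by simp
    then show ?thesis unfolding det_def by (auto intro!: sum.cong prod.cong)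
  qed
  ultimately show ?thesis by simp
qed

text \<open>An indexed family may repeat a vector; the repetition is then itself the
  relation.\<close>

lemma ex_relation:
  fixes w :: "nat \<Rightarrow> 'b"
  assumes "dim S \<le> d" "\<And>t. t \<le> d \<Longrightarrow> w t \<in> S"
  shows "\<exists>k. (\<exists>t\<le>d. k t \<noteq> 0) \<and> (\<Sum>t\<le>d. k t *s w t) = 0"
proof (cases "inj_on w {..d}")
  case True
  have "\<not> independent (w ` {..d})"
  proof
    assume "independent (w ` {..d})"
    then have "card (w ` {..d}) \<le> dim S" using assms(2) by (intro independent_card_le_dim) auto
    then show False using assms(1) card_image[OF True] by simp
  qed
  then obtain u v where uv: "v \<in> w ` {..d}" "u v \<noteq> 0" "(\<Sum>v\<in>w ` {..d}. u v *s v) = 0"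
    by (auto simp: dependent_finite)
  then have "(\<Sum>t\<le>d. u (w t) *s w t) = 0" by (simp add: sum.reindex[OF True])
  then show ?thesis using uv by (intro exI[of _ "u \<circ> w"]) auto
next
  case False
  then obtain s t where st: "s \<le> d" "t \<le> d" "s \<noteq> t" "w s = w t" by (auto simp: inj_on_def)
  define k where "k i = (if i = s then 1 else if i = t then - 1 else 0 :: 'a)" for i
  have "(\<Sum>i\<le>d. k i *s w i) = (\<Sum>i\<in>{s, t}. k i *s w i)"
    using st by (intro sum.mono_neutral_right) (auto simp: k_def)
  also have "\<dots> = 0" using st by (simp add: k_def)
  finally show ?thesis using st by (intro exI[of _ k]) (auto simp: k_def)
qed

text \<open>Vanishing of all minors of size \<open>d + 1\<close>, with arbitrary functionals in
  place of coordinates. A relation among the vectors gives a kernel vector; conversely, functionals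
  dual to \<open>d + 1\<close> independent vectors of \<open>S\<close> give the identity
  matrix.\<close>

lemma dim_le_iff_det:
  "dim S \<le> d \<longleftrightarrow> (\<forall>\<phi> w. (\<forall>s\<le>d. Vector_Spaces.linear scale (*) (\<phi> s)) \<longrightarrow> (\<forall>t\<le>d. w t \<in> S)
     \<longrightarrow> det (mat (Suc d) (Suc d) (\<lambda>(s, t). \<phi> s (w t))) = 0)"
proof (intro iffI allI impI)
  fix \<phi> and w :: "nat \<Rightarrow> 'b"
  assume S: "dim S \<le> d" and \<phi>: "\<forall>s\<le>d. Vector_Spaces.linear scale (*) (\<phi> s)" and w: "\<forall>t\<le>d. w t \<in> S"
  obtain k t where k: "t \<le> d" "k t \<noteq> 0" "(\<Sum>t\<le>d. k t *s w t) = 0"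
    using ex_relation[OF S, of w] w by blast
  let ?A = "mat (Suc d) (Suc d) (\<lambda>(s, t). \<phi> s (w t))"
  let ?v = "vec (Suc d) k"
  have "?v \<noteq> 0\<^sub>v (Suc d)"
  proof
    assume "?v = 0\<^sub>v (Suc d)"
    then have "?v $ t = 0\<^sub>v (Suc d) $ t" by simp
    then show False using k by simp
  qed
  moreover have "?A *\<^sub>v ?v = 0\<^sub>v (Suc d)"
  proof (rule eq_vecI)
    fix s assume s: "s < dim_vec (0\<^sub>v (Suc d))"
    then interpret l: Vector_Spaces.linear scale "(*)" "\<phi> s" using \<phi> by simp
    have "(?A *\<^sub>v ?v) $ s = (\<Sum>t\<le>d. \<phi> s (w t) * k t)"
      using s by (auto simp: scalar_prod_def lessThan_Suc_atMost atLeast0LessThan intro!: sum.cong)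
    also have "\<dots> = \<phi> s (\<Sum>t\<le>d. k t *s w t)"
      by (simp add: l.sum l.scale mult.commute)
    finally show "(?A *\<^sub>v ?v) $ s = 0\<^sub>v (Suc d) $ s" using k s by (simp add: l.zero)
  qed simp
  ultimately show "det ?A = 0"
    using det_0_iff_vec_prod_zero_field[of ?A "Suc d"] by (metis mat_carrier vec_carrier)
next
  assume R: "\<forall>\<phi> w. (\<forall>s\<le>d. Vector_Spaces.linear scale (*) (\<phi> s)) \<longrightarrow> (\<forall>t\<le>d. w t \<in> S)
     \<longrightarrow> det (mat (Suc d) (Suc d) (\<lambda>(s, t). \<phi> s (w t))) = 0"
  show "dim S \<le> d"
  proof (rule ccontr)
    assume "\<not> dim S \<le> d"
    moreover obtain B where B: "B \<subseteq> S" "independent B" "card B = dim S" by (rule basis_exists[of S])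
    ultimately have "Suc d \<le> card B" by simp
    then obtain T where T: "T \<subseteq> B" "card T = Suc d" by (rule obtain_subset_with_card_n)
    then have "finite T" by (metis card.infinite nat.distinct(1))
    then obtain w where w: "bij_betw w {0..<Suc d} T" using ex_bij_betw_nat_finite T(2) by metis
    have indT: "independent T" using B(2) T(1) independent_mono by blast
    interpret vp: vector_space_pair scale "(*) :: 'a \<Rightarrow> 'a \<Rightarrow> 'a"
      by unfold_locales (auto simp: algebra_simps)
    have "\<exists>g. Vector_Spaces.linear scale (*) g \<and> (\<forall>x\<in>T. g x = (if x = w s then 1 else 0))" for s
      using vp.linear_independent_extend[OF indT, of "\<lambda>x. if x = w s then 1 else 0"] by blast
    then obtain \<phi> where \<phi>: "\<And>s. Vector_Spaces.linear scale (*) (\<phi> s)"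
      "\<And>s x. x \<in> T \<Longrightarrow> \<phi> s x = (if x = w s then 1 else 0)" by metis
    have wT: "w t \<in> T" if "t \<le> d" for t using w that unfolding bij_betw_def by auto
    have "mat (Suc d) (Suc d) (\<lambda>(s, t). \<phi> s (w t)) = 1\<^sub>m (Suc d)"
    proof (rule eq_matI)
      fix s t assume "s < dim_row (1\<^sub>m (Suc d))" "t < dim_col (1\<^sub>m (Suc d))"
      then have st: "s < Suc d" "t < Suc d" by auto
      have "w t = w s \<longleftrightarrow> t = s" using w st unfolding bij_betw_def inj_on_def by auto
      then show "mat (Suc d) (Suc d) (\<lambda>(s, t). \<phi> s (w t)) $$ (s, t) = 1\<^sub>m (Suc d) $$ (s, t)"
        using st \<phi>(2)[OF wT, of t s] by auto
    qed auto
    then have "det (mat (Suc d) (Suc d) (\<lambda>(s, t). \<phi> s (w t))) = 1" by simp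
    moreover have "det (mat (Suc d) (Suc d) (\<lambda>(s, t). \<phi> s (w t))) = 0"
      using R \<phi>(1) wT T(1) B(1) by blast
    ultimately show False by simp
  qed
qed

text \<open>\<open>sel\<close> selects vectors of a frame whose span has the dimension in question;
  the minors of the selected vectors are polynomial functions that cut out the condition.\<close>

lemma zariski_closed_dim_le:
  fixes sel :: "('b frame \<Rightarrow> 'b) set"
  assumes sel: "\<And>\<sigma> \<phi>. \<sigma> \<in> sel \<Longrightarrow> Vector_Spaces.linear scale (*) \<phi> \<Longrightarrow> (\<lambda>z. \<phi> (\<sigma> z)) \<in> polyfun"
    and n: "composition (dim (UNIV :: 'b set)) b" "composition (dim (UNIV :: 'b set)) c"
    and dimF: "\<And>z. z \<in> frames \<Longrightarrow> dimF (config_of b c z) = dim ((\<lambda>\<sigma>. \<sigma> z) ` sel)"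
  shows "zariski_closed b c {F \<in> Triples b c. dimF F \<le> d}"
  unfolding zariski_closed_def
proof (intro conjI exI ballI)
  define P where "P = {(\<lambda>z. det (mat (Suc d) (Suc d) (\<lambda>(s, t). \<phi> s (\<sigma> t z)))) | \<phi> \<sigma>.
    (\<forall>s\<le>d. Vector_Spaces.linear scale (*) (\<phi> s)) \<and> (\<forall>t\<le>d. \<sigma> t \<in> sel)}"
  show "P \<subseteq> polyfun"
    unfolding P_def using sel by (auto intro!: det_polyfun)
  fix z :: "'b frame" assume z: "z \<in> frames"
  have "dim ((\<lambda>\<sigma>. \<sigma> z) ` sel) \<le> d \<longleftrightarrow> (\<forall>f\<in>P. f z = 0)"
  proof
    assume le: "dim ((\<lambda>\<sigma>. \<sigma> z) ` sel) \<le> d"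
    show "\<forall>f\<in>P. f z = 0"
    proof
      fix f assume "f \<in> P"
      then obtain \<phi> \<sigma> where f: "f = (\<lambda>z. det (mat (Suc d) (Suc d) (\<lambda>(s, t). \<phi> s (\<sigma> t z))))"
        and \<phi>: "\<forall>s\<le>d. Vector_Spaces.linear scale (*) (\<phi> s)" and \<sigma>: "\<forall>t\<le>d. \<sigma> t \<in> sel"
        unfolding P_def by blast
      have "\<forall>t\<le>d. \<sigma> t z \<in> (\<lambda>\<sigma>. \<sigma> z) ` sel" using \<sigma> by blast
      with \<phi> show "f z = 0"
        using spec[OF spec[OF le[unfolded dim_le_iff_det], of \<phi>], of "\<lambda>t. \<sigma> t z"] unfolding f by simp
    qed
  next
    assume P0: "\<forall>f\<in>P. f z = 0"
    show "dim ((\<lambda>\<sigma>. \<sigma> z) ` sel) \<le> d"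
      unfolding dim_le_iff_det
    proof (intro allI impI)
      fix \<phi> w assume \<phi>: "\<forall>s\<le>d. Vector_Spaces.linear scale (*) (\<phi> s)"
        and "\<forall>t\<le>d. w t \<in> (\<lambda>\<sigma>. \<sigma> z) ` sel"
      then have "\<forall>t. \<exists>\<sigma>. t \<le> d \<longrightarrow> \<sigma> \<in> sel \<and> w t = \<sigma> z" by blast
      then obtain \<sigma> where \<sigma>: "\<And>t. t \<le> d \<Longrightarrow> \<sigma> t \<in> sel \<and> w t = \<sigma> t z" by metis
      have "(\<lambda>z. det (mat (Suc d) (Suc d) (\<lambda>(s, t). \<phi> s (\<sigma> t z)))) \<in> P"
        unfolding P_def using \<phi> \<sigma> by (intro CollectI exI[of _ \<phi>] exI[of _ \<sigma>]) simp
      then have "det (mat (Suc d) (Suc d) (\<lambda>(s, t). \<phi> s (\<sigma> t z))) = 0"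
        using P0 by (rule bspec[rotated])
      moreover have "mat (Suc d) (Suc d) (\<lambda>(s, t). \<phi> s (\<sigma> t z)) = mat (Suc d) (Suc d) (\<lambda>(s, t). \<phi> s (w t))"
        using \<sigma> by (intro eq_matI) auto
      ultimately show "det (mat (Suc d) (Suc d) (\<lambda>(s, t). \<phi> s (w t))) = 0" by simp
    qed
  qed
  then show "config_of b c z \<in> {F \<in> Triples b c. dimF F \<le> d} \<longleftrightarrow> (\<forall>f\<in>P. f z = 0)"
    using config_of_in_Triples[OF n z] dimF[OF z] by simp
qed auto

text \<open>The dimension of a union is that of the sum of the subspaces; \<open>w\<close> tells
  whether the line takes part.\<close>

definition sum_dim :: "bool \<Rightarrow> nat \<Rightarrow> nat \<Rightarrow> 'b config \<Rightarrow> nat" where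
  "sum_dim w i j F = dim ((if w then fst F else {}) \<union> fst (snd F) ! i \<union> snd (snd F) ! j)"

lemma dim_span_Un: "dim (S \<union> span X) = dim (S \<union> X)" "dim (span X \<union> S) = dim (X \<union> S)"
proof -
  have "span (S \<union> span X) = span (S \<union> X)"
    by (rule span_eq[THEN iffD2]) (auto intro: span_base span_mono[THEN subsetD])
  then show "dim (S \<union> span X) = dim (S \<union> X)" by (metis dim_span)
  then show "dim (span X \<union> S) = dim (X \<union> S)" by (metis Un_commute)
qed

lemma dim_span_Un3:
  "dim ((if w then span {a} else {}) \<union> span X \<union> span Y) = dim ((if w then {a} else {}) \<union> X \<union> Y)"
  using dim_span_Un(1)[of "(if w then span {a} else {}) \<union> span X" Y]
    dim_span_Un(1)[of "(if w then span {a} else {}) \<union> Y" X] dim_span_Un(2)[of "{a}" "X \<union> Y"]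
  by (cases w) (simp_all add: Un_ac)

lemma zariski_closed_sum_dim:
  assumes n: "composition (dim (UNIV :: 'b set)) b" "composition (dim (UNIV :: 'b set)) c"
    and ij: "i \<le> length b" "j \<le> length c"
  shows "zariski_closed b c {F \<in> Triples b c. sum_dim w i j F \<le> d}"
proof (rule zariski_closed_dim_le[OF _ n])
  let ?sel = "(if w then {(\<lambda>(a, x, y). a)} else {}) \<union> (\<lambda>l (a, x, y). x l) ` {1..sum_list (take i b)}
    \<union> (\<lambda>l (a, x, y). y l) ` {1..sum_list (take j c)} :: ('b frame \<Rightarrow> 'b) set"
  have le: "sum_list (take i b) \<le> dim (UNIV :: 'b set)" "sum_list (take j c) \<le> dim (UNIV :: 'b set)"
    using n sum_list_take_le[of i b] sum_list_take_le[of j c] unfolding composition_def by auto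
  show "(\<lambda>z. \<phi> (\<sigma> z)) \<in> polyfun" if \<sigma>: "\<sigma> \<in> ?sel" and \<phi>: "Vector_Spaces.linear scale (*) \<phi>" for \<sigma> \<phi>
  proof -
    consider "\<sigma> = (\<lambda>(a, x, y). a)" | l where "l \<in> {1..sum_list (take i b)}" "\<sigma> = (\<lambda>(a, x, y). x l)"
      | l where "l \<in> {1..sum_list (take j c)}" "\<sigma> = (\<lambda>(a, x, y). y l)"
      using \<sigma> by (auto split: if_splits)
    then show ?thesis
    proof cases
      case 1
      then show ?thesis using polyfun.line[OF \<phi>] by (simp add: case_prod_beta')
    next
      case (2 l)
      then have "l \<in> {1..dim (UNIV :: 'b set)}" using le by auto
      from polyfun.fst_flag[OF \<phi> this] show ?thesis using 2 by (simp add: case_prod_beta')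
    next
      case (3 l)
      then have "l \<in> {1..dim (UNIV :: 'b set)}" using le by auto
      from polyfun.snd_flag[OF \<phi> this] show ?thesis using 3 by (simp add: case_prod_beta')
    qed
  qed
  fix z :: "'b frame" assume "z \<in> frames"
  obtain a x y where z: "z = (a, x, y)" by (cases z)
  have "flag_of b x ! i = span (x ` {1..sum_list (take i b)})"
    "flag_of c y ! j = span (y ` {1..sum_list (take j c)})"
    unfolding flag_of_def using ij by (simp_all del: upt_Suc)
  then have "sum_dim w i j (config_of b c z)
      = dim ((if w then {a} else {}) \<union> x ` {1..sum_list (take i b)} \<union> y ` {1..sum_list (take j c)})"
    unfolding sum_dim_def z config_of.simps fst_conv snd_conv by (simp only: dim_span_Un3)
  also have "(if w then {a} else {}) \<union> x ` {1..sum_list (take i b)} \<union> y ` {1..sum_list (take j c)}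
      = (\<lambda>\<sigma>. \<sigma> z) ` ?sel"
    unfolding z image_Un image_image by auto
  finally show "sum_dim w i j (config_of b c z) = dim ((\<lambda>\<sigma>. \<sigma> z) ` ?sel)" .
qed

text \<open>All subspaces are spanned by parts of one basis, so dimensions count indices. The line
  adds 1 exactly when some vector of the decoration lies outside B_i + C_j, that is, at a position
  strictly beyond \<open>(i, j)\<close>.\<close>

lemma sum_dim_orbit:
  assumes M: "decorated b c (M, D)" and n: "composition (dim (UNIV :: 'b set)) b"
    and F: "F \<in> orbit (length b) (length c) (M, D)" and ij: "i \<le> length b" "j \<le> length c"
  shows "int (sum_dim w i j F) = int (sum_list (take i b)) + int (sum_list (take j c)) - rk M i j
    + of_bool (w \<and> (\<exists>k l. (k, l) \<in> D \<and> i < k \<and> j < l))"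
proof -
  let ?I = "index_set (length b) (length c) M"
  have t: "transport b c M" using M by (simp add: decorated_iff del: decorated.simps)
  note I = card_index_set[OF t]
  obtain v where v: "basis_family ?I v"
    and F: "F = (span {\<Sum>(i, j)\<in>D. v (i, j, 1)}, level_flag (length b) ?I fst v, level_flag (length c) ?I (fst \<circ> snd) v)"
    using F unfolding orbit_eq by blast
  let ?X = "{\<iota> \<in> ?I. fst \<iota> \<le> i}" and ?Y = "{\<iota> \<in> ?I. fst (snd \<iota>) \<le> j}"
  let ?K = "(\<lambda>(i, j). (i, j, 1)) ` D :: (nat \<times> nat \<times> nat) set" and ?J = "?X \<union> ?Y"
  note a = decoration_vector_nonzero[OF M v]
  have fin: "finite ?X" "finite ?Y" using I(1) by auto
  have "sum_dim w i j F = dim ((if w then {\<Sum>(i, j)\<in>D. v (i, j, 1)} else {}) \<union> v ` ?X \<union> v ` ?Y)"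
  proof -
    have "level_flag (length b) ?I fst v ! i = span (v ` ?X)"
      "level_flag (length c) ?I (fst \<circ> snd) v ! j = span (v ` ?Y)"
      unfolding level_flag_def using ij by (simp_all del: upt_Suc)
    then show ?thesis unfolding sum_dim_def F fst_conv snd_conv by (simp only: dim_span_Un3)
  qed
  also have "(if w then {\<Sum>(i, j)\<in>D. v (i, j, 1)} else {}) \<union> v ` ?X \<union> v ` ?Y
      = (if w then insert (\<Sum>\<iota>\<in>?K. v \<iota>) (v ` ?J) else v ` ?J)"
    unfolding a(1) by auto
  also have "dim \<dots> = dim (v ` ?J) + of_bool (w \<and> \<not> ?K \<subseteq> ?J)"
    using basis_family_sum_in_span[OF v a(2), of ?J] by (auto simp: dim_insert)
  also have "dim (v ` ?J) = card ?J" using basis_family_dim[OF v, of ?J] by auto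
  also have "\<not> ?K \<subseteq> ?J \<longleftrightarrow> (\<exists>k l. (k, l) \<in> D \<and> i < k \<and> j < l)"
  proof -
    have "(k, l, 1) \<in> ?J \<longleftrightarrow> \<not> (i < k \<and> j < l)" if "(k, l) \<in> D" for k l
      using a(2) that by (auto simp: image_subset_iff)
    moreover have "?K \<subseteq> ?J \<longleftrightarrow> (\<forall>k l. (k, l) \<in> D \<longrightarrow> (k, l, 1) \<in> ?J)"
      unfolding image_subset_iff Ball_def split_paired_All prod.case by (rule refl)
    ultimately show ?thesis by blast
  qed
  finally have dim: "sum_dim w i j F = card ?J + of_bool (w \<and> (\<exists>k l. (k, l) \<in> D \<and> i < k \<and> j < l))" .
  have "card ?X = sum_list (take i b)" "card ?Y = sum_list (take j c)"
  proof -
    have *: "card {\<iota> \<in> J. \<beta> \<iota> \<le> i} = sum_list (take i b)"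
      if J: "finite J" "\<And>\<iota>. \<iota> \<in> J \<Longrightarrow> \<beta> \<iota> \<in> {1..length b}"
        "\<And>i. i \<in> {1..length b} \<Longrightarrow> card {\<iota> \<in> J. \<beta> \<iota> = i} = b ! (i - 1)" and i: "i \<le> length b"
      for J and \<beta> :: "nat \<times> nat \<times> nat \<Rightarrow> nat" and b i
    proof -
      obtain e where e: "card J = sum_list b" "bij_betw e {1..card J} J"
        "\<forall>i\<le>length b. e ` {1..sum_list (take i b)} = {\<iota> \<in> J. \<beta> \<iota> \<le> i}"
        by (rule ex_level_enum[OF J])
      have "{1..sum_list (take i b)} \<subseteq> {1..card J}" using e(1) sum_list_take_le[of i b] by auto
      then have "inj_on e {1..sum_list (take i b)}" using e(2) unfolding bij_betw_def by (meson inj_on_subset)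
      then show ?thesis using e(3) i card_image by fastforce
    qed
    show "card ?X = sum_list (take i b)" by (rule *) (use I ij in auto)
    show "card ?Y = sum_list (take j c)" by (rule *) (use I ij in auto)
  qed
  moreover have "int (card (?X \<inter> ?Y)) = rk M i j"
  proof -
    have "rk M i j = rk (\<lambda>p. \<Sum>\<iota>\<in>?I. E (fst \<iota>, fst (snd \<iota>)) p) i j"
      using I(4) by (metis ext)
    also have "\<dots> = (\<Sum>\<iota>\<in>?I. of_bool (fst \<iota> \<le> i \<and> fst (snd \<iota>) \<le> j))"
      unfolding rk_sum rk_E ..
    also have "\<dots> = int (card {\<iota> \<in> ?I. fst \<iota> \<le> i \<and> fst (snd \<iota>) \<le> j})"
      using I(1) by (simp add: of_bool_def sum.If_cases Int_def)
    also have "{\<iota> \<in> ?I. fst \<iota> \<le> i \<and> fst (snd \<iota>) \<le> j} = ?X \<inter> ?Y" by auto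
    finally show ?thesis by simp
  qed
  moreover have "card ?X + card ?Y = card ?J + card (?X \<inter> ?Y)" using fin by (rule card_Un_Int)
  ultimately show ?thesis unfolding dim by simp
qed

text \<open>Each \<open>sum_dim\<close> is constant on the target orbit, and its sublevel set is
  closed, hence contains the closure. Without the line this compares ranks; with the line, at equal
  ranks, it gives \<open>dominated\<close>.\<close>

lemma deg_le_imp_rank_pair:
  assumes n: "composition (dim (UNIV :: 'b set)) b" "composition (dim (UNIV :: 'b set)) c"
    and M: "decorated b c (M, D)" and M': "decorated b c (M', D')" and deg: "deg_le b c (M, D) (M', D')"
  shows "rank_pair b c M M' D D'"
proof -
  have t: "transport b c M" "transport b c M'" using M M' by (simp_all add: decorated_iff del: decorated.simps)
  obtain v :: "nat \<times> nat \<times> nat \<Rightarrow> 'b" where v: "basis_family (index_set (length b) (length c) M) v"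
    using orbit_nonempty[OF M n(1)] by blast
  obtain v' :: "nat \<times> nat \<times> nat \<Rightarrow> 'b" where v': "basis_family (index_set (length b) (length c) M') v'"
    using orbit_nonempty[OF M' n(1)] by blast
  obtain F F' where F: "F \<in> orbit (length b) (length c) (M, D)" and F': "F' \<in> orbit (length b) (length c) (M', D')"
    using v v' unfolding orbit_eq by blast
  have key: "of_bool (w \<and> (\<exists>k l. (k, l) \<in> D \<and> i < k \<and> j < l)) - rk M i j
      \<le> of_bool (w \<and> (\<exists>k l. (k, l) \<in> D' \<and> i < k \<and> j < l)) - rk M' i j"
    if ij: "i \<le> length b" "j \<le> length c" for w i j
  proof -
    let ?Z = "{G \<in> Triples b c. sum_dim w i j G \<le> sum_dim w i j F'}"
    have "orbit (length b) (length c) (M', D') \<subseteq> ?Z"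
    proof
      fix G assume G: "G \<in> orbit (length b) (length c) (M', D')"
      then show "G \<in> ?Z"
        using orbit_subset_Triples[OF M' n] sum_dim_orbit[OF M' n(1) G ij, of w]
          sum_dim_orbit[OF M' n(1) F' ij, of w] by auto
    qed
    then have "zariski_closure b c (orbit (length b) (length c) (M', D')) \<subseteq> ?Z"
      unfolding zariski_closure_def using zariski_closed_sum_dim[OF n ij] by (intro hull_minimal)
    then have "sum_dim w i j F \<le> sum_dim w i j F'"
      using deg F unfolding deg_le_def by blast
    then show ?thesis
      using sum_dim_orbit[OF M n(1) F ij, of w] sum_dim_orbit[OF M' n(1) F' ij, of w] by linarith
  qed
  show ?thesis
  proof
    show "decorated b c (M, D)" "decorated b c (M', D')" by (rule M, rule M')
    show "rk M' i j \<le> rk M i j" for i j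
    proof (cases "margin b c i j")
      case True
      then show ?thesis using transport_rk_margin[OF t] by simp
    next
      case False
      then show ?thesis using key[of i j False] by (auto simp: margin_def)
    qed
    fix k l i j assume *: "(k, l) \<in> D" "i < k" "j < l" "rk M i j = rk M' i j"
    have "0 < M (k, l)" using M *(1) unfolding decorated_iff by blast
    then have "k \<le> length b" "l \<le> length c" using transport_outside[OF t(1), of k l] by auto
    then show "\<exists>k' l'. (k', l') \<in> D' \<and> i < k' \<and> j < l'"
      using key[of i j True] * by (auto simp: of_bool_def split: if_splits)
  qed
qed

section \<open>Simple moves are degenerations\<close>

lemma polyfun_curve:
  assumes "f \<in> polyfun"
  shows "\<exists>p :: 'a poly. \<forall>\<tau>. f (a + \<tau> *s a', \<lambda>l. x l + \<tau> *s x' l, \<lambda>l. y l + \<tau> *s y' l) = poly p \<tau>"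
  using assms
proof (induction rule: polyfun.induct)
  case (const k)
  then show ?case by (intro exI[of _ "[:k:]"]) simp
next
  case (line \<phi>)
  then interpret l: Vector_Spaces.linear scale "(*)" \<phi> .
  show ?case by (intro exI[of _ "[:\<phi> a, \<phi> a':]"]) (simp add: l.add l.scale)
next
  case (fst_flag \<phi> l)
  interpret l: Vector_Spaces.linear scale "(*)" \<phi> by fact
  show ?case by (intro exI[of _ "[:\<phi> (x l), \<phi> (x' l):]"]) (simp add: l.add l.scale)
next
  case (snd_flag \<phi> l)
  interpret l: Vector_Spaces.linear scale "(*)" \<phi> by fact
  show ?case by (intro exI[of _ "[:\<phi> (y l), \<phi> (y' l):]"]) (simp add: l.add l.scale)
next
  case (add f g)
  then obtain p q where "\<forall>\<tau>. f (a + \<tau> *s a', \<lambda>l. x l + \<tau> *s x' l, \<lambda>l. y l + \<tau> *s y' l) = poly p \<tau>"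
    "\<forall>\<tau>. g (a + \<tau> *s a', \<lambda>l. x l + \<tau> *s x' l, \<lambda>l. y l + \<tau> *s y' l) = poly q \<tau>" by blast
  then show ?case by (intro exI[of _ "p + q"]) simp
next
  case (mult f g)
  then obtain p q where "\<forall>\<tau>. f (a + \<tau> *s a', \<lambda>l. x l + \<tau> *s x' l, \<lambda>l. y l + \<tau> *s y' l) = poly p \<tau>"
    "\<forall>\<tau>. g (a + \<tau> *s a', \<lambda>l. x l + \<tau> *s x' l, \<lambda>l. y l + \<tau> *s y' l) = poly q \<tau>" by blast
  then show ?case by (intro exI[of _ "p * q"]) simp
qed

text \<open>Along an affine curve a polynomial function is a polynomial in \<open>\<tau>\<close>;
  over an infinite field the nonzero parameters already exceed any finite number of roots.\<close>

lemma polyfun_curve_limit: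
  assumes "infinite (UNIV :: 'a set)" "f \<in> polyfun"
    and zero: "\<And>\<tau>. \<tau> \<noteq> 0 \<Longrightarrow> f (a + \<tau> *s a', \<lambda>l. x l + \<tau> *s x' l, \<lambda>l. y l + \<tau> *s y' l) = 0"
  shows "f (a, x, y) = 0"
proof -
  obtain p where p: "\<And>\<tau>. f (a + \<tau> *s a', \<lambda>l. x l + \<tau> *s x' l, \<lambda>l. y l + \<tau> *s y' l) = poly p \<tau>"
    using polyfun_curve[OF assms(2)] by blast
  have "UNIV - {0} \<subseteq> {\<tau>. poly p \<tau> = 0}" using zero p by auto
  moreover have "infinite (UNIV - {0 :: 'a})" using assms(1) by simp
  ultimately have "infinite {\<tau>. poly p \<tau> = 0}" using finite_subset by blast
  then have "p = 0" using poly_roots_finite by blast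
  then show ?thesis using p[of 0] by simp
qed

lemma basis_family_sum_nonzero:
  assumes u: "basis_family I u" and "\<kappa> \<in> I" "cf \<kappa> \<noteq> 0"
  shows "(\<Sum>\<iota>\<in>I. cf \<iota> *s u \<iota>) \<noteq> 0"
proof
  assume 0: "(\<Sum>\<iota>\<in>I. cf \<iota> *s u \<iota>) = 0"
  have inj: "inj_on u I" and ind: "independent (u ` I)" using u unfolding basis_family_def by auto
  have "(\<Sum>w\<in>u ` I. cf (the_inv_into I u w) *s w) = (\<Sum>\<iota>\<in>I. cf (the_inv_into I u (u \<iota>)) *s u \<iota>)"
    by (simp add: sum.reindex[OF inj])
  also have "\<dots> = (\<Sum>\<iota>\<in>I. cf \<iota> *s u \<iota>)"
    by (intro sum.cong) (simp_all add: the_inv_into_f_f[OF inj])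
  finally have "\<forall>w\<in>u ` I. cf (the_inv_into I u w) = 0"
    using 0 ind basis_family_finite[OF u] by (auto simp: dependent_finite)
  then show False using assms(2,3) the_inv_into_f_f[OF inj assms(2)] by auto
qed

text \<open>The first flag stays fixed, the second is carried by \<open>v + \<tau> v'\<close> and
  the line by \<open>a + \<tau> a'\<close>. For \<open>\<tau> \<noteq> 0\<close> one basis
  \<open>u\<close> is adapted to both flags, with first levels unchanged and second levels
  \<open>\<gamma>\<close>. Its pairs of levels count to \<open>M1\<close>, and the support of the
  line yields \<open>D1\<close>, so the curve runs in the target orbit away from 0.\<close>

lemma deg_leI:
  assumes inf: "infinite (UNIV :: 'a set)"
    and n: "composition (dim (UNIV :: 'b set)) b" "composition (dim (UNIV :: 'b set)) c"
    and M: "decorated b c (M, D)" and D1: "D1 \<noteq> {}"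
  defines "I \<equiv> index_set (length b) (length c) M"
  assumes M1: "\<And>p. M1 p = (\<Sum>\<iota>\<in>I. E (fst \<iota>, \<gamma> \<iota>) p)" and \<gamma>: "\<And>\<iota>. \<iota> \<in> I \<Longrightarrow> \<gamma> \<iota> \<in> {1..length c}"
    and curve: "\<And>v. basis_family I v \<Longrightarrow> \<exists>a' v'. \<forall>\<tau>. \<tau> \<noteq> 0 \<longrightarrow> (\<exists>u cf.
      (\<forall>i. span (u ` {\<iota> \<in> I. fst \<iota> \<le> i}) = span (v ` {\<iota> \<in> I. fst \<iota> \<le> i})) \<and>
      (\<forall>j. span (u ` {\<iota> \<in> I. \<gamma> \<iota> \<le> j}) = span ((\<lambda>\<iota>. v \<iota> + \<tau> *s v' \<iota>) ` {\<iota> \<in> I. fst (snd \<iota>) \<le> j})) \<and>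
      (\<Sum>(i, j)\<in>D. v (i, j, 1)) + \<tau> *s a' = (\<Sum>\<iota>\<in>I. cf \<iota> *s u \<iota>) \<and>
      D1 = maxset {(fst \<iota>, \<gamma> \<iota>) | \<iota>. \<iota> \<in> I \<and> cf \<iota> \<noteq> 0})"
  shows "deg_le b c (M, D) (M1, D1)"
  unfolding deg_le_def
proof
  fix F assume "F \<in> orbit (length b) (length c) (M, D)"
  then obtain v where v: "basis_family I v" and F: "F = (span {\<Sum>(i, j)\<in>D. v (i, j, 1)},
      level_flag (length b) I fst v, level_flag (length c) I (fst \<circ> snd) v)"
    unfolding orbit_eq I_def by blast
  have t: "transport b c M" using M by (simp add: decorated_iff del: decorated.simps)
  note I = card_index_set[OF t, folded I_def]
  define a where "a = (\<Sum>(i, j)\<in>D. v (i, j, 1))"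
  have a0: "a \<noteq> 0" unfolding a_def using decoration_vector_nonzero(3)[OF M v[unfolded I_def]] .
  obtain e1 e2 where fr: "\<And>a v v'. a \<noteq> 0 \<Longrightarrow> basis_family I v \<Longrightarrow> basis_family I v' \<Longrightarrow>
     (a, v \<circ> e1, v' \<circ> e2) \<in> frames \<and> config_of b c (a, v \<circ> e1, v' \<circ> e2)
         = (span {a}, level_flag (length b) I fst v, level_flag (length c) I (fst \<circ> snd) v')"
    using orbit_config[OF M n(1) v[unfolded I_def], folded I_def] by metis
  obtain a' v' where crv: "\<And>\<tau>. \<tau> \<noteq> 0 \<Longrightarrow> \<exists>u cf.
      (\<forall>i. span (u ` {\<iota> \<in> I. fst \<iota> \<le> i}) = span (v ` {\<iota> \<in> I. fst \<iota> \<le> i})) \<and>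
      (\<forall>j. span (u ` {\<iota> \<in> I. \<gamma> \<iota> \<le> j}) = span ((\<lambda>\<iota>. v \<iota> + \<tau> *s v' \<iota>) ` {\<iota> \<in> I. fst (snd \<iota>) \<le> j})) \<and>
      a + \<tau> *s a' = (\<Sum>\<iota>\<in>I. cf \<iota> *s u \<iota>) \<and>
      D1 = maxset {(fst \<iota>, \<gamma> \<iota>) | \<iota>. \<iota> \<in> I \<and> cf \<iota> \<noteq> 0}"
    using curve[OF v] unfolding a_def by blast
  let ?w = "\<lambda>\<tau> \<iota>. v \<iota> + \<tau> *s v' \<iota>"
  have on_curve: "a + \<tau> *s a' \<noteq> 0 \<and> basis_family I (?w \<tau>) \<and>
      (span {a + \<tau> *s a'}, level_flag (length b) I fst v, level_flag (length c) I (fst \<circ> snd) (?w \<tau>))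
        \<in> orbit (length b) (length c) (M1, D1)" if \<tau>: "\<tau> \<noteq> 0" for \<tau>
  proof -
    obtain u cf where B: "\<And>i. span (u ` {\<iota> \<in> I. fst \<iota> \<le> i}) = span (v ` {\<iota> \<in> I. fst \<iota> \<le> i})"
      and C: "\<And>j. span (u ` {\<iota> \<in> I. \<gamma> \<iota> \<le> j}) = span (?w \<tau> ` {\<iota> \<in> I. fst (snd \<iota>) \<le> j})"
      and A: "a + \<tau> *s a' = (\<Sum>\<iota>\<in>I. cf \<iota> *s u \<iota>)"
      and D: "D1 = maxset {(fst \<iota>, \<gamma> \<iota>) | \<iota>. \<iota> \<in> I \<and> cf \<iota> \<noteq> 0}"
      using crv[OF \<tau>] by blast
    have "{\<iota> \<in> I. fst \<iota> \<le> length b} = I" "{\<iota> \<in> I. \<gamma> \<iota> \<le> length c} = I"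
      "{\<iota> \<in> I. fst (snd \<iota>) \<le> length c} = I"
      using I(5) \<gamma> by auto
    then have "span (u ` I) = UNIV" "span (?w \<tau> ` I) = UNIV"
      using B[of "length b"] C[of "length c"] v unfolding basis_family_def by simp_all
    then have u: "basis_family I u" and w: "basis_family I (?w \<tau>)"
      using I(1) basis_family_card[OF v] by (auto intro: basis_familyI)
    have "\<exists>\<iota>\<in>I. cf \<iota> \<noteq> 0" using D1 D maxset_subset by blast
    then have "a + \<tau> *s a' \<noteq> 0" unfolding A using basis_family_sum_nonzero[OF u] by blast
    moreover have "(span {a + \<tau> *s a'}, level_flag (length b) I fst u, level_flag (length c) I \<gamma> u)
        \<in> orbit (length b) (length c) (M1, D1)"
      unfolding A by (rule orbitI[OF u _ M1 D]) (use I(5) \<gamma> in blast)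
    moreover have "level_flag (length b) I fst u = level_flag (length b) I fst v"
      by (rule level_flag_cong) (rule B)
    moreover have "level_flag (length c) I \<gamma> u = level_flag (length c) I (fst \<circ> snd) (?w \<tau>)"
      by (rule level_flag_cong) (simp add: C)
    ultimately show ?thesis using w by simp
  qed
  show "F \<in> zariski_closure b c (orbit (length b) (length c) (M1, D1))"
    unfolding zariski_closure_def hull_def
  proof (intro InterI, elim CollectE conjE)
    fix Z assume Z: "zariski_closed b c Z" and sub: "orbit (length b) (length c) (M1, D1) \<subseteq> Z"
    have "\<exists>P\<subseteq>polyfun. \<forall>z\<in>frames. config_of b c z \<in> Z \<longleftrightarrow> (\<forall>f\<in>P. f z = 0)"
      using Z unfolding zariski_closed_def by (rule conjunct2)
    then obtain P where P1: "P \<subseteq> polyfun"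
      and P2: "\<forall>z\<in>frames. config_of b c z \<in> Z \<longleftrightarrow> (\<forall>f\<in>P. f z = 0)"
      by (elim exE conjE) (rule that)
    note P = P1 bspec[OF P2]
    have "f (a, v \<circ> e1, v \<circ> e2) = 0" if f: "f \<in> P" for f
    proof (rule polyfun_curve_limit[OF inf, of f a a' "v \<circ> e1" "\<lambda>_. 0" "v \<circ> e2" "v' \<circ> e2"])
      show "f \<in> polyfun" using f P(1) by blast
      fix \<tau> :: 'a assume \<tau>: "\<tau> \<noteq> 0"
      have oc: "a + \<tau> *s a' \<noteq> 0" "basis_family I (?w \<tau>)" using on_curve[OF \<tau>] by simp_all
      have "config_of b c (a + \<tau> *s a', v \<circ> e1, ?w \<tau> \<circ> e2) \<in> orbit (length b) (length c) (M1, D1)"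
        using fr[OF oc(1) v oc(2)] on_curve[OF \<tau>] by simp
      then have "config_of b c (a + \<tau> *s a', v \<circ> e1, ?w \<tau> \<circ> e2) \<in> Z" using sub by (rule subsetD[rotated])
      moreover have "(a + \<tau> *s a', v \<circ> e1, ?w \<tau> \<circ> e2) \<in> frames" using fr[OF oc(1) v oc(2)] by simp
      ultimately have "f (a + \<tau> *s a', v \<circ> e1, ?w \<tau> \<circ> e2) = 0" using P(2) f by blast
      then show "f (a + \<tau> *s a', \<lambda>l. (v \<circ> e1) l + \<tau> *s 0, \<lambda>l. (v \<circ> e2) l + \<tau> *s (v' \<circ> e2) l) = 0"
        by (simp add: comp_def)
    qed
    then have "config_of b c (a, v \<circ> e1, v \<circ> e2) \<in> Z" using P(2) fr[OF a0 v v] by blast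
    then show "F \<in> Z" using fr[OF a0 v v] unfolding F a_def by simp
  qed
qed

text \<open>\<open>u (\<iota> s)\<close> differs from its predecessor by \<open>\<tau>\<close> times
  \<open>v (\<iota> s)\<close>, so \<open>u\<close> is triangular over \<open>v\<close> for first
  levels that rise along the chain. Read backwards from \<open>u (\<iota> t) = w (\<iota> 0)\<close>
  it is triangular over \<open>w\<close>, with second levels shifted by one along the chain and the
  last vector receiving the lowest level.\<close>

lemma chain_span:
  fixes \<iota> :: "nat \<Rightarrow> 'i" and v :: "'i \<Rightarrow> 'b"
  assumes \<tau>: "\<tau> \<noteq> 0" and t: "1 \<le> t" and inj: "inj_on \<iota> {..t}" and \<iota>I: "\<iota> ` {..t} \<subseteq> I"
    and u: "\<And>s. s \<le> t \<Longrightarrow> u (\<iota> s) = v (\<iota> 0) + \<tau> *s (\<Sum>s'\<in>{1..s}. v (\<iota> s'))"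
      "\<And>\<kappa>. \<kappa> \<in> I \<Longrightarrow> \<kappa> \<notin> \<iota> ` {..t} \<Longrightarrow> u \<kappa> = v \<kappa>"
  shows "(\<And>s s'. s \<le> s' \<Longrightarrow> s' \<le> t \<Longrightarrow> \<beta> (\<iota> s) \<le> \<beta> (\<iota> s')) \<Longrightarrow>
      span (u ` {\<kappa> \<in> I. \<beta> \<kappa> \<le> m}) = span (v ` {\<kappa> \<in> I. \<beta> \<kappa> \<le> m})"
    and "(\<And>s s'. 1 \<le> s \<Longrightarrow> s \<le> s' \<Longrightarrow> s' \<le> t \<Longrightarrow> \<gamma> (\<iota> s') \<le> \<gamma> (\<iota> s)) \<Longrightarrow> \<gamma> (\<iota> 0) \<le> \<gamma> (\<iota> t) \<Longrightarrow>
      w (\<iota> 0) = u (\<iota> t) \<Longrightarrow> (\<And>\<kappa>. \<kappa> \<in> I \<Longrightarrow> \<kappa> \<noteq> \<iota> 0 \<Longrightarrow> w \<kappa> = v \<kappa>) \<Longrightarrow>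
      (\<And>s. s < t \<Longrightarrow> \<gamma>' (\<iota> s) = \<gamma> (\<iota> (Suc s))) \<Longrightarrow> \<gamma>' (\<iota> t) = \<gamma> (\<iota> 0) \<Longrightarrow>
      (\<And>\<kappa>. \<kappa> \<in> I \<Longrightarrow> \<kappa> \<notin> \<iota> ` {..t} \<Longrightarrow> \<gamma>' \<kappa> = \<gamma> \<kappa>) \<Longrightarrow>
      span (u ` {\<kappa> \<in> I. \<gamma>' \<kappa> \<le> m}) = span (w ` {\<kappa> \<in> I. \<gamma> \<kappa> \<le> (m :: nat)})"
proof -
  have diff: "v (\<iota> (Suc s)) = inverse \<tau> *s (u (\<iota> (Suc s)) - u (\<iota> s))" if "Suc s \<le> t" for s
    using u(1)[of s] u(1)[OF that] that \<tau> by (simp add: scale_right_distrib)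
  have mem: "\<iota> s \<in> I" if "s \<le> t" for s using \<iota>I that by auto
  show "span (u ` {\<kappa> \<in> I. \<beta> \<kappa> \<le> m}) = span (v ` {\<kappa> \<in> I. \<beta> \<kappa> \<le> m})"
    if mono: "\<And>s s'. s \<le> s' \<Longrightarrow> s' \<le> t \<Longrightarrow> \<beta> (\<iota> s) \<le> \<beta> (\<iota> s')"
  proof (rule span_eq[THEN iffD2], intro conjI image_subsetI, elim CollectE conjE)
    fix \<kappa> assume \<kappa>: "\<kappa> \<in> I" "\<beta> \<kappa> \<le> m"
    show "u \<kappa> \<in> span (v ` {\<kappa> \<in> I. \<beta> \<kappa> \<le> m})"
    proof (cases "\<kappa> \<in> \<iota> ` {..t}")
      case True
      then obtain s where s: "s \<le> t" "\<kappa> = \<iota> s" by auto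
      have "v (\<iota> s') \<in> span (v ` {\<kappa> \<in> I. \<beta> \<kappa> \<le> m})" if "s' \<le> s" for s'
        using mem[of s'] mono[of s' s] s \<kappa> that by (intro span_base) auto
      then show ?thesis unfolding s(2) u(1)[OF s(1)] by (intro span_add span_scale span_sum) auto
    next
      case False
      then show ?thesis using u(2)[OF \<kappa>(1)] \<kappa> by (auto intro: span_base)
    qed
  next
    fix \<kappa> assume "\<kappa> \<in> {\<kappa> \<in> I. \<beta> \<kappa> \<le> m}"
    then have \<kappa>: "\<kappa> \<in> I" "\<beta> \<kappa> \<le> m" by auto
    show "v \<kappa> \<in> span (u ` {\<kappa> \<in> I. \<beta> \<kappa> \<le> m})"
    proof (cases "\<kappa> \<in> \<iota> ` {..t}")
      case True
      then obtain s where s: "s \<le> t" "\<kappa> = \<iota> s" by auto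
      have us: "u (\<iota> s') \<in> span (u ` {\<kappa> \<in> I. \<beta> \<kappa> \<le> m})" if "s' \<le> s" for s'
        using mem[of s'] mono[of s' s] s \<kappa> that by (intro span_base) auto
      show ?thesis
      proof (cases s)
        case 0
        then show ?thesis using us[of 0] u(1)[of 0] s by simp
      next
        case (Suc s')
        then show ?thesis
          using us[of s'] us[of s] diff[of s'] s by (auto intro!: span_scale span_diff)
      qed
    next
      case False
      then have "v \<kappa> = u \<kappa>" using u(2)[OF \<kappa>(1)] by simp
      then show ?thesis using \<kappa> by (auto intro: span_base)
    qed
  qed
  show "span (u ` {\<kappa> \<in> I. \<gamma>' \<kappa> \<le> m}) = span (w ` {\<kappa> \<in> I. \<gamma> \<kappa> \<le> m})"
    if anti: "\<And>s s'. 1 \<le> s \<Longrightarrow> s \<le> s' \<Longrightarrow> s' \<le> t \<Longrightarrow> \<gamma> (\<iota> s') \<le> \<gamma> (\<iota> s)" and low: "\<gamma> (\<iota> 0) \<le> \<gamma> (\<iota> t)"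
      and w: "w (\<iota> 0) = u (\<iota> t)" "\<And>\<kappa>. \<kappa> \<in> I \<Longrightarrow> \<kappa> \<noteq> \<iota> 0 \<Longrightarrow> w \<kappa> = v \<kappa>"
      and \<gamma>': "\<And>s. s < t \<Longrightarrow> \<gamma>' (\<iota> s) = \<gamma> (\<iota> (Suc s))" "\<gamma>' (\<iota> t) = \<gamma> (\<iota> 0)"
        "\<And>\<kappa>. \<kappa> \<in> I \<Longrightarrow> \<kappa> \<notin> \<iota> ` {..t} \<Longrightarrow> \<gamma>' \<kappa> = \<gamma> \<kappa>"
  proof (rule span_eq[THEN iffD2], intro conjI image_subsetI, elim CollectE conjE)
    have w_ne: "w (\<iota> s) = v (\<iota> s)" if "1 \<le> s" "s \<le> t" for s
      using w(2)[OF mem, of s] inj_onD[OF inj, of s 0] that by fastforce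
    fix \<kappa> assume \<kappa>: "\<kappa> \<in> I" "\<gamma>' \<kappa> \<le> m"
    show "u \<kappa> \<in> span (w ` {\<kappa> \<in> I. \<gamma> \<kappa> \<le> m})"
    proof (cases "\<kappa> \<in> \<iota> ` {..t}")
      case True
      then obtain s where s: "s \<le> t" "\<kappa> = \<iota> s" by auto
      have last: "u (\<iota> t) \<in> span (w ` {\<kappa> \<in> I. \<gamma> \<kappa> \<le> m})" if "\<gamma> (\<iota> 0) \<le> m"
        using mem[of 0] w(1) that by (auto intro!: span_base image_eqI[of _ _ "\<iota> 0"])
      show ?thesis
      proof (cases "s = t")
        case True
        then show ?thesis using last \<gamma>'(2) \<kappa> s by simp
      next
        case False
        then have le: "\<gamma> (\<iota> (Suc s)) \<le> m" using \<gamma>'(1)[of s] \<kappa> s by simp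
        then have le': "\<gamma> (\<iota> s') \<le> m" if "s < s'" "s' \<le> t" for s'
          using anti[of "Suc s" s'] that by simp
        have "{1..t} = {1..s} \<union> {Suc s..t}" using s by auto
        then have "(\<Sum>s'\<in>{1..t}. v (\<iota> s')) = (\<Sum>s'\<in>{1..s}. v (\<iota> s')) + (\<Sum>s'\<in>{Suc s..t}. v (\<iota> s'))"
          by (simp add: sum.union_disjoint)
        \<comment> \<open>Written from the far end, \<open>u (\<iota> s)\<close> involves only later
          vectors, whose second levels are at most that of \<open>\<iota> (Suc s)\<close>.\<close>
        then have "u (\<iota> s) = u (\<iota> t) - \<tau> *s (\<Sum>s'\<in>{Suc s..t}. v (\<iota> s'))"
          unfolding u(1)[OF s(1)] u(1)[OF order_refl] by (simp add: scale_right_distrib)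
        moreover have "v (\<iota> s') \<in> span (w ` {\<kappa> \<in> I. \<gamma> \<kappa> \<le> m})" if "s' \<in> {Suc s..t}" for s'
          using w_ne[of s'] mem[of s'] le'[of s'] that by (auto intro!: span_base image_eqI[of _ _ "\<iota> s'"])
        moreover have "\<gamma> (\<iota> 0) \<le> m" using low le'[of t] False s by simp
        ultimately show ?thesis using last s by (auto intro!: span_diff span_scale span_sum)
      qed
    next
      case False
      then have "\<kappa> \<noteq> \<iota> 0" by auto
      then show ?thesis using u(2)[OF \<kappa>(1) False] w(2)[OF \<kappa>(1)] \<gamma>'(3)[OF \<kappa>(1) False] \<kappa>
        by (auto intro!: span_base image_eqI[of _ _ \<kappa>])
    qed
  next
    have w_ne: "w (\<iota> s) = v (\<iota> s)" if "1 \<le> s" "s \<le> t" for s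
      using w(2)[OF mem, of s] inj_onD[OF inj, of s 0] that by fastforce
    fix \<kappa> assume "\<kappa> \<in> {\<kappa> \<in> I. \<gamma> \<kappa> \<le> m}"
    then have \<kappa>: "\<kappa> \<in> I" "\<gamma> \<kappa> \<le> m" by auto
    have us: "u (\<iota> s) \<in> span (u ` {\<kappa> \<in> I. \<gamma>' \<kappa> \<le> m})" if "s \<le> t" "\<gamma>' (\<iota> s) \<le> m" for s
      using mem[of s] that by (intro span_base) auto
    show "w \<kappa> \<in> span (u ` {\<kappa> \<in> I. \<gamma>' \<kappa> \<le> m})"
    proof (cases "\<kappa> \<in> \<iota> ` {..t}")
      case True
      then obtain s where s: "s \<le> t" "\<kappa> = \<iota> s" by auto
      show ?thesis
      proof (cases s)
        case 0
        then show ?thesis using us[of t] w(1) \<gamma>'(2) \<kappa> s by simp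
      next
        case (Suc s')
        have "\<gamma>' (\<iota> s') \<le> m" using \<gamma>'(1)[of s'] \<kappa> s Suc by simp
        moreover have "\<gamma>' (\<iota> s) \<le> m"
        proof (cases "s = t")
          case True
          then show ?thesis using \<gamma>'(2) low \<kappa> s by simp
        next
          case False
          then show ?thesis using \<gamma>'(1)[of s] anti[of s "Suc s"] \<kappa> s Suc by simp
        qed
        ultimately have "v (\<iota> s) \<in> span (u ` {\<kappa> \<in> I. \<gamma>' \<kappa> \<le> m})"
          using us[of s'] us[of s] diff[of s'] s Suc by (auto intro!: span_scale span_diff)
        then show ?thesis using w_ne[of s] s Suc by simp
      qed
    next
      case False
      then have "\<kappa> \<noteq> \<iota> 0" by auto
      then have "w \<kappa> = u \<kappa>" "\<gamma>' \<kappa> = \<gamma> \<kappa>" using u(2)[OF \<kappa>(1) False] w(2)[OF \<kappa>(1)] \<gamma>'(3)[OF \<kappa>(1) False] by auto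
      then show ?thesis using \<kappa> by (auto intro: span_base)
    qed
  qed
qed

end

lemma maxset_insert_below:
  assumes "x < y" "y \<in> S" shows "maxset (insert x S) = maxset S"
  unfolding maxset_def using assms by (auto dest: less_trans)

lemma decoratedI_chain:
  assumes M: "decorated b c (M, D)" and t: "1 \<le> t" and i: "strict_mono_on {0..t} i"
    and j: "strict_antimono_on {1..t} j" and jt: "j 0 < j t"
    and pos: "\<And>s. s \<le> t \<Longrightarrow> 0 < M (i s, j s)"
    and D1: "D1 \<noteq> {}" "antichain D1" "\<And>p. p \<in> D1 \<Longrightarrow> 0 < chain_mat M i j t p"
  shows "decorated b c (chain_mat M i j t, D1)"
proof -
  have tr: "transport b c M" using M by (simp add: decorated_iff del: decorated.simps)
  have "transport b c (chain_mat M i j t)"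
  proof (rule transport_if_rk_eq[OF tr])
    fix x y assume m: "margin b c x y"
    have "\<not> (i 0 \<le> x \<and> j 0 \<le> y \<and> (\<exists>s\<in>{1..t}. x < i s \<and> y < j s))"
    proof
      assume "i 0 \<le> x \<and> j 0 \<le> y \<and> (\<exists>s\<in>{1..t}. x < i s \<and> y < j s)"
      then obtain s where "i 0 \<le> x" "j 0 \<le> y" "s \<le> t" "x < i s" "y < j s" by auto
      then show False
        using m transport_outside[OF tr pos, of 0] transport_outside[OF tr pos, of s]
        unfolding margin_def by auto
    qed
    then show "rk (chain_mat M i j t) x y = rk M x y"
      using rk_chain_mat[where M = M and i = i and j = j and x = x and y = y, OF t i j jt pos] by simp
  qed
  then show ?thesis using D1 by (simp add: decorated_iff del: decorated.simps)
qed

lemma decoratedI_cyc: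
  assumes M: "decorated b c (M, D)" and lt: "i0 < i2" "i2 < i1" "j2 < j0" "j0 < j1"
    and pos: "0 < M (i0, j0)" "0 < M (i1, j1)" "0 < M (i2, j2)"
    and D1: "D1 \<noteq> {}" "antichain D1" "\<And>p. p \<in> D1 \<Longrightarrow> 0 < cyc_mat M i0 j0 i2 j2 i1 j1 p"
  shows "decorated b c (cyc_mat M i0 j0 i2 j2 i1 j1, D1)"
proof -
  have tr: "transport b c M" using M by (simp add: decorated_iff del: decorated.simps)
  have "transport b c (cyc_mat M i0 j0 i2 j2 i1 j1)"
  proof (rule transport_if_rk_eq[OF tr])
    fix x y assume m: "margin b c x y"
    have "\<not> ((i0 \<le> x \<and> j0 \<le> y \<or> i2 \<le> x \<and> j2 \<le> y) \<and> x < i1 \<and> y < j1)"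
      using m transport_outside[OF tr pos(1)] transport_outside[OF tr pos(2)]
        transport_outside[OF tr pos(3)] unfolding margin_def by auto
    then show "rk (cyc_mat M i0 j0 i2 j2 i1 j1) x y = rk M x y"
      using rk_cyc_mat[where i = x and j = y, OF pos lt] by simp
  qed
  then show ?thesis using D1 by (simp add: decorated_iff del: decorated.simps)
qed

section \<open>Degenerations that involve few basis vectors\<close>

context finite_dimensional_vector_space
begin

lemma decoration_sum_split:
  assumes M: "decorated b c (M, D)" and v: "basis_family (index_set (length b) (length c) M) v"
    and S: "finite S"
  shows "(\<Sum>(i, j)\<in>D. v (i, j, 1)) = (\<Sum>(i, j)\<in>{(i, j) \<in> D. (i, j, 1) \<notin> S}. v (i, j, 1))
     + (\<Sum>\<kappa>\<in>{\<kappa> \<in> S. \<kappa> \<in> (\<lambda>(i, j). (i, j, 1)) ` D}. v \<kappa>)"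
proof -
  let ?K = "(\<lambda>(i, j). (i, j, 1)) ` D :: (nat \<times> nat \<times> nat) set"
  have finK: "finite ?K"
    using decoration_vector_nonzero(2)[OF M v] basis_family_finite[OF v] by (rule finite_subset)
  have "(\<Sum>\<kappa>\<in>?K. v \<kappa>) = (\<Sum>\<kappa>\<in>?K - S. v \<kappa>) + (\<Sum>\<kappa>\<in>?K \<inter> S. v \<kappa>)"
    using finK by (metis add.commute sum.Int_Diff)
  moreover have "?K - S = (\<lambda>(i, j). (i, j, 1)) ` {(i, j) \<in> D. (i, j, 1) \<notin> S}" by auto
  then have "(\<Sum>\<kappa>\<in>?K - S. v \<kappa>) = (\<Sum>(i, j)\<in>{(i, j) \<in> D. (i, j, 1) \<notin> S}. v (i, j, 1))"
    by (simp only:) (subst sum.reindex, auto simp: inj_on_def comp_def split_beta)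
  moreover have "?K \<inter> S = {\<kappa> \<in> S. \<kappa> \<in> ?K}" by auto
  ultimately show ?thesis unfolding decoration_vector_nonzero(1)[OF M v] by simp
qed

text \<open>Only the vectors indexed by \<open>S\<close> are replaced or change level, so matrix,
  line and decoration need to be compared on \<open>S\<close> alone.\<close>

lemma deg_leI_special:
  assumes inf: "infinite (UNIV :: 'a set)"
    and n: "composition (dim (UNIV :: 'b set)) b" "composition (dim (UNIV :: 'b set)) c"
    and M: "decorated b c (M, D)" and D1: "D1 \<noteq> {}"
  defines "I \<equiv> index_set (length b) (length c) M"
  assumes S: "S \<subseteq> I" and \<gamma>S: "\<And>\<kappa>. \<kappa> \<in> S \<Longrightarrow> \<gamma> \<kappa> \<in> {1..length c}"
    and \<gamma>: "\<And>\<kappa>. \<kappa> \<in> I \<Longrightarrow> \<kappa> \<notin> S \<Longrightarrow> \<gamma> \<kappa> = fst (snd \<kappa>)"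
    and M1: "\<And>p. M1 p + (\<Sum>\<kappa>\<in>S. E (fst \<kappa>, fst (snd \<kappa>)) p) = M p + (\<Sum>\<kappa>\<in>S. E (fst \<kappa>, \<gamma> \<kappa>) p)"
    and curve: "\<And>v. basis_family I v \<Longrightarrow> \<exists>a' v'. \<forall>\<tau>. \<tau> \<noteq> 0 \<longrightarrow> (\<exists>u cf.
      (\<forall>\<kappa>\<in>I - S. u \<kappa> = v \<kappa>) \<and>
      (\<forall>i. span (u ` {\<iota> \<in> I. fst \<iota> \<le> i}) = span (v ` {\<iota> \<in> I. fst \<iota> \<le> i})) \<and>
      (\<forall>j. span (u ` {\<iota> \<in> I. \<gamma> \<iota> \<le> j}) = span ((\<lambda>\<iota>. v \<iota> + \<tau> *s v' \<iota>) ` {\<iota> \<in> I. fst (snd \<iota>) \<le> j})) \<and>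
      (\<Sum>\<kappa>\<in>{\<kappa> \<in> S. \<kappa> \<in> (\<lambda>(i, j). (i, j, 1)) ` D}. v \<kappa>) + \<tau> *s a' = (\<Sum>\<kappa>\<in>S. cf \<kappa> *s u \<kappa>) \<and>
      D1 = maxset ({(i, j) \<in> D. (i, j, 1) \<notin> S} \<union> {(fst \<kappa>, \<gamma> \<kappa>) | \<kappa>. \<kappa> \<in> S \<and> cf \<kappa> \<noteq> 0}))"
  shows "deg_le b c (M, D) (M1, D1)"
proof (rule deg_leI[OF inf n M D1, of M1 \<gamma>, folded I_def])
  have t: "transport b c M" using M by (simp add: decorated_iff del: decorated.simps)
  note I = card_index_set[OF t, folded I_def]
  have finS: "finite S" using S I(1) by (rule finite_subset)
  show "\<gamma> \<iota> \<in> {1..length c}" if "\<iota> \<in> I" for \<iota> using \<gamma>S \<gamma> I(5) that by (cases "\<iota> \<in> S") auto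
  show "M1 p = (\<Sum>\<iota>\<in>I. E (fst \<iota>, \<gamma> \<iota>) p)" for p
  proof -
    have "(\<Sum>\<iota>\<in>I. E (fst \<iota>, \<gamma> \<iota>) p) = (\<Sum>\<iota>\<in>I - S. E (fst \<iota>, fst (snd \<iota>)) p) + (\<Sum>\<kappa>\<in>S. E (fst \<kappa>, \<gamma> \<kappa>) p)"
      using sum.subset_diff[OF S I(1), of "\<lambda>\<iota>. E (fst \<iota>, \<gamma> \<iota>) p"] \<gamma> by simp
    moreover have "M p = (\<Sum>\<iota>\<in>I - S. E (fst \<iota>, fst (snd \<iota>)) p) + (\<Sum>\<kappa>\<in>S. E (fst \<kappa>, fst (snd \<kappa>)) p)"
      using sum.subset_diff[OF S I(1), of "\<lambda>\<iota>. E (fst \<iota>, fst (snd \<iota>)) p"] I(4)[of p] by simp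
    ultimately show ?thesis using M1[of p] by simp
  qed
  fix v assume v: "basis_family I v"
  let ?N = "{(i, j) \<in> D. (i, j, 1) \<notin> S}"
  let ?K = "(\<lambda>(i, j). (i, j, 1)) ` ?N :: (nat \<times> nat \<times> nat) set"
  have KI: "?K \<subseteq> I" using decoration_vector_nonzero(2)[OF M v[unfolded I_def]] unfolding I_def by auto
  obtain a' v' where *: "\<forall>\<tau>. \<tau> \<noteq> 0 \<longrightarrow> (\<exists>u cf.
      (\<forall>\<kappa>\<in>I - S. u \<kappa> = v \<kappa>) \<and>
      (\<forall>i. span (u ` {\<iota> \<in> I. fst \<iota> \<le> i}) = span (v ` {\<iota> \<in> I. fst \<iota> \<le> i})) \<and>
      (\<forall>j. span (u ` {\<iota> \<in> I. \<gamma> \<iota> \<le> j}) = span ((\<lambda>\<iota>. v \<iota> + \<tau> *s v' \<iota>) ` {\<iota> \<in> I. fst (snd \<iota>) \<le> j})) \<and>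
      (\<Sum>\<kappa>\<in>{\<kappa> \<in> S. \<kappa> \<in> (\<lambda>(i, j). (i, j, 1)) ` D}. v \<kappa>) + \<tau> *s a' = (\<Sum>\<kappa>\<in>S. cf \<kappa> *s u \<kappa>) \<and>
      D1 = maxset ({(i, j) \<in> D. (i, j, 1) \<notin> S} \<union> {(fst \<kappa>, \<gamma> \<kappa>) | \<kappa>. \<kappa> \<in> S \<and> cf \<kappa> \<noteq> 0}))"
    using curve[OF v] by blast
  show "\<exists>a' v'. \<forall>\<tau>. \<tau> \<noteq> 0 \<longrightarrow> (\<exists>u cf.
      (\<forall>i. span (u ` {\<iota> \<in> I. fst \<iota> \<le> i}) = span (v ` {\<iota> \<in> I. fst \<iota> \<le> i})) \<and>
      (\<forall>j. span (u ` {\<iota> \<in> I. \<gamma> \<iota> \<le> j}) = span ((\<lambda>\<iota>. v \<iota> + \<tau> *s v' \<iota>) ` {\<iota> \<in> I. fst (snd \<iota>) \<le> j})) \<and>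
      (\<Sum>(i, j)\<in>D. v (i, j, 1)) + \<tau> *s a' = (\<Sum>\<iota>\<in>I. cf \<iota> *s u \<iota>) \<and>
      D1 = maxset {(fst \<iota>, \<gamma> \<iota>) | \<iota>. \<iota> \<in> I \<and> cf \<iota> \<noteq> 0})"
  proof (rule exI[of _ a'], rule exI[of _ v'], intro allI impI)
    fix \<tau> :: 'a assume "\<tau> \<noteq> 0"
    then obtain u cf where u: "\<forall>\<kappa>\<in>I - S. u \<kappa> = v \<kappa>"
      and spans: "\<forall>i. span (u ` {\<iota> \<in> I. fst \<iota> \<le> i}) = span (v ` {\<iota> \<in> I. fst \<iota> \<le> i})"
        "\<forall>j. span (u ` {\<iota> \<in> I. \<gamma> \<iota> \<le> j}) = span ((\<lambda>\<iota>. v \<iota> + \<tau> *s v' \<iota>) ` {\<iota> \<in> I. fst (snd \<iota>) \<le> j})"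
      and vec: "(\<Sum>\<kappa>\<in>{\<kappa> \<in> S. \<kappa> \<in> (\<lambda>(i, j). (i, j, 1)) ` D}. v \<kappa>) + \<tau> *s a' = (\<Sum>\<kappa>\<in>S. cf \<kappa> *s u \<kappa>)"
      and D1: "D1 = maxset (?N \<union> {(fst \<kappa>, \<gamma> \<kappa>) | \<kappa>. \<kappa> \<in> S \<and> cf \<kappa> \<noteq> 0})"
      using * by blast
    \<comment> \<open>Outside \<open>S\<close> the line keeps the coefficients of the original
      decoration: 1 on decorated vectors and 0 elsewhere.\<close>
    define cf' where "cf' \<kappa> = (if \<kappa> \<in> S then cf \<kappa> else of_bool (\<kappa> \<in> ?K))" for \<kappa>
    have "(\<Sum>\<iota>\<in>I. cf' \<iota> *s u \<iota>) = (\<Sum>\<iota>\<in>I - S. cf' \<iota> *s u \<iota>) + (\<Sum>\<iota>\<in>S. cf' \<iota> *s u \<iota>)"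
      by (rule sum.subset_diff[OF S I(1)])
    also have "(\<Sum>\<iota>\<in>S. cf' \<iota> *s u \<iota>) = (\<Sum>\<kappa>\<in>S. cf \<kappa> *s u \<kappa>)" by (simp add: cf'_def)
    also have "(\<Sum>\<iota>\<in>I - S. cf' \<iota> *s u \<iota>) = (\<Sum>\<iota>\<in>?K. v \<iota>)"
    proof -
      have "?K \<subseteq> I - S" using KI by auto
      then have "(\<Sum>\<iota>\<in>I - S. cf' \<iota> *s u \<iota>) = (\<Sum>\<iota>\<in>?K. cf' \<iota> *s u \<iota>)"
        using I(1) by (intro sum.mono_neutral_right) (auto simp: cf'_def)
      also have "\<dots> = (\<Sum>\<iota>\<in>?K. v \<iota>)"
      proof (rule sum.cong[OF refl])
        fix \<iota> assume "\<iota> \<in> ?K"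
        moreover from this have "\<iota> \<in> I - S" using \<open>?K \<subseteq> I - S\<close> by blast
        ultimately show "cf' \<iota> *s u \<iota> = v \<iota>" using u by (simp add: cf'_def)
      qed
      finally show ?thesis .
    qed
    also have "(\<Sum>\<iota>\<in>?K. v \<iota>) = (\<Sum>(i, j)\<in>?N. v (i, j, 1))"
      by (subst sum.reindex) (auto simp: inj_on_def comp_def split_beta)
    also have "\<dots> + (\<Sum>\<kappa>\<in>S. cf \<kappa> *s u \<kappa>) = (\<Sum>(i, j)\<in>D. v (i, j, 1)) + \<tau> *s a'"
      unfolding decoration_sum_split[OF M v[unfolded I_def] finS] vec[symmetric] by (simp add: add.assoc)
    finally have sum: "(\<Sum>(i, j)\<in>D. v (i, j, 1)) + \<tau> *s a' = (\<Sum>\<iota>\<in>I. cf' \<iota> *s u \<iota>)" ..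
    have "{(fst \<iota>, \<gamma> \<iota>) | \<iota>. \<iota> \<in> I \<and> cf' \<iota> \<noteq> 0} = ?N \<union> {(fst \<kappa>, \<gamma> \<kappa>) | \<kappa>. \<kappa> \<in> S \<and> cf \<kappa> \<noteq> 0}"
    proof (intro equalityI subsetI)
      fix p assume "p \<in> {(fst \<iota>, \<gamma> \<iota>) | \<iota>. \<iota> \<in> I \<and> cf' \<iota> \<noteq> 0}"
      then obtain \<iota> where \<iota>: "p = (fst \<iota>, \<gamma> \<iota>)" "\<iota> \<in> I" "cf' \<iota> \<noteq> 0" by blast
      show "p \<in> ?N \<union> {(fst \<kappa>, \<gamma> \<kappa>) | \<kappa>. \<kappa> \<in> S \<and> cf \<kappa> \<noteq> 0}"
      proof (cases "\<iota> \<in> S")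
        case True
        then show ?thesis using \<iota> by (intro UnI2 CollectI exI[of _ \<iota>]) (simp add: cf'_def)
      next
        case False
        then have "\<iota> \<in> ?K" using \<iota>(3) by (simp add: cf'_def split: if_splits)
        then show ?thesis using \<iota> \<gamma>[OF \<iota>(2) False] by auto
      qed
    next
      fix p assume "p \<in> ?N \<union> {(fst \<kappa>, \<gamma> \<kappa>) | \<kappa>. \<kappa> \<in> S \<and> cf \<kappa> \<noteq> 0}"
      then consider "p \<in> ?N" | "p \<in> {(fst \<kappa>, \<gamma> \<kappa>) | \<kappa>. \<kappa> \<in> S \<and> cf \<kappa> \<noteq> 0}" by blast
      then show "p \<in> {(fst \<iota>, \<gamma> \<iota>) | \<iota>. \<iota> \<in> I \<and> cf' \<iota> \<noteq> 0}"
      proof cases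
        case p: 1
        obtain i j where ij: "p = (i, j)" by fastforce
        have K: "(i, j, 1) \<in> ?K" using p ij by (auto intro: image_eqI[of _ _ "(i, j)"])
        then have "(i, j, 1) \<in> I" "(i, j, 1) \<notin> S" using KI p ij by auto
        then show ?thesis using K \<gamma>[of "(i, j, 1)"] ij
          by (intro CollectI exI[of _ "(i, j, 1)"]) (simp add: cf'_def)
      next
        case 2
        then obtain \<kappa> where "p = (fst \<kappa>, \<gamma> \<kappa>)" "\<kappa> \<in> S" "cf \<kappa> \<noteq> 0" by blast
        then show ?thesis using S by (intro CollectI exI[of _ \<kappa>]) (auto simp: cf'_def)
      qed
    qed
    then show "\<exists>u cf. (\<forall>i. span (u ` {\<iota> \<in> I. fst \<iota> \<le> i}) = span (v ` {\<iota> \<in> I. fst \<iota> \<le> i})) \<and>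
      (\<forall>j. span (u ` {\<iota> \<in> I. \<gamma> \<iota> \<le> j}) = span ((\<lambda>\<iota>. v \<iota> + \<tau> *s v' \<iota>) ` {\<iota> \<in> I. fst (snd \<iota>) \<le> j})) \<and>
      (\<Sum>(i, j)\<in>D. v (i, j, 1)) + \<tau> *s a' = (\<Sum>\<iota>\<in>I. cf \<iota> *s u \<iota>) \<and>
      D1 = maxset {(fst \<iota>, \<gamma> \<iota>) | \<iota>. \<iota> \<in> I \<and> cf \<iota> \<noteq> 0}"
      using spans sum D1 by (intro exI[of _ u] exI[of _ cf']) simp
  qed
qed

text \<open>\<open>k s\<close> selects which copy at the position is used, so that the decorated
  copy 1 can be avoided; \<open>cs \<tau> s\<close> are the coefficients of the moving part of the
  line in the new basis, and \<open>a'\<close> is its velocity.\<close>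

lemma deg_le_chain:
  assumes inf: "infinite (UNIV :: 'a set)"
    and n: "composition (dim (UNIV :: 'b set)) b" "composition (dim (UNIV :: 'b set)) c"
    and M: "decorated b c (M, D)" and D1: "D1 \<noteq> {}"
    and t: "1 \<le> t" and i: "strict_mono_on {0..t} i" and j: "strict_antimono_on {1..t} j"
    and jt: "j 0 < j t" and k: "\<And>s. s \<le> t \<Longrightarrow> 1 \<le> k s \<and> k s \<le> M (i s, j s)"
  defines "\<iota> \<equiv> \<lambda>s. (i s, j s, k s)"
  assumes vec: "\<And>v \<tau>. \<tau> \<noteq> 0 \<Longrightarrow> (\<Sum>s | s \<le> t \<and> \<iota> s \<in> (\<lambda>(i, j). (i, j, 1)) ` D. v (\<iota> s)) + \<tau> *s a' v
      = (\<Sum>s\<le>t. cs \<tau> s *s (v (\<iota> 0) + \<tau> *s (\<Sum>s'\<in>{1..s}. v (\<iota> s'))))"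
    and D1_eq: "\<And>\<tau>. \<tau> \<noteq> 0 \<Longrightarrow> D1 = maxset ({(x, y) \<in> D. (x, y, 1) \<notin> \<iota> ` {..t}} \<union>
      {(i s, if s = t then j 0 else j (Suc s)) | s. s \<le> t \<and> cs \<tau> s \<noteq> 0})"
  shows "deg_le b c (M, D) (chain_mat M i j t, D1)"
proof -
  let ?I = "index_set (length b) (length c) M"
  have tr: "transport b c M" using M by (simp add: decorated_iff del: decorated.simps)
  have pos: "0 < M (i s, j s)" if "s \<le> t" for s using k[OF that] by simp
  have i_inj: "s = s'" if "i s = i s'" "s \<le> t" "s' \<le> t" for s s'
    using that strict_mono_on_imp_inj_on[OF i] by (auto simp: inj_on_def)
  have inj: "inj_on \<iota> {..t}" unfolding \<iota>_def using i_inj by (auto simp: inj_on_def)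
  have \<iota>I: "\<iota> ` {..t} \<subseteq> ?I"
  proof (rule image_subsetI)
    fix s assume "s \<in> {..t}"
    then have s: "s \<le> t" by simp
    show "\<iota> s \<in> ?I"
      using k[OF s] transport_outside[OF tr pos[OF s]] unfolding \<iota>_def index_set_def by auto
  qed
  \<comment> \<open>The cyclic shift of columns in \<open>chain_mat\<close>: each vector takes the
    column of its successor, the last one that of index 0.\<close>
  define \<gamma> where "\<gamma> \<kappa> = (if \<kappa> \<in> \<iota> ` {..t} then (let s = the_inv_into {..t} \<iota> \<kappa> in
      if s = t then j 0 else j (Suc s)) else fst (snd \<kappa>))" for \<kappa>
  have \<gamma>_\<iota>: "\<gamma> (\<iota> s) = (if s = t then j 0 else j (Suc s))" if "s \<le> t" for s
    using the_inv_into_f_f[OF inj, of s] that unfolding \<gamma>_def by simp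
  have sum_\<iota>: "(\<Sum>\<kappa>\<in>\<iota> ` {..t}. f \<kappa>) = (\<Sum>s\<le>t. f (\<iota> s))" for f :: "_ \<Rightarrow> 'x :: comm_monoid_add"
    by (simp add: sum.reindex[OF inj])
  show ?thesis
  proof (rule deg_leI_special[OF inf n M D1 \<iota>I, of \<gamma>])
    fix \<kappa> assume "\<kappa> \<in> \<iota> ` {..t}"
    then obtain s where s: "s \<le> t" "\<kappa> = \<iota> s" by auto
    show "\<gamma> \<kappa> \<in> {1..length c}"
      using transport_outside[OF tr pos, of 0] transport_outside[OF tr pos, of "Suc s"] s \<gamma>_\<iota>[OF s(1)]
      by (auto simp: Suc_le_eq)
  next
    show "\<gamma> \<kappa> = fst (snd \<kappa>)" if "\<kappa> \<notin> \<iota> ` {..t}" for \<kappa> using that by (simp add: \<gamma>_def)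
  next
    fix p
    have "(\<Sum>s\<le>t. E (i s, \<gamma> (\<iota> s)) p) = E (i 0, j 1) p + (\<Sum>s = 1..<t. E (i s, j (s + 1)) p) + E (i t, j 0) p"
    proof -
      have "{..t} = insert 0 (insert t {1..<t})" using t by auto
      moreover have "(\<Sum>s = 1..<t. E (i s, \<gamma> (\<iota> s)) p) = (\<Sum>s = 1..<t. E (i s, j (s + 1)) p)"
        using \<gamma>_\<iota> by (intro sum.cong) auto
      ultimately show ?thesis using t \<gamma>_\<iota>[of 0] \<gamma>_\<iota>[of t] by simp
    qed
    then show "chain_mat M i j t p + (\<Sum>\<kappa>\<in>\<iota> ` {..t}. E (fst \<kappa>, fst (snd \<kappa>)) p)
        = M p + (\<Sum>\<kappa>\<in>\<iota> ` {..t}. E (fst \<kappa>, \<gamma> \<kappa>) p)"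
      unfolding sum_\<iota> using chain_mat_balance[where M = M and i = i and j = j and x = p, OF i pos]
      by (simp add: \<iota>_def)
  next
    fix v assume v: "basis_family ?I v"
    define v' where "v' \<kappa> = (if \<kappa> = \<iota> 0 then \<Sum>s\<in>{1..t}. v (\<iota> s) else 0)" for \<kappa>
    show "\<exists>a' v'. \<forall>\<tau>. \<tau> \<noteq> 0 \<longrightarrow> (\<exists>u cf.
      (\<forall>\<kappa>\<in>?I - \<iota> ` {..t}. u \<kappa> = v \<kappa>) \<and>
      (\<forall>i. span (u ` {\<iota> \<in> ?I. fst \<iota> \<le> i}) = span (v ` {\<iota> \<in> ?I. fst \<iota> \<le> i})) \<and>
      (\<forall>j. span (u ` {\<iota> \<in> ?I. \<gamma> \<iota> \<le> j}) = span ((\<lambda>\<iota>. v \<iota> + \<tau> *s v' \<iota>) ` {\<iota> \<in> ?I. fst (snd \<iota>) \<le> j})) \<and>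
      (\<Sum>\<kappa>\<in>{\<kappa> \<in> \<iota> ` {..t}. \<kappa> \<in> (\<lambda>(i, j). (i, j, 1)) ` D}. v \<kappa>) + \<tau> *s a' = (\<Sum>\<kappa>\<in>\<iota> ` {..t}. cf \<kappa> *s u \<kappa>) \<and>
      D1 = maxset ({(i, j) \<in> D. (i, j, 1) \<notin> \<iota> ` {..t}} \<union> {(fst \<kappa>, \<gamma> \<kappa>) | \<kappa>. \<kappa> \<in> \<iota> ` {..t} \<and> cf \<kappa> \<noteq> 0}))"
    proof (rule exI[of _ "a' v"], rule exI[of _ v'], intro allI impI)
      fix \<tau> :: 'a assume \<tau>: "\<tau> \<noteq> 0"
      define u where "u \<kappa> = (if \<kappa> \<in> \<iota> ` {..t} then v (\<iota> 0) + \<tau> *s (\<Sum>s'\<in>{1..the_inv_into {..t} \<iota> \<kappa>}. v (\<iota> s')) else v \<kappa>)" for \<kappa>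
      define cf where "cf \<kappa> = cs \<tau> (the_inv_into {..t} \<iota> \<kappa>)" for \<kappa>
      have u_\<iota>: "u (\<iota> s) = v (\<iota> 0) + \<tau> *s (\<Sum>s'\<in>{1..s}. v (\<iota> s'))" and cf_\<iota>: "cf (\<iota> s) = cs \<tau> s" if "s \<le> t" for s
        using the_inv_into_f_f[OF inj, of s] that unfolding u_def cf_def by simp_all
      have u_v: "u \<kappa> = v \<kappa>" if "\<kappa> \<notin> \<iota> ` {..t}" for \<kappa> using that by (simp add: u_def)
      note sp = chain_span[where u = u and v = v and I = ?I, OF \<tau> t inj \<iota>I u_\<iota> u_v]
      have B: "span (u ` {\<kappa> \<in> ?I. fst \<kappa> \<le> m}) = span (v ` {\<kappa> \<in> ?I. fst \<kappa> \<le> m})" for m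
      proof (rule sp(1))
        fix s s' assume "s \<le> s'" "s' \<le> t"
        then show "fst (\<iota> s) \<le> fst (\<iota> s')"
          using strict_mono_onD[OF i, of s s'] unfolding \<iota>_def by (cases "s = s'") auto
      qed
      have C: "span (u ` {\<kappa> \<in> ?I. \<gamma> \<kappa> \<le> m}) = span ((\<lambda>\<iota>. v \<iota> + \<tau> *s v' \<iota>) ` {\<kappa> \<in> ?I. fst (snd \<kappa>) \<le> m})" for m
      proof (rule sp(2))
        fix s s' assume "1 \<le> s" "s \<le> s'" "s' \<le> t"
        then show "fst (snd (\<iota> s')) \<le> fst (snd (\<iota> s))"
          using monotone_onD[OF j, of s s'] unfolding \<iota>_def by (cases "s = s'") auto
      next
        show "fst (snd (\<iota> 0)) \<le> fst (snd (\<iota> t))" unfolding \<iota>_def using jt by simp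
        show "v (\<iota> 0) + \<tau> *s v' (\<iota> 0) = u (\<iota> t)" by (simp add: u_\<iota> v'_def)
        show "\<gamma> (\<iota> t) = fst (snd (\<iota> 0))" using \<gamma>_\<iota>[of t] by (simp add: \<iota>_def)
        show "v \<kappa> + \<tau> *s v' \<kappa> = v \<kappa>" if "\<kappa> \<noteq> \<iota> 0" for \<kappa> using that by (simp add: v'_def)
        show "\<gamma> (\<iota> s) = fst (snd (\<iota> (Suc s)))" if "s < t" for s using \<gamma>_\<iota>[of s] that by (simp add: \<iota>_def)
        show "\<gamma> \<kappa> = fst (snd \<kappa>)" if "\<kappa> \<notin> \<iota> ` {..t}" for \<kappa> using that by (simp add: \<gamma>_def)
      qed
      have sumD: "(\<Sum>\<kappa>\<in>{\<kappa> \<in> \<iota> ` {..t}. \<kappa> \<in> (\<lambda>(i, j). (i, j, 1)) ` D}. v \<kappa>)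
          = (\<Sum>s | s \<le> t \<and> \<iota> s \<in> (\<lambda>(i, j). (i, j, 1)) ` D. v (\<iota> s))"
      proof -
        have "{\<kappa> \<in> \<iota> ` {..t}. \<kappa> \<in> (\<lambda>(i, j). (i, j, 1)) ` D} = \<iota> ` {s. s \<le> t \<and> \<iota> s \<in> (\<lambda>(i, j). (i, j, 1)) ` D}"
          by blast
        moreover have "inj_on \<iota> {s. s \<le> t \<and> \<iota> s \<in> (\<lambda>(i, j). (i, j, 1)) ` D}"
          using inj by (rule inj_on_subset) auto
        ultimately show ?thesis by (simp add: sum.reindex)
      qed
      have "(\<Sum>\<kappa>\<in>\<iota> ` {..t}. cf \<kappa> *s u \<kappa>) = (\<Sum>s\<le>t. cs \<tau> s *s (v (\<iota> 0) + \<tau> *s (\<Sum>s'\<in>{1..s}. v (\<iota> s'))))"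
        unfolding sum_\<iota> using u_\<iota> cf_\<iota> by (intro sum.cong) auto
      moreover have "{(fst \<kappa>, \<gamma> \<kappa>) | \<kappa>. \<kappa> \<in> \<iota> ` {..t} \<and> cf \<kappa> \<noteq> 0}
          = {(i s, if s = t then j 0 else j (Suc s)) | s. s \<le> t \<and> cs \<tau> s \<noteq> 0}"
      proof -
        have "fst (\<iota> s) = i s" for s by (simp add: \<iota>_def)
        then have "(fst (\<iota> s), \<gamma> (\<iota> s)) = (i s, if s = t then j 0 else j (Suc s))" if "s \<le> t" for s
          using \<gamma>_\<iota>[OF that] by simp
        then have iff: "(p = (fst (\<iota> s), \<gamma> (\<iota> s)) \<and> s \<le> t \<and> cf (\<iota> s) \<noteq> 0) \<longleftrightarrow>
            (p = (i s, if s = t then j 0 else j (Suc s)) \<and> s \<le> t \<and> cs \<tau> s \<noteq> 0)" for p s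
          using cf_\<iota>[of s] by (cases "s \<le> t") simp_all
        have "{(fst \<kappa>, \<gamma> \<kappa>) | \<kappa>. \<kappa> \<in> \<iota> ` {..t} \<and> cf \<kappa> \<noteq> 0}
            = {(fst (\<iota> s), \<gamma> (\<iota> s)) | s. s \<le> t \<and> cf (\<iota> s) \<noteq> 0}" by blast
        then show ?thesis unfolding iff .
      qed
      ultimately show "\<exists>u cf. (\<forall>\<kappa>\<in>?I - \<iota> ` {..t}. u \<kappa> = v \<kappa>) \<and>
      (\<forall>i. span (u ` {\<iota> \<in> ?I. fst \<iota> \<le> i}) = span (v ` {\<iota> \<in> ?I. fst \<iota> \<le> i})) \<and>
      (\<forall>j. span (u ` {\<iota> \<in> ?I. \<gamma> \<iota> \<le> j}) = span ((\<lambda>\<iota>. v \<iota> + \<tau> *s v' \<iota>) ` {\<iota> \<in> ?I. fst (snd \<iota>) \<le> j})) \<and>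
      (\<Sum>\<kappa>\<in>{\<kappa> \<in> \<iota> ` {..t}. \<kappa> \<in> (\<lambda>(i, j). (i, j, 1)) ` D}. v \<kappa>) + \<tau> *s a' v = (\<Sum>\<kappa>\<in>\<iota> ` {..t}. cf \<kappa> *s u \<kappa>) \<and>
      D1 = maxset ({(i, j) \<in> D. (i, j, 1) \<notin> \<iota> ` {..t}} \<union> {(fst \<kappa>, \<gamma> \<kappa>) | \<kappa>. \<kappa> \<in> \<iota> ` {..t} \<and> cf \<kappa> \<noteq> 0})"
        using B C u_v vec[OF \<tau>, of v] D1_eq[OF \<tau>] sumD
        by (intro exI[of _ u] exI[of _ cf]) simp
    qed
  qed
qed

end

lemma decoratedI_swap:
  assumes M: "decorated b c (M, D)" and lt: "i0 < i1" "j0 < j1"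
    and pos: "0 < M (i0, j0)" "0 < M (i1, j1)"
    and D1: "D1 \<noteq> {}" "antichain D1" "\<And>p. p \<in> D1 \<Longrightarrow> 0 < swap_mat M i0 j0 i1 j1 p"
  shows "decorated b c (swap_mat M i0 j0 i1 j1, D1)"
proof -
  have tr: "transport b c M" using M by (simp add: decorated_iff del: decorated.simps)
  have "transport b c (swap_mat M i0 j0 i1 j1)"
  proof (rule transport_if_rk_eq[OF tr])
    fix x y assume m: "margin b c x y"
    have "\<not> (i0 \<le> x \<and> x < i1 \<and> j0 \<le> y \<and> y < j1)"
      using m transport_outside[OF tr pos(1)] transport_outside[OF tr pos(2)] unfolding margin_def by auto
    then show "rk (swap_mat M i0 j0 i1 j1) x y = rk M x y"
      using rk_swap_mat[where i = x and j = y, OF pos lt] by simp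
  qed
  then show ?thesis using D1 by (simp add: decorated_iff del: decorated.simps)
qed

lemma swap_mat_eq_chain_mat:
  "swap_mat M i0 j0 i1 j1 = chain_mat M (\<lambda>s. if s = 0 then i0 else i1) (\<lambda>s. if s = 0 then j0 else j1) 1"
  by (simp add: swap_mat_def chain_mat_def)

section \<open>Curves for the individual moves\<close>

context finite_dimensional_vector_space
begin

text \<open>The chain of length 1. Its new basis vectors are \<open>v0\<close> at
  \<open>(i0, j1)\<close> and \<open>v0 + \<tau> v1\<close> at \<open>(i1, j0)\<close>, writing
  \<open>v0\<close> and \<open>v1\<close> for the two vectors involved; \<open>cs\<close> tells
  which of them enter the line.\<close>

lemma deg_le_swap:
  assumes inf: "infinite (UNIV :: 'a set)"
    and n: "composition (dim (UNIV :: 'b set)) b" "composition (dim (UNIV :: 'b set)) c"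
    and M: "decorated b c (M, D)" and D1: "D1 \<noteq> {}"
    and lt: "i0 < i1" "j0 < j1" and k: "1 \<le> k0" "k0 \<le> M (i0, j0)" "0 < M (i1, j1)"
    and f: "(i1, j1) \<notin> D"
    and vec: "\<And>v \<tau>. \<tau> \<noteq> 0 \<Longrightarrow> (if (i0, j0) \<in> D \<and> k0 = 1 then v (i0, j0, k0) else 0) + \<tau> *s a' v
      = cs 0 *s v (i0, j0, k0) + cs 1 *s (v (i0, j0, k0) + \<tau> *s v (i1, j1, 1))"
    and D1_eq: "D1 = maxset ((if k0 = 1 then D - {(i0, j0)} else D) \<union>
      (if cs 0 \<noteq> 0 then {(i0, j1)} else {}) \<union> (if cs (1 :: nat) \<noteq> 0 then {(i1, j0)} else {}))"
  shows "deg_le b c (M, D) (swap_mat M i0 j0 i1 j1, D1)"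
proof -
  let ?i = "\<lambda>s :: nat. if s = 0 then i0 else i1" and ?j = "\<lambda>s :: nat. if s = 0 then j0 else j1"
  let ?k = "\<lambda>s :: nat. if s = 0 then k0 else 1"
  have le1: "{..1 :: nat} = {0, 1}" by auto
  show ?thesis
    unfolding swap_mat_eq_chain_mat
  proof (rule deg_le_chain[where k = ?k and a' = a' and cs = "\<lambda>_. cs", OF inf n M D1])
    show "strict_mono_on {0..1} ?i" "strict_antimono_on {1..1} ?j"
      using lt by (auto simp: strict_mono_on_def monotone_on_def)
    show "1 \<le> ?k s \<and> ?k s \<le> M (?i s, ?j s)" if "s \<le> 1" for s using k that by auto
    fix v \<tau> assume \<tau>: "\<tau> \<noteq> (0 :: 'a)"
    have eq: "{s. s \<le> 1 \<and> (?i s, ?j s, ?k s) \<in> (\<lambda>(i, j). (i, j, 1)) ` D}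
        = (if (i0, j0) \<in> D \<and> k0 = 1 then {0} else {})"
    proof -
      have mem: "(x, y, m) \<in> (\<lambda>(i, j). (i, j, 1)) ` D \<longleftrightarrow> (x, y) \<in> D \<and> m = (1 :: nat)" for x y m
        by (auto intro: image_eqI[of _ _ "(x, y)"])
      show ?thesis unfolding mem using f by (auto simp: le_Suc_eq split: if_splits)
    qed
    show "(\<Sum>s | s \<le> 1 \<and> (?i s, ?j s, ?k s) \<in> (\<lambda>(i, j). (i, j, 1)) ` D. v (?i s, ?j s, ?k s)) + \<tau> *s a' v
      = (\<Sum>s\<le>1. cs s *s (v (?i 0, ?j 0, ?k 0) + \<tau> *s (\<Sum>s'\<in>{1..s}. v (?i s', ?j s', ?k s'))))"
      unfolding eq le1 using vec[OF \<tau>, of v] by (cases "(i0, j0) \<in> D"; cases "k0 = 1") simp_all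
  next
    fix \<tau> assume \<tau>: "\<tau> \<noteq> (0 :: 'a)"
    have "{(x, y) \<in> D. (x, y, 1) \<notin> (\<lambda>s. (?i s, ?j s, ?k s)) ` {..1}} = (if k0 = 1 then D - {(i0, j0)} else D)"
      unfolding le1 using f by auto
    moreover have "{(?i s, if s = 1 then ?j 0 else ?j (Suc s)) | s. s \<le> 1 \<and> cs s \<noteq> 0}
       = (if cs 0 \<noteq> 0 then {(i0, j1)} else {}) \<union> (if cs 1 \<noteq> 0 then {(i1, j0)} else {})"
      by (auto simp: le_Suc_eq intro!: gr0I)
    ultimately show "D1 = maxset ({(x, y) \<in> D. (x, y, 1) \<notin> (\<lambda>s. (?i s, ?j s, ?k s)) ` {..1}} \<union>
      {(?i s, if s = 1 then ?j 0 else ?j (Suc s)) | s. s \<le> 1 \<and> cs s \<noteq> 0})"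
      unfolding D1_eq by (simp add: Un_assoc)
  qed (use lt in auto)
qed

text \<open>With \<open>v0\<close>, \<open>v1\<close>, \<open>v2\<close> at the three positions, the
  second flag uses \<open>v0 - \<tau> v1\<close>, \<open>v1\<close> and
  \<open>v2 + \<tau> v1\<close>. The part \<open>v0 + v2\<close> of the fixed line is also the sum
  of the first and the last of these, so it has levels \<open>i2\<close> and \<open>j0\<close>: the
  two decorated vectors merge into one at \<open>(i2, j0)\<close>.\<close>

lemma deg_le_cyc:
  assumes inf: "infinite (UNIV :: 'a set)"
    and n: "composition (dim (UNIV :: 'b set)) b" "composition (dim (UNIV :: 'b set)) c"
    and M: "decorated b c (M, D)"
    and lt: "i0 < i2" "i2 < i1" "j2 < j0" "j0 < j1"
    and D: "(i0, j0) \<in> D" "(i2, j2) \<in> D" "(i1, j1) \<notin> D" and pos: "0 < M (i1, j1)"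
  shows "deg_le b c (M, D) (cyc_mat M i0 j0 i2 j2 i1 j1, maxset (D \<union> {(i2, j0)}))"
proof -
  let ?I = "index_set (length b) (length c) M"
  have tr: "transport b c M" and posD: "\<And>p. p \<in> D \<Longrightarrow> 0 < M p"
    using M by (simp_all add: decorated_iff del: decorated.simps)
  have pos': "0 < M (i0, j0)" "0 < M (i2, j2)" using posD D by auto
  define x0 where "x0 = (i0, j0, 1 :: nat)"
  define x1 where "x1 = (i1, j1, 1 :: nat)"
  define x2 where "x2 = (i2, j2, 1 :: nat)"
  define S where "S = {x0, x1, x2}"
  have ne: "x0 \<noteq> x1" "x0 \<noteq> x2" "x1 \<noteq> x2" using lt by (auto simp: x0_def x1_def x2_def)
  have xI: "x0 \<in> ?I" "x1 \<in> ?I" "x2 \<in> ?I"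
    using transport_outside[OF tr pos] transport_outside[OF tr pos'(1)] transport_outside[OF tr pos'(2)] pos pos'
    unfolding index_set_def x0_def x1_def x2_def by auto
  define \<gamma> where "\<gamma> = (fst \<circ> snd)(x0 := j1, x1 := j2, x2 := j0)"
  have finD: "finite (D \<union> {(i2, j0)})"
  proof -
    have "D \<subseteq> {..length b} \<times> {..length c}"
      using transport_outside[OF tr posD] by (auto simp: subset_iff)
    then show ?thesis using finite_subset[of D "{..length b} \<times> {..length c}"] by simp
  qed
  have ne_D1: "maxset (D \<union> {(i2, j0)}) \<noteq> {}" using ex_maxset_above[OF finD, of i2 j0] by auto
  show ?thesis
  proof (rule deg_leI_special[where S = S and \<gamma> = \<gamma>, OF inf n M ne_D1])
    show "S \<subseteq> ?I" using xI by (simp add: S_def)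
    show "\<gamma> \<kappa> \<in> {1..length c}" if "\<kappa> \<in> S" for \<kappa>
      using that ne transport_outside[OF tr pos] transport_outside[OF tr pos'(1)] transport_outside[OF tr pos'(2)]
      by (auto simp: S_def \<gamma>_def Suc_le_eq)
    show "\<gamma> \<kappa> = fst (snd \<kappa>)" if "\<kappa> \<notin> S" for \<kappa> using that by (auto simp: S_def \<gamma>_def)
    show "cyc_mat M i0 j0 i2 j2 i1 j1 p + (\<Sum>\<kappa>\<in>S. E (fst \<kappa>, fst (snd \<kappa>)) p) = M p + (\<Sum>\<kappa>\<in>S. E (fst \<kappa>, \<gamma> \<kappa>) p)" for p
      using cyc_mat_balance[OF pos'(1) pos pos'(2) lt(1,2), of p] ne lt
      by (simp add: S_def \<gamma>_def x0_def x1_def x2_def)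
    fix v assume v: "basis_family ?I v"
    define v' where "v' = (\<lambda>_. 0)(x2 := v x1, x0 := - v x1)"
    show "\<exists>a' v'. \<forall>\<tau>. \<tau> \<noteq> 0 \<longrightarrow> (\<exists>u cf.
      (\<forall>\<kappa>\<in>?I - S. u \<kappa> = v \<kappa>) \<and>
      (\<forall>i. span (u ` {\<iota> \<in> ?I. fst \<iota> \<le> i}) = span (v ` {\<iota> \<in> ?I. fst \<iota> \<le> i})) \<and>
      (\<forall>j. span (u ` {\<iota> \<in> ?I. \<gamma> \<iota> \<le> j}) = span ((\<lambda>\<iota>. v \<iota> + \<tau> *s v' \<iota>) ` {\<iota> \<in> ?I. fst (snd \<iota>) \<le> j})) \<and>
      (\<Sum>\<kappa>\<in>{\<kappa> \<in> S. \<kappa> \<in> (\<lambda>(i, j). (i, j, 1)) ` D}. v \<kappa>) + \<tau> *s a' = (\<Sum>\<kappa>\<in>S. cf \<kappa> *s u \<kappa>) \<and>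
      maxset (D \<union> {(i2, j0)}) = maxset ({(i, j) \<in> D. (i, j, 1) \<notin> S} \<union> {(fst \<kappa>, \<gamma> \<kappa>) | \<kappa>. \<kappa> \<in> S \<and> cf \<kappa> \<noteq> 0}))"
    proof (rule exI[of _ 0], rule exI[of _ v'], intro allI impI)
      fix \<tau> :: 'a assume \<tau>: "\<tau> \<noteq> 0"
      define w where "w \<iota> = v \<iota> + \<tau> *s v' \<iota>" for \<iota>
      \<comment> \<open>The common basis: \<open>x0\<close> keeps its vector, now at column
        \<open>j1\<close>; the vector of \<open>x1\<close> is that of \<open>x2\<close> in the moved
        second flag; the vector of \<open>x2\<close> is the decorated sum.\<close>
      define u where "u = v(x1 := v x2 + \<tau> *s v x1, x2 := v x0 + v x2)"
      define cf where "cf \<kappa> = (of_bool (\<kappa> = x2) :: 'a)" for \<kappa>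
      have us: "u x0 = v x0" "u x1 = v x2 + \<tau> *s v x1" "u x2 = v x0 + v x2"
        "\<And>\<kappa>. \<kappa> \<notin> S \<Longrightarrow> u \<kappa> = v \<kappa>" using ne by (auto simp: u_def S_def)
      have ws: "w x0 = v x0 - \<tau> *s v x1" "w x1 = v x1" "w x2 = v x2 + \<tau> *s v x1"
        "\<And>\<kappa>. \<kappa> \<notin> S \<Longrightarrow> w \<kappa> = v \<kappa>" using ne by (auto simp: w_def v'_def S_def)
      have B: "span (u ` {\<kappa> \<in> ?I. fst \<kappa> \<le> m}) = span (v ` {\<kappa> \<in> ?I. fst \<kappa> \<le> m})" for m
      proof (rule span_eq[THEN iffD2], intro conjI image_subsetI)
        have vs: "v \<kappa> \<in> span (v ` {\<kappa> \<in> ?I. fst \<kappa> \<le> m})" if "\<kappa> \<in> ?I" "fst \<kappa> \<le> m" for \<kappa>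
          using that by (auto intro: span_base)
        have us': "u \<kappa> \<in> span (u ` {\<kappa> \<in> ?I. fst \<kappa> \<le> m})" if "\<kappa> \<in> ?I" "fst \<kappa> \<le> m" for \<kappa>
          using that by (auto intro: span_base)
        have lev: "fst x0 = i0" "fst x1 = i1" "fst x2 = i2" by (simp_all add: x0_def x1_def x2_def)
        fix \<kappa> assume "\<kappa> \<in> {\<kappa> \<in> ?I. fst \<kappa> \<le> m}"
        then have \<kappa>: "\<kappa> \<in> ?I" "fst \<kappa> \<le> m" by auto
        consider "\<kappa> = x0" | "\<kappa> = x1" | "\<kappa> = x2" | "\<kappa> \<notin> S" by (auto simp: S_def)
        then show "u \<kappa> \<in> span (v ` {\<kappa> \<in> ?I. fst \<kappa> \<le> m})"
        proof cases
          case 1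
          then show ?thesis using us vs[OF \<kappa>] by simp
        next
          case 2
          then show ?thesis using us vs[OF xI(1)] vs[OF xI(2)] vs[OF xI(3)] \<kappa> lev lt
            by (auto intro!: span_add span_scale)
        next
          case 3
          then show ?thesis using us vs[OF xI(1)] vs[OF xI(3)] \<kappa> lev lt
            by (auto intro!: span_add span_scale)
        next
          case 4
          then show ?thesis using us vs[OF \<kappa>] by simp
        qed
        consider "\<kappa> = x0" | "\<kappa> = x1" | "\<kappa> = x2" | "\<kappa> \<notin> S" by (auto simp: S_def)
        then show "v \<kappa> \<in> span (u ` {\<kappa> \<in> ?I. fst \<kappa> \<le> m})"
        proof cases
          case 1
          then show ?thesis using us us'[OF \<kappa>] by simp
        next
          case 2
          have "v x1 = inverse \<tau> *s (u x1 - (u x2 - u x0))" using \<tau> us by simp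
          then show ?thesis using 2 us'[OF xI(1)] us'[OF xI(2)] us'[OF xI(3)] \<kappa> lev lt
            by (auto intro!: span_diff span_scale)
        next
          case 3
          have "v x2 = u x2 - u x0" using us by simp
          then show ?thesis using 3 us'[OF xI(1)] us'[OF xI(3)] \<kappa> lev lt
            by (auto intro!: span_diff)
        next
          case 4
          then show ?thesis using us us'[OF \<kappa>] by simp
        qed
      qed
      have C: "span (u ` {\<kappa> \<in> ?I. \<gamma> \<kappa> \<le> m}) = span (w ` {\<kappa> \<in> ?I. fst (snd \<kappa>) \<le> m})" for m
      proof (rule span_eq[THEN iffD2], intro conjI image_subsetI)
        have wI: "w \<kappa> \<in> span (w ` {\<kappa> \<in> ?I. fst (snd \<kappa>) \<le> m})" if "\<kappa> \<in> ?I" "fst (snd \<kappa>) \<le> m" for \<kappa>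
          using that by (auto intro: span_base)
        have uI: "u \<kappa> \<in> span (u ` {\<kappa> \<in> ?I. \<gamma> \<kappa> \<le> m})" if "\<kappa> \<in> ?I" "\<gamma> \<kappa> \<le> m" for \<kappa>
          using that by (auto intro: span_base)
        have lev: "fst (snd x0) = j0" "fst (snd x1) = j1" "fst (snd x2) = j2"
          by (simp_all add: x0_def x1_def x2_def)
        have lev_new: "\<gamma> x0 = j1" "\<gamma> x1 = j2" "\<gamma> x2 = j0"
          using ne by (simp_all add: \<gamma>_def)
        note lev = lev lev_new
        have lev': "\<gamma> \<kappa> = fst (snd \<kappa>)" if "\<kappa> \<notin> S" for \<kappa> using that by (auto simp: S_def \<gamma>_def)
        {
          fix \<kappa> assume "\<kappa> \<in> {\<kappa> \<in> ?I. \<gamma> \<kappa> \<le> m}"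
          then have \<kappa>: "\<kappa> \<in> ?I" "\<gamma> \<kappa> \<le> m" by auto
          consider "\<kappa> = x0" | "\<kappa> = x1" | "\<kappa> = x2" | "\<kappa> \<notin> S" by (auto simp: S_def)
          then show "u \<kappa> \<in> span (w ` {\<kappa> \<in> ?I. fst (snd \<kappa>) \<le> m})"
          proof cases
            case 1
            have "u x0 = w x0 + \<tau> *s w x1" using us ws by simp
            then show ?thesis using 1 wI[OF xI(1)] wI[OF xI(2)] \<kappa> lev lt
              by (auto intro!: span_add span_scale)
          next
            case 2
            have "u x1 = w x2" using us ws by simp
            then show ?thesis using 2 wI[OF xI(3)] \<kappa> lev lt by simp
          next
            case 3
            have "u x2 = w x0 + w x2" using us ws by simp
            then show ?thesis using 3 wI[OF xI(1)] wI[OF xI(3)] \<kappa> lev lt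
              by (auto intro!: span_add)
          next
            case 4
            then show ?thesis using us ws wI[OF \<kappa>(1)] \<kappa> lev' by simp
          qed
        next
          fix \<kappa> assume "\<kappa> \<in> {\<kappa> \<in> ?I. fst (snd \<kappa>) \<le> m}"
          then have \<kappa>: "\<kappa> \<in> ?I" "fst (snd \<kappa>) \<le> m" by auto
          consider "\<kappa> = x0" | "\<kappa> = x1" | "\<kappa> = x2" | "\<kappa> \<notin> S" by (auto simp: S_def)
          then show "w \<kappa> \<in> span (u ` {\<kappa> \<in> ?I. \<gamma> \<kappa> \<le> m})"
          proof cases
            case 1
            have "w x0 = u x2 - u x1" using us ws by simp
            then show ?thesis using 1 uI[OF xI(2)] uI[OF xI(3)] \<kappa> lev lt
              by (auto intro!: span_diff)
          next
            case 2
            have "w x1 = inverse \<tau> *s (u x1 - (u x2 - u x0))" using \<tau> us ws by simp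
            then show ?thesis using 2 uI[OF xI(1)] uI[OF xI(2)] uI[OF xI(3)] \<kappa> lev lt
              by (auto intro!: span_diff span_scale)
          next
            case 3
            have "w x2 = u x1" using us ws by simp
            then show ?thesis using 3 uI[OF xI(2)] \<kappa> lev lt by simp
          next
            case 4
            then show ?thesis using us ws uI[OF \<kappa>(1)] \<kappa> lev' by simp
          qed
        }
      qed
      have "{\<kappa> \<in> S. \<kappa> \<in> (\<lambda>(i, j). (i, j, 1)) ` D} = {x0, x2}"
        using D unfolding S_def x0_def x1_def x2_def by auto
      then have "(\<Sum>\<kappa>\<in>{\<kappa> \<in> S. \<kappa> \<in> (\<lambda>(i, j). (i, j, 1)) ` D}. v \<kappa>) + \<tau> *s 0 = (\<Sum>\<kappa>\<in>S. cf \<kappa> *s u \<kappa>)"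
        using ne us by (simp add: S_def cf_def)
      moreover have "maxset (D \<union> {(i2, j0)}) = maxset ({(i, j) \<in> D. (i, j, 1) \<notin> S} \<union> {(fst \<kappa>, \<gamma> \<kappa>) | \<kappa>. \<kappa> \<in> S \<and> cf \<kappa> \<noteq> 0})"
      proof -
        let ?N = "(D - {(i0, j0), (i2, j2)}) \<union> {(i2, j0)}"
        have "{(i, j) \<in> D. (i, j, 1) \<notin> S} = D - {(i0, j0), (i2, j2)}"
          using D(3) unfolding S_def x0_def x1_def x2_def by auto
        moreover have "{(fst \<kappa>, \<gamma> \<kappa>) | \<kappa>. \<kappa> \<in> S \<and> cf \<kappa> \<noteq> 0} = {(i2, j0)}"
          using ne unfolding S_def cf_def \<gamma>_def by (auto simp: x2_def)
        moreover have "D \<union> {(i2, j0)} = insert (i0, j0) (insert (i2, j2) ?N)" using D by auto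
        moreover have "maxset (insert (i0, j0) (insert (i2, j2) ?N)) = maxset (insert (i2, j2) ?N)"
          using lt by (intro maxset_insert_below[of _ "(i2, j0)"]) (auto simp: pair_less_iff)
        moreover have "maxset (insert (i2, j2) ?N) = maxset ?N"
          using lt by (intro maxset_insert_below[of _ "(i2, j0)"]) (auto simp: pair_less_iff)
        ultimately show ?thesis by simp
      qed
      ultimately show "\<exists>u cf.
      (\<forall>\<kappa>\<in>?I - S. u \<kappa> = v \<kappa>) \<and>
      (\<forall>i. span (u ` {\<iota> \<in> ?I. fst \<iota> \<le> i}) = span (v ` {\<iota> \<in> ?I. fst \<iota> \<le> i})) \<and>
      (\<forall>j. span (u ` {\<iota> \<in> ?I. \<gamma> \<iota> \<le> j}) = span ((\<lambda>\<iota>. v \<iota> + \<tau> *s v' \<iota>) ` {\<iota> \<in> ?I. fst (snd \<iota>) \<le> j})) \<and>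
      (\<Sum>\<kappa>\<in>{\<kappa> \<in> S. \<kappa> \<in> (\<lambda>(i, j). (i, j, 1)) ` D}. v \<kappa>) + \<tau> *s 0 = (\<Sum>\<kappa>\<in>S. cf \<kappa> *s u \<kappa>) \<and>
      maxset (D \<union> {(i2, j0)}) = maxset ({(i, j) \<in> D. (i, j, 1) \<notin> S} \<union> {(fst \<kappa>, \<gamma> \<kappa>) | \<kappa>. \<kappa> \<in> S \<and> cf \<kappa> \<noteq> 0})"
        using B C us(4) unfolding w_def[abs_def] by (intro exI[of _ u] exI[of _ cf] conjI allI ballI) auto
    qed
  qed
qed

text \<open>Both flags stay fixed, and only the line moves, in the direction of a basis vector at
  the added position.\<close>

lemma deg_le_add:
  assumes inf: "infinite (UNIV :: 'a set)"
    and n: "composition (dim (UNIV :: 'b set)) b" "composition (dim (UNIV :: 'b set)) c"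
    and M: "decorated b c (M, D)" and p: "(i1, j1) \<notin> D" "0 < M (i1, j1)"
    and D1: "maxset (D \<union> {(i1, j1)}) \<noteq> {}"
  shows "deg_le b c (M, D) (M, maxset (D \<union> {(i1, j1)}))"
proof -
  let ?I = "index_set (length b) (length c) M" and ?x = "(i1, j1, 1 :: nat)"
  have tr: "transport b c M" using M by (simp add: decorated_iff del: decorated.simps)
  show ?thesis
  proof (rule deg_leI_special[where S = "{?x}" and \<gamma> = "fst \<circ> snd", OF inf n M D1])
    show "{?x} \<subseteq> ?I" using transport_outside[OF tr p(2)] p(2) unfolding index_set_def by auto
    show "(fst \<circ> snd) \<kappa> \<in> {1..length c}" if "\<kappa> \<in> {?x}" for \<kappa>
      using that transport_outside[OF tr p(2)] by auto
    fix v
    have eq: "{\<kappa> \<in> {?x}. \<kappa> \<in> (\<lambda>(i, j). (i, j, 1)) ` D} = {}"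
      "{(i, j) \<in> D. (i, j, 1) \<notin> {?x}} = D" using p(1) by auto
    show "\<exists>a' v'. \<forall>\<tau>. \<tau> \<noteq> 0 \<longrightarrow> (\<exists>u cf.
      (\<forall>\<kappa>\<in>?I - {?x}. u \<kappa> = v \<kappa>) \<and>
      (\<forall>i. span (u ` {\<iota> \<in> ?I. fst \<iota> \<le> i}) = span (v ` {\<iota> \<in> ?I. fst \<iota> \<le> i})) \<and>
      (\<forall>j. span (u ` {\<iota> \<in> ?I. (fst \<circ> snd) \<iota> \<le> j}) = span ((\<lambda>\<iota>. v \<iota> + \<tau> *s v' \<iota>) ` {\<iota> \<in> ?I. fst (snd \<iota>) \<le> j})) \<and>
      (\<Sum>\<kappa>\<in>{\<kappa> \<in> {?x}. \<kappa> \<in> (\<lambda>(i, j). (i, j, 1)) ` D}. v \<kappa>) + \<tau> *s a' = (\<Sum>\<kappa>\<in>{?x}. cf \<kappa> *s u \<kappa>) \<and>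
      maxset (D \<union> {(i1, j1)}) = maxset ({(i, j) \<in> D. (i, j, 1) \<notin> {?x}} \<union> {(fst \<kappa>, (fst \<circ> snd) \<kappa>) | \<kappa>. \<kappa> \<in> {?x} \<and> cf \<kappa> \<noteq> 0}))"
      unfolding eq
    proof (rule exI[of _ "v ?x"], rule exI[of _ "\<lambda>_. 0"], intro allI impI)
      fix \<tau> :: 'a assume \<tau>: "\<tau> \<noteq> 0"
      then have "{(fst \<kappa>, (fst \<circ> snd) \<kappa>) | \<kappa>. \<kappa> \<in> {?x} \<and> \<tau> \<noteq> 0} = {(i1, j1)}" by auto
      then show "\<exists>u cf. (\<forall>\<kappa>\<in>?I - {?x}. u \<kappa> = v \<kappa>) \<and>
      (\<forall>i. span (u ` {\<iota> \<in> ?I. fst \<iota> \<le> i}) = span (v ` {\<iota> \<in> ?I. fst \<iota> \<le> i})) \<and>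
      (\<forall>j. span (u ` {\<iota> \<in> ?I. (fst \<circ> snd) \<iota> \<le> j}) = span ((\<lambda>\<iota>. v \<iota> + \<tau> *s 0) ` {\<iota> \<in> ?I. fst (snd \<iota>) \<le> j})) \<and>
      (\<Sum>\<kappa>\<in>{}. v \<kappa>) + \<tau> *s v ?x = (\<Sum>\<kappa>\<in>{?x}. cf \<kappa> *s u \<kappa>) \<and>
      maxset (D \<union> {(i1, j1)}) = maxset (D \<union> {(fst \<kappa>, (fst \<circ> snd) \<kappa>) | \<kappa>. \<kappa> \<in> {?x} \<and> cf \<kappa> \<noteq> 0})"
        by (intro exI[of _ v] exI[of _ "\<lambda>_. \<tau>"]) simp
    qed
  qed auto
qed

lemma deg_le_chain_v:
  assumes inf: "infinite (UNIV :: 'a set)"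
    and n: "composition (dim (UNIV :: 'b set)) b" "composition (dim (UNIV :: 'b set)) c"
    and M: "decorated b c (M, D)"
    and t: "1 \<le> t" and i: "strict_mono_on {0..t} i" and j: "strict_antimono_on {1..t} j"
    and jt: "j 0 < j t" and inD: "\<And>s. s \<in> {1..t} \<Longrightarrow> (i s, j s) \<in> D" and pos: "0 < M (i 0, j 0)"
    and e: "(i 0, j 0) \<notin> D"
  defines "D1 \<equiv> maxset ((D - (\<lambda>s. (i s, j s)) ` {0..t}) \<union> {(i 0, j 1), (i t, j 0)})"
  assumes D1: "D1 \<noteq> {}"
  shows "deg_le b c (M, D) (chain_mat M i j t, D1)"
proof -
  \<comment> \<open>In the chain basis the decorated sum of the vectors \<open>1..t\<close> is the
    last vector minus the vector of index 0, divided by \<open>\<tau>\<close>. So the fixed line has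
    support at \<open>(i 0, j 1)\<close> and \<open>(i t, j 0)\<close>.\<close>
  define cs where "cs \<tau> s = (if s = t then inverse \<tau> else if s = 0 then - inverse \<tau> else 0)" for \<tau> :: 'a and s
  have posD: "0 < M p" if "p \<in> D" for p
    using M that by (simp add: decorated_iff del: decorated.simps)
  have mem: "(x, y, m) \<in> (\<lambda>(i, j). (i, j, 1)) ` D \<longleftrightarrow> (x, y) \<in> D \<and> m = (1 :: nat)" for x y m
    by (auto intro: image_eqI[of _ _ "(x, y)"])
  have inD_iff: "s \<le> t \<and> (i s, j s) \<in> D \<longleftrightarrow> s \<in> {1..t}" for s
    using inD e by (cases s) auto
  show ?thesis
  proof (rule deg_le_chain[where k = "\<lambda>_. 1" and a' = "\<lambda>_. 0" and cs = cs, OF inf n M D1 t i j jt])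
    fix s assume "s \<le> t"
    then have "0 < M (i s, j s)" using pos posD inD[of s] by (cases s) auto
    then show "1 \<le> (1 :: nat) \<and> 1 \<le> M (i s, j s)" by simp
  next
    fix v :: "nat \<times> nat \<times> nat \<Rightarrow> 'b" and \<tau> assume \<tau>: "\<tau> \<noteq> (0 :: 'a)"
    have eq: "{s. s \<le> t \<and> (i s, j s, 1 :: nat) \<in> (\<lambda>(i, j). (i, j, 1)) ` D} = {1..t}"
    proof -
      have "s \<le> t \<and> (i s, j s) \<in> D \<and> (1 :: nat) = 1 \<longleftrightarrow> s \<in> {1..t}" for s
        using inD_iff[of s] by blast
      then show ?thesis unfolding mem by (simp only: Collect_mem_eq)
    qed
    let ?f = "\<lambda>s. cs \<tau> s *s (v (i 0, j 0, 1) + \<tau> *s (\<Sum>s'\<in>{1..s}. v (i s', j s', 1)))"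
    have "(\<Sum>s\<le>t. ?f s) = (\<Sum>s\<in>{0, t}. ?f s)"
      by (rule sum.mono_neutral_right) (auto simp: cs_def)
    also have "\<dots> = (\<Sum>s\<in>{1..t}. v (i s, j s, 1))"
      using t \<tau> by (simp add: cs_def scale_right_distrib)
    finally show "(\<Sum>s | s \<le> t \<and> (i s, j s, 1 :: nat) \<in> (\<lambda>(i, j). (i, j, 1)) ` D. v (i s, j s, 1)) + \<tau> *s 0
      = (\<Sum>s\<le>t. ?f s)" unfolding eq by simp
  next
    fix \<tau> assume \<tau>: "\<tau> \<noteq> (0 :: 'a)"
    have "{(x, y) \<in> D. (x, y, 1 :: nat) \<notin> (\<lambda>s. (i s, j s, 1)) ` {..t}} = D - (\<lambda>s. (i s, j s)) ` {0..t}"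
      by auto
    moreover have "{(i s, if s = t then j 0 else j (Suc s)) | s. s \<le> t \<and> cs \<tau> s \<noteq> 0} = {(i 0, j 1), (i t, j 0)}"
    proof -
      have "s \<le> t \<and> cs \<tau> s \<noteq> 0 \<longleftrightarrow> s = 0 \<or> s = t" for s using t \<tau> by (auto simp: cs_def)
      then have "{(i s, if s = t then j 0 else j (Suc s)) | s. s \<le> t \<and> cs \<tau> s \<noteq> 0}
          = (\<lambda>s. (i s, if s = t then j 0 else j (Suc s))) ` {0, t}" by blast
      then show ?thesis using t by simp
    qed
    ultimately show "D1 = maxset ({(x, y) \<in> D. (x, y, 1 :: nat) \<notin> (\<lambda>s. (i s, j s, 1)) ` {..t}} \<union>
      {(i s, if s = t then j 0 else j (Suc s)) | s. s \<le> t \<and> cs \<tau> s \<noteq> 0})"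
      unfolding D1_def by simp
  qed
qed

text \<open>The swaps fall into two kinds: \<open>keep\<close> leaves the decoration unchanged, for
  (ii) and (iv)(b), (c); \<open>add\<close> moves the decorated vector itself, for (iii).\<close>

lemma simple_move_deg_le:
  assumes inf: "infinite (UNIV :: 'a set)"
    and n: "composition (dim (UNIV :: 'b set)) b" "composition (dim (UNIV :: 'b set)) c"
    and X: "decorated b c X" and move: "simple_move X Y"
  shows "decorated b c Y \<and> deg_le b c X Y"
proof -
  have ne: "maxset (D \<union> S) \<noteq> {}" if M: "decorated b c (M, D)" and S: "finite S" for M D S
  proof -
    have D: "D \<noteq> {}" "\<And>p. p \<in> D \<Longrightarrow> 0 < M p" and tr: "transport b c M"
      using M by (simp_all add: decorated_iff del: decorated.simps)
    have "D \<subseteq> {..length b} \<times> {..length c}" using transport_outside[OF tr D(2)] by (auto simp: subset_iff)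
    then have fin: "finite (D \<union> S)" using finite_subset[of D "{..length b} \<times> {..length c}"] S by simp
    obtain x y where "(x, y) \<in> D" using D(1) by auto
    then show ?thesis using ex_maxset_above[OF fin, of x y] by auto
  qed
  have keep: "decorated b c (swap_mat M i0 j0 i1 j1, D) \<and> deg_le b c (M, D) (swap_mat M i0 j0 i1 j1, D)"
    if M: "decorated b c (M, D)" and lt: "i0 < i1" "j0 < j1" and pos: "0 < M (i0, j0)" "0 < M (i1, j1)"
      and f: "(i1, j1) \<notin> D" and e: "(i0, j0) \<notin> D \<or> 1 < M (i0, j0)" for M D i0 j0 i1 j1
  proof
    have D: "D \<noteq> {}" "antichain D" "\<And>p. p \<in> D \<Longrightarrow> 0 < M p"
      using M by (simp_all add: decorated_iff del: decorated.simps)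
    show "decorated b c (swap_mat M i0 j0 i1 j1, D)"
    proof (rule decoratedI_swap[OF M lt pos D(1,2)])
      fix p assume "p \<in> D"
      then show "0 < swap_mat M i0 j0 i1 j1 p"
        using swap_mat_balance[OF pos lt(1), of p] D(3)[of p] e f by (auto simp: E_def split: if_splits)
    qed
    \<comment> \<open>The last copy at \<open>(i0, j0)\<close> is the one moved; if that is copy 1,
      the entry is 1 and \<open>e\<close> says that the position is undecorated.\<close>
    have e': "\<not> ((i0, j0) \<in> D \<and> M (i0, j0) = 1)" using e by auto
    have "D = maxset (if M (i0, j0) = 1 then D - {(i0, j0)} else D)"
      using e' maxset_antichain[OF D(2)] by (cases "(i0, j0) \<in> D") simp_all
    then show "deg_le b c (M, D) (swap_mat M i0 j0 i1 j1, D)"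
      using e' pos f
      by (intro deg_le_swap[where ?k0.0 = "M (i0, j0)" and a' = "\<lambda>_. 0" and cs = "\<lambda>_. 0", OF inf n M D(1) lt]) (simp_all, blast)
  qed
  have add: "decorated b c (swap_mat M i0 j0 i1 j1, maxset (D \<union> {p}))
      \<and> deg_le b c (M, D) (swap_mat M i0 j0 i1 j1, maxset (D \<union> {p}))"
    if M: "decorated b c (M, D)" and lt: "i0 < i1" "j0 < j1" and pos: "0 < M (i1, j1)"
      and e: "(i0, j0) \<in> D" "M (i0, j0) = 1" and p: "p = (i0, j1) \<or> p = (i1, j0)" for M D i0 j0 i1 j1 p
  proof
    have D: "D \<noteq> {}" "antichain D" "\<And>p. p \<in> D \<Longrightarrow> 0 < M p"
      using M by (simp_all add: decorated_iff del: decorated.simps)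
    have pos0: "0 < M (i0, j0)" using e by simp
    have f: "(i1, j1) \<notin> D" using antichainD[OF D(2) e(1), of i1 j1] lt by auto
    have ep: "(i0, j0) < p" using p lt by (auto simp: pair_less_iff)
    have ne': "maxset (D \<union> {p}) \<noteq> {}" by (rule ne[OF M]) simp
    show "decorated b c (swap_mat M i0 j0 i1 j1, maxset (D \<union> {p}))"
    proof (rule decoratedI_swap[OF M lt pos0 pos ne' antichain_maxset])
      fix x assume x: "x \<in> maxset (D \<union> {p})"
      show "0 < swap_mat M i0 j0 i1 j1 x"
      proof (cases "x = p")
        case True then show ?thesis using p by (auto simp: swap_mat_def E_def)
      next
        case False
        then have "x \<in> D" "x \<noteq> (i0, j0)" using x ep by (auto simp: maxset_def)
        then show ?thesis
          using swap_mat_balance[OF pos0 pos lt(1), of x] D(3)[of x] f by (auto simp: E_def split: if_splits)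
      qed
    qed
    have drop: "maxset (D \<union> {p}) = maxset ((D - {(i0, j0)}) \<union> {p})"
    proof -
      have "D \<union> {p} = insert (i0, j0) ((D - {(i0, j0)}) \<union> {p})" using e by auto
      then show ?thesis using maxset_insert_below[OF ep, of "(D - {(i0, j0)}) \<union> {p}"] by simp
    qed
    show "deg_le b c (M, D) (swap_mat M i0 j0 i1 j1, maxset (D \<union> {p}))"
    proof (cases "p = (i0, j1)")
      case True
      \<comment> \<open>The line stays fixed: its moving part is the new basis vector of index 0,
        now at \<open>(i0, j1)\<close>.\<close>
      show ?thesis
        by (rule deg_le_swap[where ?k0.0 = 1 and a' = "\<lambda>_. 0" and cs = "\<lambda>s. of_bool (s = 0)", OF inf n M ne' lt])
          (use e pos f drop True in auto)
    next
      case False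
      then have p': "p = (i1, j0)" using p by simp
      \<comment> \<open>The line follows the curve: its moving part becomes the new basis vector of
        index 1, at \<open>(i1, j0)\<close>.\<close>
      show ?thesis
        by (rule deg_le_swap[where ?k0.0 = 1 and a' = "\<lambda>v. v (i1, j1, 1)" and cs = "\<lambda>s. of_bool (s = 1)",
              OF inf n M ne' lt]) (use e pos f drop p' in auto)
    qed
  qed
  show ?thesis
    using move X
  proof (induction rule: simple_move.induct)
    case (i i1 j1 D M)
    have D: "antichain D" "\<And>p. p \<in> D \<Longrightarrow> 0 < M p" and tr: "transport b c M"
      using i.prems by (simp_all add: decorated_iff del: decorated.simps)
    have ne': "maxset (D \<union> {(i1, j1)}) \<noteq> {}" by (rule ne[OF i.prems]) simp
    have "0 < M p" if "p \<in> maxset (D \<union> {(i1, j1)})" for p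
      using subsetD[OF maxset_subset that] D(2)[of p] i.hyps(2) by auto
    then have "decorated b c (M, maxset (D \<union> {(i1, j1)}))"
      using tr ne' by (simp add: decorated_iff antichain_maxset del: decorated.simps)
    moreover have "(i1, j1) \<notin> D" using i.hyps(1) by (auto simp: below_iff)
    ultimately show ?case using deg_le_add[OF inf n i.prems _ i.hyps(2) ne'] by blast
  next
    case (ii i0 i1 j0 j1 M D)
    then show ?case using keep[of M D i0 i1 j0 j1] unfolding swap_mat_def by blast
  next
    case (iii_a i0 i1 j0 j1 D M)
    then show ?case using add[of M D i0 i1 j0 j1 "(i0, j1)"] unfolding swap_mat_def by blast
  next
    case (iii_b i0 i1 j0 j1 D M)
    then show ?case using add[of M D i0 i1 j0 j1 "(i1, j0)"] unfolding swap_mat_def by blast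
  next
    case (iv_a i0 i2 i1 j2 j0 j1 D M)
    have M: "decorated b c (M, D)" by (rule iv_a.prems)
    have D: "antichain D" "\<And>p. p \<in> D \<Longrightarrow> 0 < M p"
      using M by (simp_all add: decorated_iff del: decorated.simps)
    note lt = iv_a.hyps(1-4)
    have f: "(i1, j1) \<notin> D" using antichainD[OF D(1) iv_a.hyps(5), of i1 j1] lt by auto
    have pos: "0 < M (i0, j0)" "0 < M (i1, j1)" "0 < M (i2, j2)" using iv_a.hyps by simp_all
    have ne': "maxset (D \<union> {(i2, j0)}) \<noteq> {}" by (rule ne[OF M]) simp
    have "decorated b c (cyc_mat M i0 j0 i2 j2 i1 j1, maxset (D \<union> {(i2, j0)}))"
    proof (rule decoratedI_cyc[OF M lt pos ne' antichain_maxset])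
      fix x assume x: "x \<in> maxset (D \<union> {(i2, j0)})"
      show "0 < cyc_mat M i0 j0 i2 j2 i1 j1 x"
      proof (cases "x = (i2, j0)")
        case True then show ?thesis by (auto simp: cyc_mat_def E_def)
      next
        case False
        moreover have "(i0, j0) < (i2, j0)" "(i2, j2) < (i2, j0)" using lt by (auto simp: pair_less_iff)
        ultimately have "x \<in> D" "x \<noteq> (i0, j0)" "x \<noteq> (i2, j2)" using x by (auto simp: maxset_def)
        then show ?thesis
          using cyc_mat_balance[OF pos lt(1,2), of x] D(2)[of x] f by (auto simp: E_def split: if_splits)
      qed
    qed
    then show ?case
      using deg_le_cyc[OF inf n M lt iv_a.hyps(5,6) f pos(2)] unfolding cyc_mat_def by blast
  next
    case (iv_b i0 i1 j0 j1 M i2 D)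
    have "antichain D" using iv_b.prems by (simp add: decorated_iff del: decorated.simps)
    then have "(i1, j1) \<notin> D" "(i0, j0) \<notin> D"
      using antichainD[of D i2 j0 i1 j1] antichainD[of D i0 j0 i2 j0] iv_b.hyps by auto
    then show ?case using keep[OF iv_b.prems iv_b.hyps(1-4)] unfolding swap_mat_def by blast
  next
    case (iv_c i0 i1 j0 j1 M j2 D)
    have "antichain D" using iv_c.prems by (simp add: decorated_iff del: decorated.simps)
    then have "(i1, j1) \<notin> D" "(i0, j0) \<notin> D"
      using antichainD[of D i0 j2 i1 j1] antichainD[of D i0 j0 i0 j2] iv_c.hyps by auto
    then show ?case using keep[OF iv_c.prems iv_c.hyps(1-4)] unfolding swap_mat_def by blast
  next
    case (v t i j D M)
    have M: "decorated b c (M, D)" by (rule v.prems)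
    have D: "antichain D" "\<And>p. p \<in> D \<Longrightarrow> 0 < M p"
      using M by (simp_all add: decorated_iff del: decorated.simps)
    have inD: "(i s, j s) \<in> D" if "s \<in> {1..t}" for s using v.hyps(5) that by blast
    have i0: "i 0 < i t" using strict_mono_onD[OF v.hyps(2), of 0 t] v.hyps(1) by auto
    have e: "(i 0, j 0) \<notin> D"
      using antichainD[OF D(1), of "i 0" "j 0" "i t" "j t"] inD[of t] i0 v.hyps(1,4) by auto
    have pos: "0 < M (i s, j s)" if "s \<le> t" for s
      using that v.hyps(6) D(2) inD[of s] by (cases s) auto
    let ?I = "(\<lambda>s. (i s, j s)) ` {0..t}"
    let ?S = "(D - ?I) \<union> {(i 0, j 1), (i t, j 0)}"
    have ne': "maxset ?S \<noteq> {}"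
    proof -
      have "D \<subseteq> {..length b} \<times> {..length c}"
        using transport_outside[of b c M, OF _ D(2)] M by (auto simp: subset_iff decorated_iff simp del: decorated.simps)
      then have "finite ?S" using finite_subset[of D "{..length b} \<times> {..length c}"] by simp
      from ex_maxset_above[OF this, of "i 0" "j 1"] show ?thesis by auto
    qed
    have "decorated b c (chain_mat M i j t, maxset ?S)"
    proof (rule decoratedI_chain[OF M v.hyps(1-4) pos ne' antichain_maxset])
      fix p assume "p \<in> maxset ?S"
      then have "p \<in> ?S" using maxset_subset by blast
      then consider "p = (i 0, j 1)" | "p = (i t, j 0)" | "p \<in> D" "p \<notin> ?I" by blast
      then show "0 < chain_mat M i j t p"
      proof cases
        case 3
        then have "(\<Sum>s\<le>t. E (i s, j s) p) = 0" by (auto simp: E_def)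
        then show ?thesis
          using chain_mat_balance[where M = M and i = i and j = j and x = p, OF v.hyps(2) pos] D(2)[OF 3(1)] by simp
      qed (auto simp: chain_mat_def E_def)
    qed
    then show ?case
      using deg_le_chain_v[OF inf n M v.hyps(1-4) inD v.hyps(6) e ne'] unfolding chain_mat_def by blast
  qed
qed

lemma deg_le_trans: "deg_le b c X Y \<Longrightarrow> deg_le b c Y Z \<Longrightarrow> deg_le b c X Z"
  unfolding deg_le_def zariski_closure_def by (rule subset_trans, assumption, subst (2) hull_hull[symmetric], rule hull_mono)

lemma move_le_imp_deg_le:
  assumes inf: "infinite (UNIV :: 'a set)"
    and n: "composition (dim (UNIV :: 'b set)) b" "composition (dim (UNIV :: 'b set)) c"
    and X: "decorated b c X" and move: "move_le X Y"
  shows "deg_le b c X Y"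
proof -
  have "decorated b c Y \<and> deg_le b c X Y"
    using move unfolding move_le_def
  proof (induction rule: rtranclp_induct)
    case base
    show ?case using X by (simp add: deg_le_def zariski_closure_def hull_subset)
  next
    case (step Y Z)
    then show ?case using simple_move_deg_le[OF inf n _ step(2)] deg_le_trans by blast
  qed
  then show ?thesis ..
qed

end

theorem mainTheorem2:
  fixes scale :: "'k::field \<Rightarrow> 'v::ab_group_add \<Rightarrow> 'v"
    and Basis :: "'v set"
    and n :: nat and b c :: "nat list"
    and M M' :: posmat and \<Delta> \<Delta>' :: "pos set"
  assumes "infinite (UNIV :: 'k set)"
    and "finite_dimensional_vector_space scale Basis"
    and "vector_space.dim scale (UNIV :: 'v set) = n"
    and "composition n b" and "composition n c"
    and "decorated b c (M, \<Delta>)" and "decorated b c (M', \<Delta>')"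
  shows "vector_space.deg_le scale b c (M, \<Delta>) (M', \<Delta>') \<longleftrightarrow> move_le (M, \<Delta>) (M', \<Delta>')"
proof -
  interpret finite_dimensional_vector_space scale Basis by (rule assms(2))
  have n: "composition (dim (UNIV :: 'v set)) b" "composition (dim (UNIV :: 'v set)) c"
    unfolding assms(3) by (rule assms(4), rule assms(5))
  show ?thesis
    using deg_le_imp_rank_pair[OF n assms(6,7), THEN rank_pair_imp_move_le]
      move_le_imp_deg_le[OF assms(1) n assms(6)]
    by blast
qed

end
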